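(* Let $p$ be an odd prime and let $G$ be a group of order $p^5$ with $|G'|\ge p^2$. Then $|\mathcal{M}(G)|\neq p^{5}$; that is, no such group satisfies $|\mathcal{M}(G)|=p^{\frac12\cdot 5\cdot 4-5}$.
   Context: $\mathcal{M}(G)$ denotes the Schur multiplier of $G$ and $G'$ the derived subgroup. *)

theory Defs
  imports "HOL-Algebra.Algebra" Complex_Main
begin

text \<open>Schur multiplier of a finite group G, in Schur's original form
  M(G) = H^2(G, C^*) (trivial action): normalised-support 2-cocycles
  G x G -> C^* modulo 2-coboundaries.\<close>

definition schur_cocycles :: "('a, 'b) monoid_scheme \<Rightarrow> ('a \<Rightarrow> 'a \<Rightarrow> complex) set" where
  "schur_cocycles G = {f.
     (\<forall>x y. f x y \<noteq> 0) \<and>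
     (\<forall>x y. (x \<notin> carrier G \<or> y \<notin> carrier G) \<longrightarrow> f x y = 1) \<and>
     (\<forall>x\<in>carrier G. \<forall>y\<in>carrier G. \<forall>z\<in>carrier G.
        f x y * f (x \<otimes>\<^bsub>G\<^esub> y) z = f y z * f x (y \<otimes>\<^bsub>G\<^esub> z))}"

definition schur_coboundary :: "('a, 'b) monoid_scheme \<Rightarrow> ('a \<Rightarrow> 'a \<Rightarrow> complex) \<Rightarrow> bool" where
  "schur_coboundary G f \<longleftrightarrow> (\<exists>g :: 'a \<Rightarrow> complex. (\<forall>x\<in>carrier G. g x \<noteq> 0) \<and>
     (\<forall>x\<in>carrier G. \<forall>y\<in>carrier G. f x y = g x * g y / g (x \<otimes>\<^bsub>G\<^esub> y)))"

definition cohomologous :: "('a, 'b) monoid_scheme \<Rightarrow> ('a \<Rightarrow> 'a \<Rightarrow> complex) rel" where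
  "cohomologous G = {(f, f'). f \<in> schur_cocycles G \<and> f' \<in> schur_cocycles G \<and>
     schur_coboundary G (\<lambda>x y. f x y / f' x y)}"

definition schur_multiplier :: "('a, 'b) monoid_scheme \<Rightarrow> ('a \<Rightarrow> 'a \<Rightarrow> complex) set set" where
  "schur_multiplier G = schur_cocycles G // cohomologous G"

definition schur_multiplier_order :: "('a, 'b) monoid_scheme \<Rightarrow> nat" where
  "schur_multiplier_order G = card (schur_multiplier G)"

end

theory Submission
  imports Defs
begin

text \<open>
  For a central element \<open>z\<close> of order \<open>p\<close> a cocycle \<open>f\<close> gives the character
  \<open>g \<mapsto> f(g, z) / f(z, g)\<close> of \<open>G\<close>, the commutator of lifts of \<open>g\<close> and \<open>z\<close> in the central
  extension defined by \<open>f\<close>. The classes with trivial character are inflated from \<open>G / \<langle>z\<rangle>\<close>, and if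
  \<open>z \<in> G'\<close> then inflation has a kernel of order \<open>p\<close>. Hence
  \<open>p |M(G)| \<le> |M(G/\<langle>z\<rangle>)| [G : S]\<close> for every subgroup \<open>S\<close> on which all these characters vanish.
  Iterating with \<open>S\<close> the Frattini subgroup gives \<open>|M(G)| \<le> p\<^sup>4\<close> if \<open>G\<close> has two generators.
  Otherwise \<open>|G'| = p\<^sup>2\<close> and \<open>G/G'\<close> is elementary abelian, and identities between commutators in
  the central extension produce an \<open>S\<close> of index \<open>p\<close>, so that again \<open>|M(G)| \<le> p\<^sup>4\<close>, unless \<open>G\<close> has
  class two and exponent \<open>p\<close>. In that last case explicit cocycles show that \<open>|M(G)| \<ge> p\<^sup>6\<close>.
\<close>

section \<open>Finite p-groups\<close>

text \<open>For a three-generator group the iteration with \<open>S = G'\<close> stops at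
  \<open>p^6\<close>: the quotient of order \<open>p^4\<close> contributes \<open>p^4\<close>, the
  characters of \<open>G / G'\<close> contribute \<open>p^3\<close>, and the kernel of inflation
  removes one \<open>p\<close>. This value is attained in class two and exponent \<open>p\<close>,
  so no upper bound can exclude \<open>p^5\<close> there and a lower bound has to jump over it. In
  the other cases the index of \<open>S\<close> must drop from \<open>p^3\<close> to
  \<open>p\<close>. The choice of \<open>z\<close> achieves this: it is a commutator or a
  \<open>p\<close>-th power, so that commutator identities or common roots force many lifts to
  commute with a lift of \<open>z\<close>. Oddness of \<open>p\<close> enters in class two, where it
  makes \<open>x \<mapsto> x^p\<close> a homomorphism and the factor 2 in the cocycles invertible.
  The cardinality of an infinite set is 0, so every upper bound comes together with finiteness of
  the multiplier. The comparison with the quotient is an injection of sets, so the multiplier is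
  only counted as a set of classes.\<close>

definition center :: "('a, 'b) monoid_scheme \<Rightarrow> 'a set" where
  "center G = {z \<in> carrier G. \<forall>g\<in>carrier G. g \<otimes>\<^bsub>G\<^esub> z = z \<otimes>\<^bsub>G\<^esub> g}"

definition centralizer :: "('a, 'b) monoid_scheme \<Rightarrow> 'a \<Rightarrow> 'a set" where
  "centralizer G a = {g \<in> carrier G. g \<otimes>\<^bsub>G\<^esub> a = a \<otimes>\<^bsub>G\<^esub> g}"

definition commutator :: "('a, 'b) monoid_scheme \<Rightarrow> 'a \<Rightarrow> 'a \<Rightarrow> 'a" where
  "commutator G x y = x \<otimes>\<^bsub>G\<^esub> y \<otimes>\<^bsub>G\<^esub> inv\<^bsub>G\<^esub> x \<otimes>\<^bsub>G\<^esub> inv\<^bsub>G\<^esub> y"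

section \<open>Centre, centralizers and commutators\<close>

context group
begin

lemma center_closed: "z \<in> center G \<Longrightarrow> z \<in> carrier G"
  by (simp add: center_def)

lemma center_comm: "z \<in> center G \<Longrightarrow> g \<in> carrier G \<Longrightarrow> g \<otimes> z = z \<otimes> g"
  by (simp add: center_def)

lemma inv_commute:
  assumes "x \<in> carrier G" "y \<in> carrier G" "x \<otimes> y = y \<otimes> x"
  shows "inv x \<otimes> y = y \<otimes> inv x"
  using assms by (metis inv_closed inv_solve_left m_assoc r_inv r_one m_closed)

lemma subgroup_centralizer:
  assumes "a \<in> carrier G"
  shows "subgroup (centralizer G a) G"
proof (rule subgroupI)
  show "centralizer G a \<noteq> {}" using assms by (auto simp: centralizer_def)
next
  fix x y assume "x \<in> centralizer G a" "y \<in> centralizer G a"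
  then show "x \<otimes> y \<in> centralizer G a"
    using assms unfolding centralizer_def by (auto simp: m_assoc) (metis m_assoc)
qed (use assms inv_commute in \<open>auto simp: centralizer_def\<close>)

lemma subgroup_center: "subgroup (center G) G"
proof (rule subgroupI)
  fix x y assume xy: "x \<in> center G" "y \<in> center G"
  show "x \<otimes> y \<in> center G"
    unfolding center_def
  proof (intro CollectI conjI ballI)
    fix g assume g: "g \<in> carrier G"
    show "g \<otimes> (x \<otimes> y) = x \<otimes> y \<otimes> g"
      using g xy by (metis center_closed center_comm m_assoc)
  qed (use xy center_closed in simp)
next
  fix x assume x: "x \<in> center G"
  have "g \<otimes> inv x = inv x \<otimes> g" if "g \<in> carrier G" for g
    using inv_commute[of x g] x that center_closed[of x] center_comm[of x g] by simp
  then show "inv x \<in> center G"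
    using x center_closed[of x] unfolding center_def[of G] by simp
qed (auto simp: center_def)

lemma commutator_closed [simp]:
  "x \<in> carrier G \<Longrightarrow> y \<in> carrier G \<Longrightarrow> commutator G x y \<in> carrier G"
  by (simp add: commutator_def)

lemma commutator_in_derived:
  "x \<in> carrier G \<Longrightarrow> y \<in> carrier G \<Longrightarrow> commutator G x y \<in> derived G (carrier G)"
  unfolding commutator_def derived_def by (rule generate.incl) blast

lemma mult_eq_commutator:
  assumes "x \<in> carrier G" "y \<in> carrier G"
  shows "x \<otimes> y = commutator G x y \<otimes> (y \<otimes> x)"
proof -
  have "commutator G x y \<otimes> (y \<otimes> x) = x \<otimes> y \<otimes> inv x \<otimes> (inv y \<otimes> y) \<otimes> x"
    using assms by (simp only: commutator_def m_assoc m_closed inv_closed)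
  then show ?thesis using assms by (simp add: m_assoc)
qed

lemma commutator_unique:
  assumes "x \<in> carrier G" "y \<in> carrier G" "c \<in> carrier G" "x \<otimes> y = c \<otimes> (y \<otimes> x)"
  shows "commutator G x y = c"
  using assms mult_eq_commutator[of x y] by (metis commutator_closed m_closed r_cancel)

lemma commutator_eq_one_iff:
  assumes "x \<in> carrier G" "y \<in> carrier G"
  shows "commutator G x y = \<one> \<longleftrightarrow> x \<otimes> y = y \<otimes> x"
  using assms commutator_unique[of x y \<one>] mult_eq_commutator[of x y] by auto

lemma derived_subset_iff:
  assumes "subgroup S G"
  shows "derived G (carrier G) \<subseteq> S \<longleftrightarrow>
    (\<forall>x\<in>carrier G. \<forall>y\<in>carrier G. commutator G x y \<in> S)"
proof
  assume "\<forall>x\<in>carrier G. \<forall>y\<in>carrier G. commutator G x y \<in> S"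
  then show "derived G (carrier G) \<subseteq> S"
    unfolding derived_def commutator_def
    by (intro generate_subgroup_incl[OF _ assms]) blast
qed (use commutator_in_derived in blast)

lemma subgroup_derived: "subgroup (derived G (carrier G)) G"
  by (rule derived_is_subgroup) simp

lemma derived_closed: "x \<in> derived G (carrier G) \<Longrightarrow> x \<in> carrier G"
  using subgroup.subset[OF subgroup_derived] by blast

lemma comm_if_derived_trivial:
  assumes "derived G (carrier G) = {\<one>}" "x \<in> carrier G" "y \<in> carrier G"
  shows "x \<otimes> y = y \<otimes> x"
  using assms commutator_in_derived[of x y] commutator_eq_one_iff[of x y] by auto

text \<open>Translating a fibre by the inverse of one of its elements embeds it in \<open>S\<close>.
  This serves as an index bound for maps that are not homomorphisms, such as
  \<open>h \<mapsto> commutator G h x\<close>.\<close>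

lemma card_le_fibres:
  assumes S: "subgroup S G" and fin: "finite (carrier G)" "finite B"
    and B: "\<phi> ` carrier G \<subseteq> B"
    and fib: "\<And>x y. x \<in> carrier G \<Longrightarrow> y \<in> carrier G \<Longrightarrow> \<phi> x = \<phi> y \<Longrightarrow> inv x \<otimes> y \<in> S"
  shows "card (carrier G) \<le> card B * card S"
proof -
  have finS: "finite S" using S fin(1) by (meson finite_subset subgroup.subset)
  have *: "card {x \<in> carrier G. \<phi> x = b} \<le> card S" for b
  proof (cases "\<exists>a\<in>carrier G. \<phi> a = b")
    case True
    then obtain a where a: "a \<in> carrier G" "\<phi> a = b" by blast
    show ?thesis
    proof (rule card_inj_on_le[OF _ _ finS])
      show "inj_on (\<lambda>x. inv a \<otimes> x) {x \<in> carrier G. \<phi> x = b}"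
        using a by (auto simp: inj_on_def)
      show "(\<lambda>x. inv a \<otimes> x) ` {x \<in> carrier G. \<phi> x = b} \<subseteq> S"
        using a fib by auto
    qed
  next
    case False
    then have "{x \<in> carrier G. \<phi> x = b} = {}" by blast
    then show ?thesis by (simp only: card.empty le0)
  qed
  have "carrier G = (\<Union>b\<in>B. {x \<in> carrier G. \<phi> x = b})" using B by auto
  then have "card (carrier G) \<le> (\<Sum>b\<in>B. card {x \<in> carrier G. \<phi> x = b})"
    using card_UN_le[OF fin(2), of "\<lambda>b. {x \<in> carrier G. \<phi> x = b}"] by simp
  also have "\<dots> \<le> card B * card S"
    using sum_bounded_above[of B "\<lambda>b. card {x \<in> carrier G. \<phi> x = b}" "card S"] * by simp
  finally show ?thesis .
qed

lemma nat_pow_commute: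
  assumes "x \<in> carrier G" "y \<in> carrier G" "x \<otimes> y = y \<otimes> x"
  shows "x [^] (k::nat) \<otimes> y = y \<otimes> x [^] k"
proof -
  have "x \<in> centralizer G y" using assms by (simp add: centralizer_def)
  then have "x [^] k \<in> centralizer G y"
    using subgroup_centralizer[OF assms(2)] subgroup_int_pow_closed[of _ x "int k"]
    by (simp add: int_pow_int)
  then show ?thesis by (simp add: centralizer_def)
qed

end

lemma (in group) subgroup_nat_pow_closed:
  assumes "subgroup H G" "h \<in> H" shows "h [^] (k :: nat) \<in> H"
  using subgroup_int_pow_closed[OF assms, of "int k"] by (simp add: int_pow_int)

section \<open>Orders of subgroups and central elements of order p\<close>

locale p_group = group G for G (structure) +
  fixes p n :: nat
  assumes prime_p: "Factorial_Ring.prime p"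
    and card_carrier: "card (carrier G) = p ^ n"
begin

lemma p_gt_1: "p > 1"
  using prime_p by (rule prime_gt_1_nat)

lemma finite_carrier: "finite (carrier G)"
  using card_carrier p_gt_1 by (metis card.infinite not_one_less_zero power_not_zero)

lemma finite_subgroup: "subgroup S G \<Longrightarrow> finite S"
  by (meson finite_carrier finite_subset subgroup.subset)

lemma subgroup_card:
  assumes "subgroup S G"
  obtains i where "i \<le> n" "card S = p ^ i"
proof -
  have "card S dvd p ^ n"
    using lagrange[OF assms] card_carrier by (metis dvd_triv_right order_def)
  then show ?thesis using that divides_primepow_nat[OF prime_p] by blast
qed

text \<open>Both orders are powers of \<open>p\<close>, so a strict inclusion gains at least a
  factor \<open>p\<close>. Orders are bounded from below by chains of such inclusions.\<close>

lemma psubset_card: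
  assumes "subgroup S G" "subgroup T G" "S \<subset> T"
  shows "p * card S \<le> card T"
proof -
  obtain i where i: "card S = p ^ i" using subgroup_card[OF assms(1)] by blast
  obtain j where j: "card T = p ^ j" using subgroup_card[OF assms(2)] by blast
  have "card S < card T"
    using assms finite_subgroup psubset_card_mono by blast
  then have "Suc i \<le> j" using i j p_gt_1 by (metis Suc_leI power_less_imp_less_exp)
  then have "p ^ Suc i \<le> p ^ j" using p_gt_1 by (intro power_increasing) auto
  then show ?thesis using i j by simp
qed

lemma pow_of_order_p:
  assumes "x \<in> carrier G" "x \<noteq> \<one>"
  obtains k :: nat where "x [^] k \<noteq> \<one>" "(x [^] k) [^] p = \<one>"
proof -
  have "ord x dvd p ^ n"
    using ord_dvd_group_order[OF assms(1)] card_carrier by (simp add: order_def)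
  then obtain i where i: "ord x = p ^ i" using divides_primepow_nat[OF prime_p] by blast
  have "i \<noteq> 0" using i assms ord_eq_1[OF assms(1)] by (intro notI) simp
  then obtain j where j: "i = Suc j" using not0_implies_Suc by blast
  have "x [^] (p ^ j) \<noteq> \<one>"
  proof
    assume "x [^] (p ^ j) = \<one>"
    then have "p ^ Suc j dvd p ^ j" using pow_eq_id[OF assms(1)] i j by metis
    then show False using p_gt_1 prime_p by (metis Suc_n_not_le_n power_dvd_imp_le)
  qed
  moreover have "(x [^] (p ^ j)) [^] p = \<one>"
    using assms(1) i j pow_ord_eq_1[OF assms(1)] by (simp add: nat_pow_pow mult.commute)
  ultimately show ?thesis using that by blast
qed

lemma ord_eq_p:
  assumes "z \<in> carrier G" "z \<noteq> \<one>" "z [^] p = \<one>"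
  shows "ord z = p"
proof -
  have "ord z dvd p" using assms pow_eq_id by blast
  moreover have "ord z \<noteq> 1" using assms ord_eq_1 by blast
  ultimately show ?thesis using prime_p by (metis prime_nat_iff)
qed

text \<open>Conjugation acts on \<open>N - {\<one>}\<close>. An orbit with one element consists of a
  central element, so if there are none then every orbit has order divisible by \<open>p\<close>;
  then \<open>p\<close> divides both \<open>card N - 1\<close> and \<open>card N\<close>.\<close>

lemma normal_meets_center:
  assumes "N \<lhd> G" "N \<noteq> {\<one>}"
  shows "N \<inter> center G \<noteq> {\<one>}"
proof
  assume F: "N \<inter> center G = {\<one>}"
  interpret N: normal N G by fact
  define \<phi> where "\<phi> = (\<lambda>g. (\<lambda>h \<in> carrier G. g \<otimes> h \<otimes> (inv g)))"
  interpret act: group_action G "carrier G" \<phi>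
    unfolding \<phi>_def by (rule action_by_conjugation)
  let ?O = "orbit G \<phi> ` (N - {\<one>})"
  have orb: "orbit G \<phi> x = {g \<otimes> x \<otimes> inv g | g. g \<in> carrier G}" if "x \<in> carrier G" for x
    using that by (auto simp: orbit_def \<phi>_def)
  have sub: "orbit G \<phi> x \<subseteq> N - {\<one>}" if x: "x \<in> N - {\<one>}" for x
  proof
    fix y assume "y \<in> orbit G \<phi> x"
    then obtain g where g: "g \<in> carrier G" "y = g \<otimes> x \<otimes> inv g" using orb x N.subset by auto
    have "y \<noteq> \<one>" using g x N.subset
      by (metis DiffE N.mem_carrier inv_closed inv_equality inv_solve_right l_one m_closed
          r_inv r_one singletonI l_cancel_one)
    then show "y \<in> N - {\<one>}" using g x N.inv_op_closed2 by simp
  qed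
  have self: "x \<in> orbit G \<phi> x" if "x \<in> N - {\<one>}" for x
    using that act.orbit_refl[of x] N.subset by blast
  have un: "\<Union>?O = N - {\<one>}" using sub self by blast
  have dv: "p dvd card c" if "c \<in> ?O" for c
  proof -
    from that obtain x where x: "c = orbit G \<phi> x" "x \<in> N - {\<one>}" by (rule imageE)
    have xc: "x \<in> carrier G" using x N.subset by blast
    have "card c dvd p ^ n"
      using act.orbit_stabilizer_theorem[OF xc] card_carrier x(1)
      by (metis dvd_triv_left order_def)
    then obtain i where i: "card c = p ^ i" using divides_primepow_nat[OF prime_p] by blast
    have "i \<noteq> 0"
    proof
      assume "i = 0"
      then obtain y where "c = {y}" using i card_1_singletonE by (metis power_0)
      then have c: "c = {x}" using self[OF x(2)] x(1) by simp
      have "g \<otimes> x = x \<otimes> g" if g: "g \<in> carrier G" for g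
      proof -
        have "g \<otimes> x \<otimes> inv g = x" using c x(1) orb[OF xc] g by blast
        then show ?thesis using g xc by (metis inv_closed inv_solve_right' m_closed)
      qed
      then have "x \<in> center G" using xc by (simp add: center_def)
      then show False using F x by blast
    qed
    then show ?thesis using i by (simp add: dvd_power)
  qed
  have "card (\<Union>?O) = sum card ?O"
  proof (rule card_Union_disjoint)
    show "pairwise disjnt ?O"
      unfolding pairwise_def disjnt_def
    proof (intro ballI impI)
      fix c d assume "c \<in> ?O" "d \<in> ?O" "c \<noteq> d"
      then show "c \<inter> d = {}"
        using act.disjoint_union[of c d] N.subset unfolding orbits_def by blast
    qed
    show "\<And>A. A \<in> ?O \<Longrightarrow> finite A"
      using sub finite_subgroup[OF N.subgroup_axioms] by (metis finite_Diff finite_subset imageE)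
  qed
  also have "p dvd \<dots>" using dv by (rule dvd_sum)
  finally have 1: "p dvd card (N - {\<one>})" using un by simp
  have 2: "card N = Suc (card (N - {\<one>}))"
    using finite_subgroup[OF N.subgroup_axioms] by (metis N.one_closed card.remove)
  obtain i where i: "card N = p ^ i" using subgroup_card[OF N.subgroup_axioms] by blast
  have "i \<noteq> 0"
  proof
    assume "i = 0"
    then obtain y where "N = {y}" using i card_1_singletonE by (metis power_0)
    then show False using assms(2) N.one_closed by auto
  qed
  then have "p dvd card N" unfolding i by (simp add: dvd_power)
  then have "p dvd 1" using 1 unfolding 2 by (metis Suc_eq_plus1 dvd_add_right_iff)
  then show False using p_gt_1 by simp
qed

lemma normal_central_order_p:
  assumes "N \<lhd> G" "N \<noteq> {\<one>}"
  obtains z where "z \<in> N" "z \<in> center G" "z \<noteq> \<one>" "z [^] p = \<one>"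
proof -
  interpret N: normal N G by fact
  have "\<one> \<in> N \<inter> center G" using subgroup.one_closed[OF subgroup_center] by simp
  then obtain x where x: "x \<in> N" "x \<in> center G" "x \<noteq> \<one>"
    using normal_meets_center[OF assms] by blast
  obtain k :: nat where k: "x [^] k \<noteq> \<one>" "(x [^] k) [^] p = \<one>"
    by (rule pow_of_order_p[OF center_closed[OF x(2)] x(3)])
  show ?thesis
    by (rule that[OF subgroup_nat_pow_closed[OF N.subgroup_axioms x(1)]
      subgroup_nat_pow_closed[OF subgroup_center x(2)] k])
qed

end

lemma (in group) normal_generate_central:
  assumes "z \<in> center G"
  shows "generate G {z} \<lhd> G"
proof (rule normal_generateI)
  show "{z} \<subseteq> carrier G" using assms center_closed by blast
  fix h g assume "h \<in> {z}" "g \<in> carrier G"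
  then show "g \<otimes> h \<otimes> inv g \<in> {z}"
    using assms center_comm[of z g] center_closed[of z] by (simp add: m_assoc)
qed

lemma (in group) generate_eq_pow_image:
  assumes "z \<in> carrier G" "ord z \<noteq> 0"
  shows "generate G {z} = (\<lambda>i::nat. z [^] i) ` {..<ord z}"
proof -
  have "{0..ord z - 1} = {..<ord z}" using assms(2) by auto
  then show ?thesis using generate_pow_nat[OF assms] ord_elems_inf_carrier[OF assms] by auto
qed

section \<open>Cocycles and the commutator pairing\<close>

text \<open>Integer exponents allow the differences that arise from commutators and from comparing
  cocycles.\<close>

definition root_of_unity :: "nat \<Rightarrow> int \<Rightarrow> complex" where
  "root_of_unity p a = cis (2 * pi * real_of_int a / real p)"

lemma root_of_unity_nonzero [simp]: "root_of_unity p a \<noteq> 0"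
  by (simp add: root_of_unity_def)

lemma root_of_unity_add: "root_of_unity p (a + b) = root_of_unity p a * root_of_unity p b"
  by (simp add: root_of_unity_def cis_mult add_divide_distrib distrib_left)

lemma root_of_unity_diff: "root_of_unity p (a - b) = root_of_unity p a / root_of_unity p b"
  using root_of_unity_add[of p "a - b" b] by simp

lemma root_of_unity_eq_1_iff:
  assumes "p > 0"
  shows "root_of_unity p a = 1 \<longleftrightarrow> int p dvd a"
proof
  assume "root_of_unity p a = 1"
  then have "cos (2 * pi * real_of_int a / real p) = 1"
    by (simp add: root_of_unity_def cis.ctr complex_eq_iff)
  then obtain k :: int where "2 * pi * real_of_int a / real p = of_int k * 2 * pi"
    using cos_one_2pi_int by blast
  then have "real_of_int a = of_int k * real p"
    using assms by (simp add: field_simps)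
  then have "a = k * int p" by (metis of_int_eq_iff of_int_mult of_int_of_nat_eq)
  then show "int p dvd a" by simp
next
  assume "int p dvd a"
  then obtain k where "a = int p * k" by (elim dvdE)
  then have "2 * pi * real_of_int a / real p = 2 * pi * real_of_int k" using assms by simp
  then show "root_of_unity p a = 1" by (simp add: root_of_unity_def cis_multiple_2pi)
qed

lemma root_of_unity_cong:
  assumes "p > 0" "int p dvd a - b"
  shows "root_of_unity p a = root_of_unity p b"
proof -
  have "root_of_unity p (a - b) = 1" using assms by (simp add: root_of_unity_eq_1_iff)
  then show ?thesis by (simp add: root_of_unity_diff)
qed

lemma complex_nth_root_exists:
  fixes c :: complex
  assumes "n > 0"
  obtains m where "m ^ n = c"
proof -
  have "rcis (root n (cmod c)) (Arg c / real n) ^ n = c"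
    using assms by (simp add: DeMoivre2 rcis_cmod_Arg)
  then show ?thesis using that by blast
qed

text \<open>The value 1 off the carrier makes equality of functions the same as equality on
  \<open>G\<close>, so that pairings can be counted as functions.\<close>

definition pairing :: "('a, 'b) monoid_scheme \<Rightarrow> 'a \<Rightarrow> ('a \<Rightarrow> 'a \<Rightarrow> complex) \<Rightarrow> 'a \<Rightarrow> complex" where
  "pairing G z f = (\<lambda>g. if g \<in> carrier G then f g z / f z g else 1)"

definition coboundary :: "('a, 'b) monoid_scheme \<Rightarrow> ('a \<Rightarrow> complex) \<Rightarrow> 'a \<Rightarrow> 'a \<Rightarrow> complex" where
  "coboundary G g = (\<lambda>x y. if x \<in> carrier G \<and> y \<in> carrier G
     then g x * g y / g (x \<otimes>\<^bsub>G\<^esub> y) else 1)"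

lemma cocycle_nonzero [simp]: "f \<in> schur_cocycles G \<Longrightarrow> f x y \<noteq> 0"
  by (simp add: schur_cocycles_def)

lemma cocycle_outside:
  "f \<in> schur_cocycles G \<Longrightarrow> x \<notin> carrier G \<or> y \<notin> carrier G \<Longrightarrow> f x y = 1"
  unfolding schur_cocycles_def by blast

lemma cocycle_eq:
  "f \<in> schur_cocycles G \<Longrightarrow> x \<in> carrier G \<Longrightarrow> y \<in> carrier G \<Longrightarrow> z \<in> carrier G \<Longrightarrow>
    f x y * f (x \<otimes>\<^bsub>G\<^esub> y) z = f y z * f x (y \<otimes>\<^bsub>G\<^esub> z)"
  unfolding schur_cocycles_def by blast

lemma cocycle_mult:
  assumes "f \<in> schur_cocycles G" "f' \<in> schur_cocycles G"
  shows "(\<lambda>x y. f x y * f' x y) \<in> schur_cocycles G"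
  unfolding schur_cocycles_def
proof (intro CollectI conjI ballI allI impI)
  fix x y z assume c: "x \<in> carrier G" "y \<in> carrier G" "z \<in> carrier G"
  have "f x y * f (x \<otimes>\<^bsub>G\<^esub> y) z * (f' x y * f' (x \<otimes>\<^bsub>G\<^esub> y) z) =
        f y z * f x (y \<otimes>\<^bsub>G\<^esub> z) * (f' y z * f' x (y \<otimes>\<^bsub>G\<^esub> z))"
    using cocycle_eq[OF assms(1) c] cocycle_eq[OF assms(2) c] by simp
  then show "f x y * f' x y * (f (x \<otimes>\<^bsub>G\<^esub> y) z * f' (x \<otimes>\<^bsub>G\<^esub> y) z) =
        f y z * f' y z * (f x (y \<otimes>\<^bsub>G\<^esub> z) * f' x (y \<otimes>\<^bsub>G\<^esub> z))"
    by (simp add: ac_simps)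
qed (use assms in \<open>auto simp: cocycle_outside\<close>)

lemma cocycle_inverse:
  assumes "f \<in> schur_cocycles G"
  shows "(\<lambda>x y. inverse (f x y)) \<in> schur_cocycles G"
  unfolding schur_cocycles_def
proof (intro CollectI conjI ballI allI impI)
  fix x y z assume c: "x \<in> carrier G" "y \<in> carrier G" "z \<in> carrier G"
  show "inverse (f x y) * inverse (f (x \<otimes>\<^bsub>G\<^esub> y) z) =
        inverse (f y z) * inverse (f x (y \<otimes>\<^bsub>G\<^esub> z))"
    using cocycle_eq[OF assms(1) c] by (metis inverse_mult_distrib)
qed (use assms in \<open>auto simp: cocycle_outside\<close>)

lemma cocycle_divide:
  assumes "f \<in> schur_cocycles G" "f' \<in> schur_cocycles G"
  shows "(\<lambda>x y. f x y / f' x y) \<in> schur_cocycles G"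
  using cocycle_mult[OF assms(1) cocycle_inverse[OF assms(2)]] by (simp add: divide_inverse)

lemma cocycle_trivial: "(\<lambda>x y. 1) \<in> schur_cocycles G"
  unfolding schur_cocycles_def
  by (intro CollectI conjI ballI allI impI refl) (rule one_neq_zero)

lemma cohomologous_iff:
  "(f, f') \<in> cohomologous G \<longleftrightarrow> f \<in> schur_cocycles G \<and> f' \<in> schur_cocycles G \<and>
    (\<exists>g. (\<forall>x\<in>carrier G. g x \<noteq> 0) \<and>
      (\<forall>x\<in>carrier G. \<forall>y\<in>carrier G. f x y = f' x y * (g x * g y / g (x \<otimes>\<^bsub>G\<^esub> y))))"
proof -
  have "f x y / f' x y = c \<longleftrightarrow> f x y = f' x y * c" if "f' \<in> schur_cocycles G" for x y c
    using that by (simp add: nonzero_divide_eq_eq mult.commute)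
  then show ?thesis
    unfolding cohomologous_def schur_coboundary_def by (simp cong: conj_cong)
qed

lemma cohomologousD:
  assumes "(f, f') \<in> cohomologous G"
  shows "f \<in> schur_cocycles G" "f' \<in> schur_cocycles G"
    and "\<exists>g. (\<forall>x\<in>carrier G. g x \<noteq> 0) \<and>
      (\<forall>x\<in>carrier G. \<forall>y\<in>carrier G. f x y = f' x y * (g x * g y / g (x \<otimes>\<^bsub>G\<^esub> y)))"
  using assms unfolding cohomologous_iff by blast+

section \<open>Calculus of cohomologous cocycles and multiplicativity of the pairing\<close>

context group
begin

lemma cohomologous_refl: "f \<in> schur_cocycles G \<Longrightarrow> (f, f) \<in> cohomologous G"
  unfolding cohomologous_iff by (auto intro!: exI[of _ "\<lambda>x. 1"])

lemma cohomologous_mult: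
  assumes "(f, f') \<in> cohomologous G" "(e, e') \<in> cohomologous G"
  shows "((\<lambda>x y. f x y * e x y), (\<lambda>x y. f' x y * e' x y)) \<in> cohomologous G"
proof -
  obtain g where g: "\<forall>x\<in>carrier G. g x \<noteq> 0"
    "\<forall>x\<in>carrier G. \<forall>y\<in>carrier G. f x y = f' x y * (g x * g y / g (x \<otimes> y))"
    using cohomologousD(3)[OF assms(1)] by blast
  obtain h where h: "\<forall>x\<in>carrier G. h x \<noteq> 0"
    "\<forall>x\<in>carrier G. \<forall>y\<in>carrier G. e x y = e' x y * (h x * h y / h (x \<otimes> y))"
    using cohomologousD(3)[OF assms(2)] by blast
  have "\<forall>x\<in>carrier G. \<forall>y\<in>carrier G. f x y * e x y = f' x y * e' x y *
      ((g x * h x) * (g y * h y) / (g (x \<otimes> y) * h (x \<otimes> y)))"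
    using g(2) h(2) by (simp add: field_simps)
  then show ?thesis
    using assms[THEN cohomologousD(1)] assms[THEN cohomologousD(2)] g(1) h(1)
    unfolding cohomologous_iff
    by (intro conjI cocycle_mult exI[of _ "\<lambda>x. g x * h x"]) auto
qed

lemma cohomologous_inverse:
  assumes "(f, f') \<in> cohomologous G"
  shows "((\<lambda>x y. inverse (f x y)), (\<lambda>x y. inverse (f' x y))) \<in> cohomologous G"
proof -
  obtain g where g: "\<forall>x\<in>carrier G. g x \<noteq> 0"
    "\<forall>x\<in>carrier G. \<forall>y\<in>carrier G. f x y = f' x y * (g x * g y / g (x \<otimes> y))"
    using cohomologousD(3)[OF assms(1)] by blast
  have "\<forall>x\<in>carrier G. \<forall>y\<in>carrier G. inverse (f x y) = inverse (f' x y) *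
      (inverse (g x) * inverse (g y) / inverse (g (x \<otimes> y)))"
    using g(2) by (simp add: field_simps)
  then show ?thesis
    using cohomologousD(1,2)[OF assms] g(1)
    unfolding cohomologous_iff
    by (intro conjI cocycle_inverse exI[of _ "\<lambda>x. inverse (g x)"]) auto
qed

lemma cohomologous_divide:
  assumes "(f, f') \<in> cohomologous G" "(e, e') \<in> cohomologous G"
  shows "((\<lambda>x y. f x y / e x y), (\<lambda>x y. f' x y / e' x y)) \<in> cohomologous G"
  using cohomologous_mult[OF assms(1) cohomologous_inverse[OF assms(2)]]
  by (simp add: divide_inverse)

lemma cohomologous_sym:
  assumes "(f, f') \<in> cohomologous G"
  shows "(f', f) \<in> cohomologous G"
proof -
  note K = cohomologousD(1,2)[OF assms]
  have "((\<lambda>x y. f' x y / (f x y / f x y)), (\<lambda>x y. f' x y / (f' x y / f x y))) \<in> cohomologous G"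
    using K assms by (intro cohomologous_divide cohomologous_refl) auto
  then show ?thesis using K by simp
qed

lemma cohomologous_trans:
  assumes "(f, f') \<in> cohomologous G" "(f', f'') \<in> cohomologous G"
  shows "(f, f'') \<in> cohomologous G"
proof -
  note K = cohomologousD(1,2)[OF assms(1)]
  have "((\<lambda>x y. f x y * f' x y / f' x y), (\<lambda>x y. f' x y * f'' x y / f' x y)) \<in> cohomologous G"
    using K assms by (intro cohomologous_divide cohomologous_mult cohomologous_refl) auto
  then show ?thesis using K by simp
qed

lemma equiv_cohomologous: "equiv (schur_cocycles G) (cohomologous G)"
proof (rule equivI)
  show "cohomologous G \<subseteq> schur_cocycles G \<times> schur_cocycles G"
    unfolding cohomologous_def by auto
qed (auto intro: refl_onI symI transI cohomologous_refl cohomologous_sym cohomologous_trans)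

lemma coboundary_cocycle:
  assumes "\<And>x. x \<in> carrier G \<Longrightarrow> g x \<noteq> 0"
  shows "coboundary G g \<in> schur_cocycles G"
  unfolding schur_cocycles_def coboundary_def
  using assms by (auto simp: m_assoc field_simps)

lemma coboundary_cohomologous_trivial:
  assumes "\<And>x. x \<in> carrier G \<Longrightarrow> g x \<noteq> 0"
  shows "(coboundary G g, \<lambda>x y. 1) \<in> cohomologous G"
  unfolding cohomologous_iff
  using assms coboundary_cocycle[OF assms] cocycle_trivial
  by (auto intro!: exI[of _ g] simp: coboundary_def)

lemma cocycle_one_left:
  assumes "f \<in> schur_cocycles G" "y \<in> carrier G"
  shows "f \<one> y = f \<one> \<one>"
  using cocycle_eq[OF assms(1), of \<one> \<one> y] assms by simp

lemma cocycle_one_right: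
  assumes "f \<in> schur_cocycles G" "x \<in> carrier G"
  shows "f x \<one> = f \<one> \<one>"
  using cocycle_eq[OF assms(1), of x \<one> \<one>] assms by simp

text \<open>The commutator of lifts of \<open>g\<close> and of the central element \<open>z\<close>
  is a scalar, hence multiplicative in \<open>g\<close>. In terms of \<open>f\<close> this is the
  product of the cocycle equations for \<open>(g, h, z)\<close>, \<open>(z, g, h)\<close> and
  \<open>(g, z, h)\<close>, from which all other factors cancel.\<close>

lemma pairing_mult_left:
  assumes f: "f \<in> schur_cocycles G" and z: "z \<in> center G"
    and g: "g \<in> carrier G" and h: "h \<in> carrier G"
  shows "pairing G z f (g \<otimes> h) = pairing G z f g * pairing G z f h"
proof -
  have zc: "z \<in> carrier G" using z center_closed by blast
  note comm = center_comm[OF z]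
  have nz: "f x y \<noteq> 0" for x y using f by simp
  have 1: "f g h * f (g \<otimes> h) z = f h z * f g (z \<otimes> h)"
    using cocycle_eq[OF f g h zc] comm[OF h] by simp
  have 2: "f z g * f (z \<otimes> g) h = f g h * f z (g \<otimes> h)"
    using cocycle_eq[OF f zc g h] .
  have 3: "f g z * f (z \<otimes> g) h = f z h * f g (z \<otimes> h)"
    using cocycle_eq[OF f g zc h] comm[OF g] by simp
  have "f (g \<otimes> h) z * f z g * f z h = f z (g \<otimes> h) * f g z * f h z"
  proof -
    have "f g h * f (g \<otimes> h) z * (f z g * f (z \<otimes> g) h) * (f z h * f g (z \<otimes> h)) =
          f h z * f g (z \<otimes> h) * (f g h * f z (g \<otimes> h)) * (f g z * f (z \<otimes> g) h)"
      using 1 2 3 by simp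
    then have "(f g h * f (z \<otimes> g) h * f g (z \<otimes> h)) * (f (g \<otimes> h) z * f z g * f z h) =
          (f g h * f (z \<otimes> g) h * f g (z \<otimes> h)) * (f z (g \<otimes> h) * f g z * f h z)"
      by (simp add: ac_simps)
    then show ?thesis using nz by simp
  qed
  then show ?thesis
    using g h nz unfolding pairing_def by (simp add: field_simps)
qed

lemma pairing_mult_right:
  assumes f: "f \<in> schur_cocycles G" and z: "z \<in> center G" and y: "y \<in> center G"
    and g: "g \<in> carrier G"
  shows "pairing G (z \<otimes> y) f g = pairing G z f g * pairing G y f g"
proof -
  have zc: "z \<in> carrier G" and yc: "y \<in> carrier G" using z y center_closed by blast+
  have nz: "f x y \<noteq> 0" for x y using f by simp
  have 1: "f g z * f (g \<otimes> z) y = f z y * f g (z \<otimes> y)" using cocycle_eq[OF f g zc yc] .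
  have 2: "f z y * f (z \<otimes> y) g = f y g * f z (y \<otimes> g)" using cocycle_eq[OF f zc yc g] .
  have 3: "f z g * f (g \<otimes> z) y = f g y * f z (y \<otimes> g)"
    using cocycle_eq[OF f zc g yc] center_comm[OF z g] center_comm[OF y g] by simp
  have "f g (z \<otimes> y) * f z g * f y g = f (z \<otimes> y) g * f g z * f g y"
  proof -
    have "(f z y * f g (z \<otimes> y)) * (f z g * f (g \<otimes> z) y) * (f y g * f z (y \<otimes> g)) =
          (f g z * f (g \<otimes> z) y) * (f g y * f z (y \<otimes> g)) * (f z y * f (z \<otimes> y) g)"
      using 1 2 3 by simp
    then have "(f z y * f (g \<otimes> z) y * f z (y \<otimes> g)) * (f g (z \<otimes> y) * f z g * f y g) =
          (f z y * f (g \<otimes> z) y * f z (y \<otimes> g)) * (f (z \<otimes> y) g * f g z * f g y)"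
      by (simp add: ac_simps)
    then show ?thesis using nz by simp
  qed
  then show ?thesis
    using g nz unfolding pairing_def by (simp add: field_simps)
qed

lemma pairing_pow:
  assumes f: "f \<in> schur_cocycles G" and z: "z \<in> center G" and g: "g \<in> carrier G"
  shows "pairing G (z [^] (k::nat)) f g = pairing G z f g ^ k"
proof (induction k)
  case 0
  then show ?case using cocycle_one_left[OF f g] cocycle_one_right[OF f g] f g
    by (simp add: pairing_def)
next
  case (Suc k)
  have "z [^] k \<in> center G" using subgroup_nat_pow_closed[OF subgroup_center z] .
  then show ?case using pairing_mult_right[OF f _ z g, of "z [^] k"] Suc by simp
qed

lemma pairing_divide:
  assumes "f \<in> schur_cocycles G" "f' \<in> schur_cocycles G"
  shows "pairing G z (\<lambda>x y. f x y / f' x y) g = pairing G z f g / pairing G z f' g"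
  using assms by (simp add: pairing_def field_simps)

end

section \<open>Factoring out a central subgroup of prime order\<close>

text \<open>The values commute, so the kernel is a subgroup that contains every commutator.\<close>

lemma (in group) hom_trivial_on_derived:
  fixes \<chi> :: "'a \<Rightarrow> complex"
  assumes "\<And>x. x \<in> carrier G \<Longrightarrow> \<chi> x \<noteq> 0"
    and hom: "\<And>x y. x \<in> carrier G \<Longrightarrow> y \<in> carrier G \<Longrightarrow> \<chi> (x \<otimes> y) = \<chi> x * \<chi> y"
    and "w \<in> derived G (carrier G)"
  shows "\<chi> w = 1"
proof -
  have one: "\<chi> \<one> = 1" using hom[of \<one> \<one>] assms(1)[of \<one>] by simp
  have "subgroup {x \<in> carrier G. \<chi> x = 1} G"
  proof (rule subgroupI)
    fix x assume "x \<in> {x \<in> carrier G. \<chi> x = 1}"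
    then show "inv x \<in> {x \<in> carrier G. \<chi> x = 1}" using hom[of "inv x" x] one by simp
  qed (use hom one in auto)
  moreover have "\<chi> (commutator G x y) = 1" if "x \<in> carrier G" "y \<in> carrier G" for x y
    using hom[of "commutator G x y" "y \<otimes> x"] mult_eq_commutator[of x y] that
      hom[of x y] hom[of y x] assms(1) by simp
  ultimately have "derived G (carrier G) \<subseteq> {x \<in> carrier G. \<chi> x = 1}"
    by (subst derived_subset_iff) auto
  then show ?thesis using assms(3) by blast
qed

locale central_prime = group G for G (structure) +
  fixes z :: 'a and p :: nat
  assumes prime_p: "Factorial_Ring.prime p"
    and z_center: "z \<in> center G" and z_ne: "z \<noteq> \<one>" and z_pow: "z [^] p = \<one>"
begin

abbreviation Z :: "'a set" where "Z \<equiv> generate G {z}"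

lemma z_closed [simp]: "z \<in> carrier G"
  using z_center center_closed by blast

lemma p_pos: "p > 0"
  using prime_p by (rule prime_gt_0_nat)

lemma ord_z: "ord z = p"
proof -
  have "ord z dvd p" using z_pow pow_eq_id z_closed by blast
  moreover have "ord z \<noteq> 1" using z_ne ord_eq_1 z_closed by blast
  ultimately show ?thesis using prime_p by (metis prime_nat_iff)
qed

lemma Z_eq: "Z = (\<lambda>i::nat. z [^] i) ` {..<p}"
  using generate_eq_pow_image[OF z_closed] ord_z p_pos by simp

lemma card_Z: "card Z = p"
  using generate_pow_card[OF z_closed] ord_z by simp

lemma normal_Z: "Z \<lhd> G"
  by (rule normal_generate_central[OF z_center])

sublocale Z: normal Z G
  by (rule normal_Z)

lemma z_in_Z: "z \<in> Z"
  by (rule generate.incl) simp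

lemma coset_z_mult:
  assumes "x \<in> carrier G"
  shows "Z #> (z \<otimes> x) = Z #> x"
proof -
  have "Z #> z #> x = Z #> (z \<otimes> x)" by (rule coset_mult_assoc) (use assms Z.subset in auto)
  moreover have "Z #> z = Z" using coset_join2[OF z_closed Z.subgroup_axioms z_in_Z] .
  ultimately show ?thesis by simp
qed

lemma coset_eq_imp:
  assumes "x \<in> carrier G" "y \<in> carrier G" "Z #> x = Z #> y"
  obtains i where "i < p" "x = z [^] i \<otimes> y"
proof -
  have "x \<in> Z #> y" using assms(3) rcos_self[OF assms(1) Z.subgroup_axioms] by simp
  then show ?thesis using that unfolding r_coset_def Z_eq by auto
qed

text \<open>On a coset of \<open>Z\<close>, multiplication by \<open>z\<close> is a
  \<open>p\<close>-cycle. The solution starts with 1 at a representative and picks up a factor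
  \<open>q\<close> at each step; it closes up because the product of \<open>q\<close> round the
  cycle is 1. The cochains in \<open>pairing_kernel\<close> and \<open>transgression\<close> are
  obtained in this way.\<close>

lemma coset_recurrence:
  fixes q :: "'a \<Rightarrow> complex"
  assumes nz: "\<And>x. x \<in> carrier G \<Longrightarrow> q x \<noteq> 0"
    and cyc: "\<And>x. x \<in> carrier G \<Longrightarrow> (\<Prod>i<p. q (z [^] i \<otimes> x)) = 1"
  obtains \<mu> where "\<And>x. x \<in> carrier G \<Longrightarrow> \<mu> x \<noteq> 0"
    "\<And>x. x \<in> carrier G \<Longrightarrow> \<mu> (z \<otimes> x) = q x * \<mu> x"
proof -
  define r where "r x = (SOME y. y \<in> carrier G \<and> Z #> y = Z #> x)" for x
  define e where "e x = (THE i. i < p \<and> x = z [^] i \<otimes> r x)" for x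
  define \<mu> where "\<mu> x = (\<Prod>i<e x. q (z [^] i \<otimes> r x))" for x
  have r: "r x \<in> carrier G" "Z #> r x = Z #> x" if "x \<in> carrier G" for x
    using that someI[of "\<lambda>y. y \<in> carrier G \<and> Z #> y = Z #> x" x] unfolding r_def by auto
  have e_unique: "e x = i" if x: "x \<in> carrier G" and i: "i < p" "x = z [^] i \<otimes> r x" for x i
    unfolding e_def
  proof (rule the_equality)
    fix j assume j: "j < p \<and> x = z [^] j \<otimes> r x"
    then have "z [^] j = z [^] i" using i r(1)[OF x] by (metis nat_pow_closed right_cancel z_closed)
    moreover have "inj_on (\<lambda>i. z [^] i) {..<p}"
      using card_Z Z_eq by (intro eq_card_imp_inj_on) auto
    ultimately show "j = i" using i j by (auto dest: inj_onD)
  qed (use i in simp)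
  have e: "e x < p" "x = z [^] e x \<otimes> r x" if x: "x \<in> carrier G" for x
  proof -
    obtain i where "i < p" "x = z [^] i \<otimes> r x"
      by (rule coset_eq_imp[OF x r(1)[OF x] r(2)[OF x, symmetric]])
    then show "e x < p" "x = z [^] e x \<otimes> r x" using e_unique[OF x, of i] by simp_all
  qed
  show ?thesis
  proof (rule that[of \<mu>])
    fix x assume x: "x \<in> carrier G"
    show "\<mu> x \<noteq> 0" unfolding \<mu>_def using nz r(1)[OF x] by simp
    have zx: "z \<otimes> x \<in> carrier G" using x by simp
    have rz: "r (z \<otimes> x) = r x" unfolding r_def coset_z_mult[OF x] ..
    have zx_eq: "z \<otimes> x = z [^] Suc (e x) \<otimes> r x"
      using e(2)[OF x] r(1)[OF x] by (metis m_assoc nat_pow_Suc2 nat_pow_closed z_closed)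
    have qx: "q (z [^] e x \<otimes> r x) = q x" using e(2)[OF x] by simp
    show "\<mu> (z \<otimes> x) = q x * \<mu> x"
    proof (cases "Suc (e x) < p")
      case True
      then have "e (z \<otimes> x) = Suc (e x)" using e_unique[OF zx True] zx_eq rz by simp
      then show ?thesis unfolding \<mu>_def rz using qx by (simp add: mult.commute)
    next
      \<comment> \<open>Here \<open>x\<close> is the last element of its coset and
        \<open>z \<otimes> x\<close> is the representative again, where \<open>\<mu>\<close> is an
        empty product; the full product over the cycle has the same value 1.\<close>
      case False
      then have p: "p = Suc (e x)" using e(1)[OF x] by simp
      have "z \<otimes> x = z [^] (0::nat) \<otimes> r (z \<otimes> x)"
        using zx_eq z_pow r(1)[OF x] rz unfolding p[symmetric] by simp
      then have "e (z \<otimes> x) = 0" by (rule e_unique[OF zx p_pos])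
      then have "\<mu> (z \<otimes> x) = (\<Prod>i<p. q (z [^] i \<otimes> r x))"
        unfolding \<mu>_def rz using cyc[OF r(1)[OF x]] by simp
      then show ?thesis unfolding \<mu>_def using qx by (simp add: p mult.commute)
    qed
  qed
qed

section \<open>Inflation, its image and its kernel\<close>

definition inflation :: "('a set \<Rightarrow> 'a set \<Rightarrow> complex) \<Rightarrow> 'a \<Rightarrow> 'a \<Rightarrow> complex" where
  "inflation h = (\<lambda>x y. if x \<in> carrier G \<and> y \<in> carrier G then h (Z #> x) (Z #> y) else 1)"

lemma coset_in_quot: "x \<in> carrier G \<Longrightarrow> Z #> x \<in> carrier (G Mod Z)"
  by (auto simp: carrier_FactGroup)

lemma coset_mult: "x \<in> carrier G \<Longrightarrow> y \<in> carrier G \<Longrightarrow>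
    (Z #> x) \<otimes>\<^bsub>G Mod Z\<^esub> (Z #> y) = Z #> (x \<otimes> y)"
  by (simp add: Z.rcos_sum)

lemma inflation_cocycle:
  assumes "h \<in> schur_cocycles (G Mod Z)"
  shows "inflation h \<in> schur_cocycles G"
  unfolding schur_cocycles_def
proof (intro CollectI conjI ballI allI impI)
  fix x y w assume c: "x \<in> carrier G" "y \<in> carrier G" "w \<in> carrier G"
  show "inflation h x y * inflation h (x \<otimes> y) w = inflation h y w * inflation h x (y \<otimes> w)"
    using cocycle_eq[OF assms coset_in_quot coset_in_quot coset_in_quot, OF c] c
    by (simp only: inflation_def coset_mult m_closed if_True simp_thms)
qed (use assms in \<open>auto simp: inflation_def\<close>)

lemma inflation_cohomologous:
  assumes "(h, h') \<in> cohomologous (G Mod Z)"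
  shows "(inflation h, inflation h') \<in> cohomologous G"
proof -
  obtain g where g: "\<forall>x\<in>carrier (G Mod Z). g x \<noteq> 0"
    "\<forall>x\<in>carrier (G Mod Z). \<forall>y\<in>carrier (G Mod Z).
       h x y = h' x y * (g x * g y / g (x \<otimes>\<^bsub>G Mod Z\<^esub> y))"
    using cohomologousD(3)[OF assms] by blast
  have "inflation h x y = inflation h' x y * (g (Z #> x) * g (Z #> y) / g (Z #> (x \<otimes> y)))"
    if c: "x \<in> carrier G" "y \<in> carrier G" for x y
    using g(2)[rule_format, OF coset_in_quot coset_in_quot, OF c] c
    by (simp only: inflation_def coset_mult if_True simp_thms)
  then show ?thesis
    unfolding cohomologous_iff
    using cohomologousD(1,2)[OF assms, THEN inflation_cocycle] g(1) coset_in_quot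
    by (intro conjI exI[of _ "\<lambda>x. g (Z #> x)"]) auto
qed

text \<open>Invariance under \<open>z\<close> in both arguments makes \<open>f\<close> constant on
  pairs of cosets, so its values at representatives define \<open>h\<close>. The cocycle is
  recovered exactly, not only up to a coboundary.\<close>

lemma descend:
  assumes f: "f \<in> schur_cocycles G"
    and l: "\<And>x y. x \<in> carrier G \<Longrightarrow> y \<in> carrier G \<Longrightarrow> f (z \<otimes> x) y = f x y"
    and r: "\<And>x y. x \<in> carrier G \<Longrightarrow> y \<in> carrier G \<Longrightarrow> f x (z \<otimes> y) = f x y"
  obtains h where "h \<in> schur_cocycles (G Mod Z)" "inflation h = f"
proof -
  have lp: "f (z [^] i \<otimes> x) y = f x y" if "x \<in> carrier G" "y \<in> carrier G" for i :: nat and x y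
  proof (induction i)
    case (Suc i)
    have "z [^] Suc i \<otimes> x = z \<otimes> (z [^] i \<otimes> x)"
      using that by (metis m_assoc nat_pow_Suc2 nat_pow_closed z_closed)
    then show ?case using Suc l[of "z [^] i \<otimes> x" y] that by simp
  qed (use that in simp)
  have rp: "f x (z [^] i \<otimes> y) = f x y" if "x \<in> carrier G" "y \<in> carrier G" for i :: nat and x y
  proof (induction i)
    case (Suc i)
    have "z [^] Suc i \<otimes> y = z \<otimes> (z [^] i \<otimes> y)"
      using that by (metis m_assoc nat_pow_Suc2 nat_pow_closed z_closed)
    then show ?case using Suc r[of x "z [^] i \<otimes> y"] that by simp
  qed (use that in simp)
  define s where "s U = (SOME x. x \<in> carrier G \<and> Z #> x = U)" for U
  define h where "h U V = (if U \<in> carrier (G Mod Z) \<and> V \<in> carrier (G Mod Z)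
    then f (s U) (s V) else 1)" for U V
  have s: "s (Z #> x) \<in> carrier G \<and> Z #> s (Z #> x) = Z #> x" if "x \<in> carrier G" for x
    using that someI[of "\<lambda>y. y \<in> carrier G \<and> Z #> y = Z #> x" x] unfolding s_def by simp
  have h: "h (Z #> x) (Z #> y) = f x y" if c: "x \<in> carrier G" "y \<in> carrier G" for x y
  proof -
    obtain i where i: "i < p" "s (Z #> x) = z [^] i \<otimes> x"
      by (rule coset_eq_imp[OF conjunct1[OF s[OF c(1)]] c(1) conjunct2[OF s[OF c(1)]]])
    obtain j where j: "j < p" "s (Z #> y) = z [^] j \<otimes> y"
      by (rule coset_eq_imp[OF conjunct1[OF s[OF c(2)]] c(2) conjunct2[OF s[OF c(2)]]])
    have "f (z [^] i \<otimes> x) (z [^] j \<otimes> y) = f x y" using lp rp c by simp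
    then show ?thesis using i(2) j(2) c coset_in_quot by (simp add: h_def)
  qed
  show ?thesis
  proof (rule that[of h])
    show "h \<in> schur_cocycles (G Mod Z)"
      unfolding schur_cocycles_def
    proof (intro CollectI conjI ballI allI impI)
      fix U V W assume "U \<in> carrier (G Mod Z)" "V \<in> carrier (G Mod Z)" "W \<in> carrier (G Mod Z)"
      then obtain x y w where c: "x \<in> carrier G" "y \<in> carrier G" "w \<in> carrier G"
        and e: "U = Z #> x" "V = Z #> y" "W = Z #> w"
        unfolding carrier_FactGroup by blast
      show "h U V * h (U \<otimes>\<^bsub>G Mod Z\<^esub> V) W = h V W * h U (V \<otimes>\<^bsub>G Mod Z\<^esub> W)"
        unfolding e coset_mult[OF c(1,2)] coset_mult[OF c(2,3)]
        using cocycle_eq[OF f c] c h by simp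
    qed (use f in \<open>auto simp: h_def\<close>)
    show "inflation h = f"
    proof (intro ext)
      fix x y
      show "inflation h x y = f x y"
        using h cocycle_outside[OF f] by (auto simp: inflation_def)
    qed
  qed
qed

text \<open>Each step is the cocycle equation for \<open>(z, z [^] k, x)\<close>. For
  \<open>k = p\<close> the factors \<open>f \<one> x\<close> and \<open>f (z [^] p) x\<close>
  coincide, so the product of \<open>f z\<close> round a coset does not depend on the coset.\<close>

lemma prod_cocycle_telescope:
  assumes f: "f \<in> schur_cocycles G" and x: "x \<in> carrier G"
  shows "(\<Prod>i<k. f z (z [^] i \<otimes> x)) * f \<one> x = (\<Prod>i<k. f z (z [^] (i::nat))) * f (z [^] k) x"
proof (induction k)
  case (Suc k)
  have "f z (z [^] k) * f (z [^] Suc k) x = f (z [^] k) x * f z (z [^] k \<otimes> x)"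
    using cocycle_eq[OF f z_closed nat_pow_closed[OF z_closed] x, of k]
    unfolding nat_pow_Suc2[OF z_closed] .
  then have "(\<Prod>i<k. f z (z [^] (i::nat))) * (f z (z [^] k) * f (z [^] Suc k) x) =
      (\<Prod>i<k. f z (z [^] (i::nat))) * f (z [^] k) x * f z (z [^] k \<otimes> x)"
    by (simp only: mult.assoc)
  then show ?case unfolding Suc[symmetric] prod.lessThan_Suc by (simp only: ac_simps)
qed simp

text \<open>A trivial pairing means \<open>f x z = f z x\<close>. Multiplying by the coboundary of a
  suitable \<open>\<mu>\<close> turns both into one constant; the cocycle equation then makes the
  new cocycle invariant under translation by \<open>z\<close>, so it descends.\<close>

lemma pairing_kernel:
  assumes f: "f \<in> schur_cocycles G" and ker: "pairing G z f = (\<lambda>g. 1)"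
  obtains h where "h \<in> schur_cocycles (G Mod Z)" "(f, inflation h) \<in> cohomologous G"
proof -
  have comm: "f x z = f z x" if "x \<in> carrier G" for x
    using fun_cong[OF ker, of x] that f by (simp add: pairing_def)
  define Q where "Q = (\<Prod>i<p. f z (z [^] i))"
  have Qnz: "Q \<noteq> 0" using f by (simp add: Q_def)
  have Q: "(\<Prod>i<p. f z (z [^] i \<otimes> x)) = Q" if x: "x \<in> carrier G" for x
    using prod_cocycle_telescope[OF f x, of p] f by (simp add: z_pow Q_def)
  \<comment> \<open>With a \<open>p\<close>-th root of \<open>1 / Q\<close> as factor, the product
    of \<open>m * f z\<close> round every coset becomes 1, as \<open>coset_recurrence\<close>
    requires. The divisibility of the group of nonzero complex numbers is used here.\<close>
  obtain m where m: "m ^ p = 1 / Q" using complex_nth_root_exists[OF p_pos] by blast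
  have mnz: "m \<noteq> 0" using m Qnz p_pos by (metis divide_eq_0_iff one_neq_zero power_0_left not_gr_zero)
  obtain \<mu> where \<mu>nz: "\<And>x. x \<in> carrier G \<Longrightarrow> \<mu> x \<noteq> 0"
    and \<mu>: "\<And>x. x \<in> carrier G \<Longrightarrow> \<mu> (z \<otimes> x) = m * f z x * \<mu> x"
  proof (rule coset_recurrence[of "\<lambda>x. m * f z x"])
    show "(\<Prod>i<p. m * f z (z [^] i \<otimes> x)) = 1" if "x \<in> carrier G" for x
      using Q[OF that] m Qnz by (simp add: prod.distrib)
  qed (use f mnz in auto)
  define f' where "f' = (\<lambda>x y. f x y * coboundary G \<mu> x y)"
  have f': "f' \<in> schur_cocycles G"
    unfolding f'_def by (intro cocycle_mult f coboundary_cocycle \<mu>nz)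
  have ff': "(f, f') \<in> cohomologous G"
    using cohomologous_mult[OF cohomologous_refl[OF f]
        cohomologous_sym[OF coboundary_cohomologous_trivial[of \<mu>]]] \<mu>nz
    by (simp add: f'_def)
  \<comment> \<open>By the recurrence
    \<open>f z x * \<mu> x / \<mu> (z \<otimes> x) = 1 / m\<close>, which leaves
    \<open>\<mu> z / m\<close> as the value of \<open>f'\<close> at \<open>(z, x)\<close>.\<close>
  define k where "k = \<mu> z / m"
  have k: "f' z x = k" "f' x z = k" if x: "x \<in> carrier G" for x
  proof -
    have "\<mu> (x \<otimes> z) = \<mu> (z \<otimes> x)" using center_comm[OF z_center x] by simp
    then show "f' z x = k" "f' x z = k"
      using x comm[OF x] \<mu>nz[OF x] mnz \<mu>[OF x] f
      by (simp_all add: f'_def coboundary_def k_def)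
  qed
  have knz: "k \<noteq> 0" using \<mu>nz[of z] mnz by (simp add: k_def)
  have nz': "f' x y \<noteq> 0" for x y using f' by simp
  obtain h where "h \<in> schur_cocycles (G Mod Z)" "inflation h = f'"
  proof (rule descend[OF f'])
    fix x y assume c: "x \<in> carrier G" "y \<in> carrier G"
    show "f' (z \<otimes> x) y = f' x y"
      using cocycle_eq[OF f' z_closed c] k c knz by simp
    have "f' x z * f' (x \<otimes> z) y = f' z y * f' x (z \<otimes> y)"
      using cocycle_eq[OF f' c(1) z_closed c(2)] .
    moreover have "f' (x \<otimes> z) y = f' x y"
      using cocycle_eq[OF f' z_closed c] k c knz center_comm[OF z_center c(1)] by simp
    ultimately show "f' x (z \<otimes> y) = f' x y" using k c knz by simp
  qed
  then show ?thesis using that ff' by blast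
qed

text \<open>The class of \<open>t j\<close> is the transgression of the \<open>j\<close>-th
  character of \<open>Z\<close>: a function \<open>\<nu>\<close> on \<open>G\<close> that transforms
  by this character under \<open>z\<close> has a coboundary invariant under \<open>z\<close>, which
  descends to the quotient. If \<open>z\<close> lies in the derived subgroup then different
  \<open>j\<close> give different classes, because every character of \<open>G\<close> is 1 at
  \<open>z\<close>.\<close>

lemma transgression:
  obtains t where "\<And>j. t j \<in> schur_cocycles (G Mod Z)"
    "\<And>j. (inflation (t j), \<lambda>x y. 1) \<in> cohomologous G"
    "\<And>i j. z \<in> derived G (carrier G) \<Longrightarrow> i < p \<Longrightarrow> j < p \<Longrightarrow>
      (t i, t j) \<in> cohomologous (G Mod Z) \<Longrightarrow> i = j"
proof -
  have "\<exists>h \<nu>. h \<in> schur_cocycles (G Mod Z) \<and> inflation h = coboundary G \<nu> \<and>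
     (\<forall>x\<in>carrier G. \<nu> x \<noteq> 0) \<and> (\<forall>x\<in>carrier G. \<nu> (z \<otimes> x) = root_of_unity p (int j) * \<nu> x)" for j
  proof -
    have "root_of_unity p (int j) ^ k = root_of_unity p (int k * int j)" for k
    proof (induction k)
      case (Suc k)
      have "int (Suc k) * int j = int j + int k * int j" by (simp add: algebra_simps)
      then show ?case using Suc by (simp only: root_of_unity_add power_Suc)
    qed (simp add: root_of_unity_def)
    then have zp: "root_of_unity p (int j) ^ p = 1"
      using p_pos by (simp add: root_of_unity_eq_1_iff)
    obtain \<nu> where nz: "\<And>x. x \<in> carrier G \<Longrightarrow> \<nu> x \<noteq> 0"
      and \<nu>: "\<And>x. x \<in> carrier G \<Longrightarrow> \<nu> (z \<otimes> x) = root_of_unity p (int j) * \<nu> x"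
      by (rule coset_recurrence[of "\<lambda>x. root_of_unity p (int j)"]) (auto simp: zp)
    obtain h where "h \<in> schur_cocycles (G Mod Z)" "inflation h = coboundary G \<nu>"
    proof (rule descend[OF coboundary_cocycle[OF nz]])
      fix x y assume c: "x \<in> carrier G" "y \<in> carrier G"
      show "coboundary G \<nu> (z \<otimes> x) y = coboundary G \<nu> x y"
        using c by (simp add: coboundary_def \<nu> m_assoc)
      have "x \<otimes> (z \<otimes> y) = z \<otimes> (x \<otimes> y)"
        using c center_comm[OF z_center c(1)] by (metis m_assoc z_closed)
      then show "coboundary G \<nu> x (z \<otimes> y) = coboundary G \<nu> x y"
        using c by (simp add: coboundary_def \<nu>)
    qed
    then show ?thesis using nz \<nu> by blast
  qed
  then obtain t \<nu> where t: "\<And>j. t j \<in> schur_cocycles (G Mod Z)"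
    "\<And>j. inflation (t j) = coboundary G (\<nu> j)"
    and nz: "\<And>j x. x \<in> carrier G \<Longrightarrow> \<nu> j x \<noteq> 0"
    and \<nu>: "\<And>j x. x \<in> carrier G \<Longrightarrow> \<nu> j (z \<otimes> x) = root_of_unity p (int j) * \<nu> j x"
    by metis
  show ?thesis
  proof (rule that[of t])
    show "t j \<in> schur_cocycles (G Mod Z)" for j by (rule t)
    show "(inflation (t j), \<lambda>x y. 1) \<in> cohomologous G" for j
      unfolding t(2) by (rule coboundary_cohomologous_trivial[OF nz])
    fix i j assume d: "z \<in> derived G (carrier G)" and ij: "i < p" "j < p"
      and coh: "(t i, t j) \<in> cohomologous (G Mod Z)"
    obtain g where g: "\<forall>x\<in>carrier (G Mod Z). g x \<noteq> 0"
      "\<forall>x\<in>carrier (G Mod Z). \<forall>y\<in>carrier (G Mod Z).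
         t i x y = t j x y * (g x * g y / g (x \<otimes>\<^bsub>G Mod Z\<^esub> y))"
      using cohomologousD(3)[OF coh] by blast
    \<comment> \<open>If \<open>g\<close> cobounds the quotient of \<open>t i\<close> by
      \<open>t j\<close>, the coboundary factors cancel and \<open>\<chi>\<close> is a character of
      \<open>G\<close>; its value at \<open>z\<close> is the root of unity with exponent
      \<open>i - j\<close>.\<close>
    define \<chi> where "\<chi> x = \<nu> i x / (\<nu> j x * g (Z #> x))" for x
    have gnz: "g (Z #> x) \<noteq> 0" if "x \<in> carrier G" for x using g(1) coset_in_quot[OF that] by blast
    have \<chi>nz: "\<chi> x \<noteq> 0" if "x \<in> carrier G" for x using nz gnz that by (simp add: \<chi>_def)
    have hom: "\<chi> (x \<otimes> y) = \<chi> x * \<chi> y" if c: "x \<in> carrier G" "y \<in> carrier G" for x y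
    proof -
      have "t i (Z #> x) (Z #> y) = t j (Z #> x) (Z #> y) *
          (g (Z #> x) * g (Z #> y) / g (Z #> (x \<otimes> y)))"
        using g(2) coset_in_quot c coset_mult[OF c] by metis
      moreover have "t i (Z #> x) (Z #> y) = \<nu> i x * \<nu> i y / \<nu> i (x \<otimes> y)" for i
        using fun_cong[OF fun_cong[OF t(2)[of i]], of x y] c
        by (simp add: inflation_def coboundary_def)
      ultimately have "\<nu> i x * \<nu> i y / \<nu> i (x \<otimes> y) = \<nu> j x * \<nu> j y / \<nu> j (x \<otimes> y) *
          (g (Z #> x) * g (Z #> y) / g (Z #> (x \<otimes> y)))" by simp
      then show ?thesis
        unfolding \<chi>_def using nz gnz c m_closed[OF c] by (simp add: field_simps)
    qed
    have "\<chi> \<one> = 1" using hom[of \<one> \<one>] \<chi>nz[of \<one>] by simp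
    moreover have "\<chi> z = 1" by (rule hom_trivial_on_derived[OF \<chi>nz hom d])
    moreover have "\<chi> z = root_of_unity p (int i - int j) * \<chi> \<one>"
      using \<nu>[OF one_closed, of i] \<nu>[OF one_closed, of j] coset_z_mult[OF one_closed]
      by (simp add: \<chi>_def root_of_unity_diff)
    ultimately have "int p dvd int i - int j" using p_pos by (simp add: root_of_unity_eq_1_iff)
    then show "i = j" using ij
      by (metis mod_eq_dvd_iff of_nat_eq_iff mod_pos_pos_trivial of_nat_0_le_iff of_nat_less_iff)
  qed
qed

end

section \<open>Comparing the multipliers of a group and of its quotient\<close>

context group
begin

lemma quotient_rep:
  assumes "c \<in> schur_multiplier G"
  obtains f where "f \<in> schur_cocycles G" "c = cohomologous G `` {f}"
  using assms unfolding schur_multiplier_def by (auto elim: quotientE)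

lemma cohomologous_class_eq_iff:
  assumes "f \<in> schur_cocycles G" "f' \<in> schur_cocycles G"
  shows "cohomologous G `` {f} = cohomologous G `` {f'} \<longleftrightarrow> (f, f') \<in> cohomologous G"
  using eq_equiv_class_iff[OF equiv_cohomologous assms] .

lemma cohomologous_class_in:
  "f \<in> schur_cocycles G \<Longrightarrow> cohomologous G `` {f} \<in> schur_multiplier G"
  unfolding schur_multiplier_def by (rule quotientI)

end

context central_prime
begin

abbreviation pairings :: "('a \<Rightarrow> complex) set" where
  "pairings \<equiv> pairing G z ` schur_cocycles G"

text \<open>A class \<open>c\<close> is encoded by the pairing of a chosen representative and by a
  class on the quotient that inflates to what remains after division by a fixed cocycle
  \<open>R\<close> with the same pairing. Multiplication by \<open>t j\<close> does not change the
  inflated class, so it yields \<open>q\<close> different codes for \<open>c\<close>. The value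
  \<open>q = 1\<close> gives the plain bound, \<open>q = p\<close> the bound with the extra factor
  \<open>p\<close>.\<close>

lemma schur_multiplier_injection:
  assumes q: "q \<le> p" "q \<le> 1 \<or> z \<in> derived G (carrier G)"
  obtains \<Psi> where "inj_on \<Psi> ({..<q} \<times> schur_multiplier G)"
    "\<Psi> ` ({..<q} \<times> schur_multiplier G) \<subseteq> schur_multiplier (G Mod Z) \<times> pairings"
proof -
  interpret H: group "G Mod Z" by (rule Z.factorgroup_is_group)
  obtain t where t: "\<And>j. t j \<in> schur_cocycles (G Mod Z)"
    "\<And>j. (inflation (t j), \<lambda>x y. 1) \<in> cohomologous G"
    "\<And>i j. z \<in> derived G (carrier G) \<Longrightarrow> i < p \<Longrightarrow> j < p \<Longrightarrow>
      (t i, t j) \<in> cohomologous (G Mod Z) \<Longrightarrow> i = j"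
    by (rule transgression) (rule that)
  have "\<forall>c\<in>schur_multiplier G. \<exists>f. f \<in> schur_cocycles G \<and> c = cohomologous G `` {f}"
    using quotient_rep by metis
  then obtain F where F: "\<And>c. c \<in> schur_multiplier G \<Longrightarrow> F c \<in> schur_cocycles G"
    "\<And>c. c \<in> schur_multiplier G \<Longrightarrow> c = cohomologous G `` {F c}"
    by metis
  have "\<forall>a\<in>pairings. \<exists>f. f \<in> schur_cocycles G \<and> pairing G z f = a" by blast
  then obtain R where R: "\<And>a. a \<in> pairings \<Longrightarrow> R a \<in> schur_cocycles G"
    "\<And>a. a \<in> pairings \<Longrightarrow> pairing G z (R a) = a"
    by metis
  define A where "A c = pairing G z (F c)" for c
  have A: "A c \<in> pairings" if "c \<in> schur_multiplier G" for c
    using F(1)[OF that] by (simp add: A_def)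
  define D where "D c = (\<lambda>x y. F c x y / R (A c) x y)" for c
  have D: "D c \<in> schur_cocycles G" if "c \<in> schur_multiplier G" for c
    unfolding D_def by (intro cocycle_divide F(1) R(1) A that)
  have "\<exists>h. h \<in> schur_cocycles (G Mod Z) \<and> (D c, inflation h) \<in> cohomologous G"
    if c: "c \<in> schur_multiplier G" for c
  proof -
    have "pairing G z (D c) g = 1" for g
      unfolding D_def pairing_divide[OF F(1)[OF c] R(1)[OF A[OF c]]] R(2)[OF A[OF c]]
      using F(1)[OF c] by (simp add: A_def pairing_def)
    then have ker: "pairing G z (D c) = (\<lambda>g. 1)" by blast
    obtain h where "h \<in> schur_cocycles (G Mod Z)" "(D c, inflation h) \<in> cohomologous G"
      by (rule pairing_kernel[OF D[OF c] ker])
    then show ?thesis by (intro exI[of _ h] conjI)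
  qed
  then obtain h where h: "\<And>c. c \<in> schur_multiplier G \<Longrightarrow> h c \<in> schur_cocycles (G Mod Z)"
    "\<And>c. c \<in> schur_multiplier G \<Longrightarrow> (D c, inflation (h c)) \<in> cohomologous G"
    by metis
  define T where "T j c = (\<lambda>x y. h c x y * t j x y)" for j c
  have T: "T j c \<in> schur_cocycles (G Mod Z)" if "c \<in> schur_multiplier G" for j c
    unfolding T_def by (intro cocycle_mult h(1) t(1) that)
  have infl_T: "(inflation (T j c), D c) \<in> cohomologous G" if c: "c \<in> schur_multiplier G" for j c
  proof -
    have "inflation (T j c) = (\<lambda>x y. inflation (h c) x y * inflation (t j) x y)"
      by (intro ext) (simp add: inflation_def T_def)
    moreover have "((\<lambda>x y. inflation (h c) x y * inflation (t j) x y), (\<lambda>x y. D c x y * 1))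
      \<in> cohomologous G"
      by (intro cohomologous_mult t(2) cohomologous_sym[OF h(2)] c)
    ultimately show ?thesis by simp
  qed
  define \<Psi> where "\<Psi> = (\<lambda>(j, c). (cohomologous (G Mod Z) `` {T j c}, A c))"
  show ?thesis
  proof (rule that[of \<Psi>])
    show "inj_on \<Psi> ({..<q} \<times> schur_multiplier G)"
    proof (rule inj_onI)
      fix u v assume "u \<in> {..<q} \<times> schur_multiplier G" "v \<in> {..<q} \<times> schur_multiplier G"
        and eq: "\<Psi> u = \<Psi> v"
      then obtain i c j d where u: "u = (i, c)" "i < q" "c \<in> schur_multiplier G"
        and v: "v = (j, d)" "j < q" "d \<in> schur_multiplier G" by auto
      have Aeq: "A c = A d" and "cohomologous (G Mod Z) `` {T i c} = cohomologous (G Mod Z) `` {T j d}"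
        using eq u v by (simp_all add: \<Psi>_def)
      then have coh: "(T i c, T j d) \<in> cohomologous (G Mod Z)"
        using H.cohomologous_class_eq_iff[OF T[OF u(3)] T[OF v(3)]] by simp
      have "(D c, D d) \<in> cohomologous G"
        using cohomologous_trans[OF cohomologous_trans[OF cohomologous_sym[OF infl_T[OF u(3)]]
            inflation_cohomologous[OF coh]] infl_T[OF v(3)]] .
      then have "((\<lambda>x y. D c x y * R (A c) x y), (\<lambda>x y. D d x y * R (A c) x y)) \<in> cohomologous G"
        by (intro cohomologous_mult cohomologous_refl R(1) A u(3))
      then have "(F c, F d) \<in> cohomologous G"
        using R(1)[OF A[OF u(3)]] Aeq by (simp add: D_def)
      then have cd: "c = d"
        using F(2)[OF u(3)] F(2)[OF v(3)] cohomologous_class_eq_iff[OF F(1)[OF u(3)] F(1)[OF v(3)]]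
        by simp
      have "((\<lambda>x y. T i c x y / h c x y), (\<lambda>x y. T j d x y / h c x y)) \<in> cohomologous (G Mod Z)"
        by (intro H.cohomologous_divide coh H.cohomologous_refl h(1) u(3))
      then have "(t i, t j) \<in> cohomologous (G Mod Z)"
        using h(1)[OF u(3)] unfolding T_def cd by simp
      then have "i = j" using q t(3)[of i j] u(2) v(2) by (cases "q \<le> 1") auto
      then show "u = v" using u v cd by simp
    qed
    show "\<Psi> ` ({..<q} \<times> schur_multiplier G) \<subseteq> schur_multiplier (G Mod Z) \<times> pairings"
      using A T H.cohomologous_class_in by (auto simp: \<Psi>_def)
  qed
qed

lemma schur_multiplier_step:
  assumes fin: "finite (schur_multiplier (G Mod Z))" "finite pairings"
  shows "finite (schur_multiplier G)"
    and "card (schur_multiplier G) \<le> card (schur_multiplier (G Mod Z)) * card pairings"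
    and "z \<in> derived G (carrier G) \<Longrightarrow>
      p * card (schur_multiplier G) \<le> card (schur_multiplier (G Mod Z)) * card pairings"
proof -
  let ?T = "schur_multiplier (G Mod Z) \<times> pairings"
  have finT: "finite ?T" using fin by simp
  have q: "finite ({..<q} \<times> schur_multiplier G) \<and> q * card (schur_multiplier G) \<le> card ?T"
    if q: "q \<le> p" "q \<le> 1 \<or> z \<in> derived G (carrier G)" for q
  proof -
    obtain \<Psi> where \<Psi>: "inj_on \<Psi> ({..<q} \<times> schur_multiplier G)"
      "\<Psi> ` ({..<q} \<times> schur_multiplier G) \<subseteq> ?T"
      by (rule schur_multiplier_injection[OF q])
    show ?thesis
      using inj_on_finite[OF \<Psi> finT] card_inj_on_le[OF \<Psi> finT]
      by (simp add: card_cartesian_product)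
  qed
  show "finite (schur_multiplier G)"
    using q[of 1] p_pos by (auto simp: finite_cartesian_product_iff lessThan_empty_iff)
  show "card (schur_multiplier G) \<le> card (schur_multiplier (G Mod Z)) * card pairings"
    using q[of 1] p_pos by (simp add: card_cartesian_product)
  show "p * card (schur_multiplier G) \<le> card (schur_multiplier (G Mod Z)) * card pairings"
    if "z \<in> derived G (carrier G)"
    using q[of p] that by (simp add: card_cartesian_product)
qed

end

section \<open>The central extension of a cocycle\<close>

text \<open>Cocycles are not normalised, which is why the unit carries the scalar
  \<open>1 / f \<one> \<one>\<close>.\<close>

definition central_extension ::
  "('a, 'b) monoid_scheme \<Rightarrow> ('a \<Rightarrow> 'a \<Rightarrow> complex) \<Rightarrow> (complex \<times> 'a) monoid" where
  "central_extension G f = \<lparr>carrier = {c. c \<noteq> 0} \<times> carrier G,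
     monoid.mult = (\<lambda>(a, x) (b, y). (a * b * f x y, x \<otimes>\<^bsub>G\<^esub> y)),
     one = (1 / f \<one>\<^bsub>G\<^esub> \<one>\<^bsub>G\<^esub>, \<one>\<^bsub>G\<^esub>)\<rparr>"

lemma central_extension_simps [simp]:
  "carrier (central_extension G f) = {c. c \<noteq> 0} \<times> carrier G"
  "(a, x) \<otimes>\<^bsub>central_extension G f\<^esub> (b, y) = (a * b * f x y, x \<otimes>\<^bsub>G\<^esub> y)"
  "\<one>\<^bsub>central_extension G f\<^esub> = (1 / f \<one>\<^bsub>G\<^esub> \<one>\<^bsub>G\<^esub>, \<one>\<^bsub>G\<^esub>)"
  by (simp_all add: central_extension_def)

context group
begin

lemma group_central_extension:
  assumes f: "f \<in> schur_cocycles G"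
  shows "group (central_extension G f)"
proof (rule groupI)
  have nz: "f x y \<noteq> 0" for x y using f by simp
  fix u assume u: "u \<in> carrier (central_extension G f)"
  obtain a x where ax: "u = (a, x)" "a \<noteq> 0" "x \<in> carrier G" using u by auto
  show "\<one>\<^bsub>central_extension G f\<^esub> \<otimes>\<^bsub>central_extension G f\<^esub> u = u"
    using ax nz[of \<one> \<one>] cocycle_one_left[OF f ax(3)] by simp
  have "(1 / (a * f (inv x) x * f \<one> \<one>), inv x) \<in> carrier (central_extension G f)"
    using ax nz by simp
  moreover have "(1 / (a * f (inv x) x * f \<one> \<one>), inv x) \<otimes>\<^bsub>central_extension G f\<^esub> u =
      \<one>\<^bsub>central_extension G f\<^esub>"
    using ax nz by simp
  ultimately show "\<exists>v\<in>carrier (central_extension G f).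
      v \<otimes>\<^bsub>central_extension G f\<^esub> u = \<one>\<^bsub>central_extension G f\<^esub>" by blast
next
  fix u v w assume "u \<in> carrier (central_extension G f)" "v \<in> carrier (central_extension G f)"
    "w \<in> carrier (central_extension G f)"
  then obtain a x b y c z where e: "u = (a, x)" "v = (b, y)" "w = (c, z)"
    and xyz: "x \<in> carrier G" "y \<in> carrier G" "z \<in> carrier G" by auto
  have "a * b * c * (f x y * f (x \<otimes> y) z) = a * b * c * (f y z * f x (y \<otimes> z))"
    using cocycle_eq[OF f xyz] by simp
  then show "u \<otimes>\<^bsub>central_extension G f\<^esub> v \<otimes>\<^bsub>central_extension G f\<^esub> w =
      u \<otimes>\<^bsub>central_extension G f\<^esub> (v \<otimes>\<^bsub>central_extension G f\<^esub> w)"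
    unfolding e using xyz by (simp add: m_assoc ac_simps)
qed (use f in \<open>auto simp: m_assoc\<close>)

lemma pairing_eq_1_iff:
  assumes f: "f \<in> schur_cocycles G" and g: "g \<in> carrier G" and gz: "g \<otimes> z = z \<otimes> g"
    and nz: "a \<noteq> 0" "b \<noteq> 0"
  shows "pairing G z f g = 1 \<longleftrightarrow>
    (a, g) \<otimes>\<^bsub>central_extension G f\<^esub> (b, z) = (b, z) \<otimes>\<^bsub>central_extension G f\<^esub> (a, g)"
  using f g gz nz by (simp add: pairing_def)

lemma central_extension_pow:
  assumes f: "f \<in> schur_cocycles G" and u: "u \<in> carrier (central_extension G f)"
  shows "snd (u [^]\<^bsub>central_extension G f\<^esub> (k::nat)) = snd u [^] k"
    and "fst (u [^]\<^bsub>central_extension G f\<^esub> (k::nat)) \<noteq> 0"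
proof -
  interpret E: group "central_extension G f" by (rule group_central_extension[OF f])
  show "snd (u [^]\<^bsub>central_extension G f\<^esub> k) = snd u [^] k"
  proof (induction k)
    case (Suc k)
    obtain b y where "u = (b, y)" by (cases u)
    moreover obtain a x where "u [^]\<^bsub>central_extension G f\<^esub> k = (a, x)" by (cases "u [^]\<^bsub>central_extension G f\<^esub> k")
    ultimately show ?case using Suc by simp
  qed simp
  show "fst (u [^]\<^bsub>central_extension G f\<^esub> k) \<noteq> 0"
    using E.nat_pow_closed[OF u, of k] by (auto simp: mem_Times_iff)
qed

text \<open>The \<open>k\<close>-th power of a lift of \<open>x\<close> is a lift of
  \<open>x [^] k\<close>, and it commutes with that lift of \<open>x\<close>. Roots of
  \<open>z\<close> are therefore elements on which the pairing with \<open>z\<close>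
  vanishes.\<close>

lemma pairing_of_root:
  assumes f: "f \<in> schur_cocycles G" and x: "x \<in> carrier G"
  shows "pairing G (x [^] (k::nat)) f x = 1"
proof -
  interpret E: group "central_extension G f" by (rule group_central_extension[OF f])
  let ?u = "(1, x)"
  have u: "?u \<in> carrier (central_extension G f)" using x by simp
  define b where "b = fst (?u [^]\<^bsub>central_extension G f\<^esub> k)"
  have b: "?u [^]\<^bsub>central_extension G f\<^esub> k = (b, x [^] k)" "b \<noteq> 0"
    using central_extension_pow[OF f u, of k] unfolding b_def by (auto simp: prod_eq_iff)
  have "?u \<otimes>\<^bsub>central_extension G f\<^esub> (b, x [^] k) = (b, x [^] k) \<otimes>\<^bsub>central_extension G f\<^esub> ?u"
    using E.nat_pow_comm[OF u, of k 1] unfolding E.nat_pow_eone[OF u] b(1) by (rule sym)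
  then show ?thesis
    using pairing_eq_1_iff[OF f x, of "x [^] k" 1 b] b(2) x nat_pow_comm[OF x, of 1 k] by simp
qed

end

section \<open>Counting pairings\<close>

text \<open>The pairings with an element of order \<open>p\<close> are characters of this kind, so
  the order of this set bounds their number. The value off the carrier is fixed as in
  \<open>pairing\<close>.\<close>

definition char_ann :: "('a, 'b) monoid_scheme \<Rightarrow> nat \<Rightarrow> 'a set \<Rightarrow> ('a \<Rightarrow> complex) set" where
  "char_ann G p S = {\<alpha>. (\<forall>g. g \<notin> carrier G \<longrightarrow> \<alpha> g = 1) \<and>
     (\<forall>g\<in>carrier G. \<forall>h\<in>carrier G. \<alpha> (g \<otimes>\<^bsub>G\<^esub> h) = \<alpha> g * \<alpha> h) \<and>
     (\<forall>g\<in>carrier G. \<alpha> g ^ p = 1) \<and> (\<forall>g\<in>S. \<alpha> g = 1)}"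

context p_group
begin

lemma char_kernel_subgroup:
  fixes \<alpha> :: "'a \<Rightarrow> complex"
  assumes "\<And>g. g \<in> carrier G \<Longrightarrow> \<alpha> g ^ p = 1"
    and "\<And>g h. g \<in> carrier G \<Longrightarrow> h \<in> carrier G \<Longrightarrow> \<alpha> (g \<otimes> h) = \<alpha> g * \<alpha> h"
  shows "subgroup {g \<in> carrier G. \<alpha> g = 1} G"
proof -
  have nz: "\<alpha> g \<noteq> 0" if "g \<in> carrier G" for g
    using assms(1)[OF that] p_gt_1 by (intro notI) (simp add: power_0_left)
  have one: "\<alpha> \<one> = 1" using assms(2)[of \<one> \<one>] nz[of \<one>] by simp
  show ?thesis
  proof (rule subgroupI)
    fix x assume "x \<in> {x \<in> carrier G. \<alpha> x = 1}"
    then show "inv x \<in> {x \<in> carrier G. \<alpha> x = 1}" using assms(2)[of "inv x" x] one by simp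
  qed (use assms(2) one in auto)
qed

text \<open>Adjoining \<open>x\<close> to \<open>S\<close> costs at most a factor \<open>p\<close>:
  there are \<open>p\<close> possible values at \<open>x\<close>, and division by a fixed member of
  a fibre embeds the fibre in the annihilator of the larger subgroup. As the index is only bounded
  by \<open>p ^ k\<close>, the induction may reach the whole group early.\<close>

lemma card_char_ann:
  assumes "subgroup S G" "p ^ n \<le> card S * p ^ k"
  shows "finite (char_ann G p S) \<and> card (char_ann G p S) \<le> p ^ k"
  using assms
proof (induction k arbitrary: S)
  case 0
  have "card S \<ge> card (carrier G)" using 0 card_carrier by simp
  then have S: "S = carrier G"
    using 0(1) by (meson card_seteq finite_carrier subgroup.subset)
  have "char_ann G p S \<subseteq> {\<lambda>g. 1}"
  proof
    fix \<alpha> assume "\<alpha> \<in> char_ann G p S"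
    then have "\<alpha> g = 1" for g unfolding char_ann_def S by blast
    then show "\<alpha> \<in> {\<lambda>g. 1}" by auto
  qed
  then show ?case
    using card_mono[of "{\<lambda>g. 1}" "char_ann G p S"] by (auto intro: finite_subset)
next
  case (Suc k)
  show ?case
  proof (cases "S = carrier G")
    case True
    then have "p ^ n \<le> card S * p ^ k" using card_carrier p_gt_1 by simp
    then have "finite (char_ann G p S) \<and> card (char_ann G p S) \<le> p ^ k"
      using Suc by blast
    moreover have "p ^ k \<le> p ^ Suc k" using p_gt_1 by simp
    ultimately show ?thesis by linarith
  next
    case False
    then obtain x where x: "x \<in> carrier G" "x \<notin> S"
      using subgroup.subset[OF Suc.prems(1)] by blast
    define T where "T = generate G (insert x S)"
    have sub: "insert x S \<subseteq> carrier G" using x subgroup.subset[OF Suc.prems(1)] by blast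
    have T: "subgroup T G" unfolding T_def by (rule generate_is_subgroup[OF sub])
    have ST: "insert x S \<subseteq> T" unfolding T_def using generate.incl by (metis subsetI)
    have "p * card S \<le> card T" using psubset_card[OF Suc.prems(1) T] ST x by blast
    then have "p * card S * p ^ k \<le> card T * p ^ k" by (rule mult_le_mono1)
    moreover have "p * card S * p ^ k = card S * p ^ Suc k" by simp
    ultimately have "p ^ n \<le> card T * p ^ k" using Suc.prems(2) by linarith
    then have IH: "finite (char_ann G p T)" "card (char_ann G p T) \<le> p ^ k"
      using Suc.IH[OF T] by blast+
    have fib: "finite {\<alpha> \<in> char_ann G p S. \<alpha> x = c} \<and> card {\<alpha> \<in> char_ann G p S. \<alpha> x = c} \<le> p ^ k" for c
    proof (cases "{\<alpha> \<in> char_ann G p S. \<alpha> x = c} = {}")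
      case True
      then show ?thesis by (metis card.empty finite.emptyI zero_le)
    next
      case False
      then obtain \<beta> where \<beta>: "\<beta> \<in> char_ann G p S" "\<beta> x = c" by blast
      have nz: "\<beta> g \<noteq> 0" for g
      proof (cases "g \<in> carrier G")
        case True
        then have "\<beta> g ^ p = 1" using \<beta>(1) by (simp add: char_ann_def)
        then show ?thesis using p_gt_1 by (intro notI) (simp add: power_0_left)
      next
        case False
        then show ?thesis using \<beta>(1) by (simp add: char_ann_def)
      qed
      let ?\<Phi> = "\<lambda>\<alpha> g. \<alpha> g / \<beta> g"
      have inj: "inj_on ?\<Phi> {\<alpha> \<in> char_ann G p S. \<alpha> x = c}"
      proof (rule inj_onI)
        fix \<alpha> \<gamma> assume "?\<Phi> \<alpha> = ?\<Phi> \<gamma>"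
        then have "\<alpha> g = \<gamma> g" for g using nz[of g] by (metis nonzero_divide_eq_eq)
        then show "\<alpha> = \<gamma>" by blast
      qed
      have im: "?\<Phi> ` {\<alpha> \<in> char_ann G p S. \<alpha> x = c} \<subseteq> char_ann G p T"
      proof clarify
        fix \<alpha> assume \<alpha>: "\<alpha> \<in> char_ann G p S" "c = \<alpha> x"
        have pw: "?\<Phi> \<alpha> g ^ p = 1" if "g \<in> carrier G" for g
          using \<alpha>(1) \<beta>(1) that by (simp add: char_ann_def power_divide)
        have hom: "?\<Phi> \<alpha> (g \<otimes> h) = ?\<Phi> \<alpha> g * ?\<Phi> \<alpha> h" if "g \<in> carrier G" "h \<in> carrier G" for g h
          using \<alpha>(1) \<beta>(1) that by (simp add: char_ann_def)
        have K: "subgroup {g \<in> carrier G. ?\<Phi> \<alpha> g = 1} G"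
          using pw hom by (rule char_kernel_subgroup)
        have "insert x S \<subseteq> {g \<in> carrier G. ?\<Phi> \<alpha> g = 1}"
          using \<alpha> \<beta> sub nz[of x] by (auto simp: char_ann_def)
        then have "T \<subseteq> {g \<in> carrier G. ?\<Phi> \<alpha> g = 1}"
          unfolding T_def by (rule generate_subgroup_incl[OF _ K])
        then have "?\<Phi> \<alpha> g = 1" if "g \<in> T" for g using that by blast
        moreover have "?\<Phi> \<alpha> g = 1" if "g \<notin> carrier G" for g
          using \<alpha>(1) \<beta>(1) that by (simp add: char_ann_def)
        ultimately show "?\<Phi> \<alpha> \<in> char_ann G p T"
          using pw hom unfolding char_ann_def by blast
      qed
      show ?thesis
        using inj_on_finite[OF inj im IH(1)] card_inj_on_le[OF inj im IH(1)] IH(2) by linarith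
    qed
    have un: "char_ann G p S = (\<Union>c\<in>{c. c ^ p = 1}. {\<alpha> \<in> char_ann G p S. \<alpha> x = c})"
      using x(1) by (auto simp: char_ann_def)
    have R: "finite {c::complex. c ^ p = 1}" "card {c::complex. c ^ p = 1} = p"
      using p_gt_1 by (auto intro: finite_roots_unity card_roots_unity_eq)
    have fin: "finite (char_ann G p S)" by (subst un) (use R fib in blast)
    have "card (char_ann G p S) \<le> (\<Sum>c\<in>{c. c ^ p = 1}. card {\<alpha> \<in> char_ann G p S. \<alpha> x = c})"
      by (subst un) (rule card_UN_le[OF R(1)])
    also have "\<dots> \<le> p * p ^ k"
      using sum_bounded_above[of "{c. c ^ p = 1}" "\<lambda>c. card {\<alpha> \<in> char_ann G p S. \<alpha> x = c}" "p ^ k"]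
        fib R(2) by simp
    finally show ?thesis using fin by simp
  qed
qed

lemma pairing_in_char_ann:
  assumes f: "f \<in> schur_cocycles G" and z: "z \<in> center G" "z [^] p = \<one>"
    and S: "S \<subseteq> carrier G" "\<And>g. g \<in> S \<Longrightarrow> pairing G z f g = 1"
  shows "pairing G z f \<in> char_ann G p S"
  unfolding char_ann_def
proof (intro CollectI conjI allI ballI impI)
  fix g assume g: "g \<in> carrier G"
  have "pairing G z f g ^ p = pairing G \<one> f g"
    using pairing_pow[OF f z(1) g, of p] z(2) by simp
  also have "\<dots> = 1"
    using pairing_pow[OF f z(1) g, of 0] by simp
  finally show "pairing G z f g ^ p = 1" .
qed (use S pairing_mult_left[OF f z(1)] in \<open>auto simp: pairing_def\<close>)

lemma pairing_derived:
  assumes f: "f \<in> schur_cocycles G" and z: "z \<in> center G"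
    and w: "w \<in> derived G (carrier G)"
  shows "pairing G z f w = 1"
proof -
  have "\<And>x. x \<in> carrier G \<Longrightarrow> pairing G z f x \<noteq> 0" using f by (simp add: pairing_def)
  then show ?thesis using hom_trivial_on_derived pairing_mult_left[OF f z] w by blast
qed

lemma pairing_pow_left:
  assumes f: "f \<in> schur_cocycles G" and z: "z \<in> center G" and x: "x \<in> carrier G"
  shows "pairing G z f (x [^] (k::nat)) = pairing G z f x ^ k"
proof (induction k)
  case 0
  show ?case using pairing_derived[OF f z subgroup.one_closed[OF subgroup_derived]] by simp
next
  case (Suc k)
  then show ?case using pairing_mult_left[OF f z, of "x [^] k" x] x by simp
qed

lemma pairing_p_power:
  assumes f: "f \<in> schur_cocycles G" and z: "z \<in> center G" "z [^] p = \<one>"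
    and x: "x \<in> carrier G"
  shows "pairing G z f (x [^] p) = 1"
proof -
  have "pairing G z f \<in> char_ann G p {}" by (rule pairing_in_char_ann[OF f z]) auto
  then show ?thesis unfolding pairing_pow_left[OF f z(1) x] using x by (simp add: char_ann_def)
qed

lemma p_group_quotient:
  assumes z: "z \<in> center G" "z \<noteq> \<one>" "z [^] p = \<one>"
  shows "p_group (G Mod generate G {z}) p (n - 1)" and "n > 0"
proof -
  interpret C: central_prime G z p
    by unfold_locales (use z prime_p in auto)
  have "card (rcosets C.Z) * p = p ^ n"
    using lagrange[OF C.Z.subgroup_axioms] C.card_Z card_carrier by (simp add: order_def)
  moreover have "n \<noteq> 0"
  proof
    assume "n = 0"
    then have "card (carrier G) = 1" using card_carrier by simp
    then show False using z(2) C.z_closed by (metis card_1_singletonE one_closed singletonD)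
  qed
  ultimately show n: "n > 0" and "p_group (G Mod generate G {z}) p (n - 1)"
  proof -
    assume a: "card (rcosets C.Z) * p = p ^ n" "n \<noteq> 0"
    then have "card (rcosets C.Z) * p = p ^ (n - 1) * p" by (metis power_minus_mult not_gr_zero)
    then have "card (rcosets C.Z) = p ^ (n - 1)" using p_gt_1 by simp
    then show "p_group (G Mod generate G {z}) p (n - 1)"
      unfolding p_group_def p_group_axioms_def
      using C.Z.factorgroup_is_group prime_p by (simp add: FactGroup_def)
  qed simp
qed

lemma card_coset_image:
  assumes z: "z \<in> center G" "z \<noteq> \<one>" "z [^] p = \<one>"
    and S: "subgroup S G" "z \<in> S"
  shows "p * card ((\<lambda>x. generate G {z} #> x) ` S) = card S"
proof -
  interpret C: central_prime G z p
    by unfold_locales (use z prime_p in auto)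
  interpret S: subgroup S G by (rule S(1))
  have ZS: "C.Z \<subseteq> S" using S by (intro generate_subgroup_incl) auto
  let ?C = "(\<lambda>x. C.Z #> x) ` S"
  have un: "\<Union>?C = S"
  proof
    show "\<Union>?C \<subseteq> S" using ZS S.m_closed by (auto simp: r_coset_def)
    show "S \<subseteq> \<Union>?C" using rcos_self[OF _ C.Z.subgroup_axioms] S.subset by blast
  qed
  have sub: "?C \<subseteq> rcosets C.Z" using S.subset by (auto simp: RCOSETS_def)
  have "p * card ?C = card (\<Union>?C)"
  proof (rule card_partition)
    show "finite ?C" "finite (\<Union>?C)" using finite_subgroup[OF S(1)] un by auto
    show "card c = p" if "c \<in> ?C" for c
      using that sub card_rcosets_equal[of c C.Z] C.card_Z C.Z.subset by auto
    show "c \<inter> d = {}" if "c \<in> ?C" "d \<in> ?C" "c \<noteq> d" for c d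
      using pairwiseD[OF rcos_disjoint[OF C.Z.subgroup_axioms], of c d] that sub
      by (simp add: disjnt_def subset_iff)
  qed
  then show ?thesis unfolding un .
qed

lemma derived_quotient:
  assumes z: "z \<in> center G"
  shows "derived (G Mod generate G {z}) (carrier (G Mod generate G {z})) =
    (\<lambda>x. generate G {z} #> x) ` derived G (carrier G)"
proof -
  interpret N: normal "generate G {z}" G by (rule normal_generate_central[OF z])
  interpret h: group_hom G "G Mod generate G {z}" "\<lambda>x. generate G {z} #> x"
    unfolding group_hom_def group_hom_axioms_def
    using N.factorgroup_is_group N.r_coset_hom_Mod is_group by blast
  show ?thesis using h.derived_img[of "carrier G"] by (simp add: carrier_FactGroup)
qed

text \<open>The common form of the estimates below: \<open>m\<close> bounds the multiplier of the
  quotient, \<open>p ^ k\<close> bounds the index of \<open>S\<close> and hence the number of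
  pairings, and the third conclusion has the gain from the kernel of inflation.\<close>

lemma schur_multiplier_bound:
  assumes z: "z \<in> center G" "z \<noteq> \<one>" "z [^] p = \<one>"
    and S: "subgroup S G" "p ^ n \<le> card S * p ^ k"
    and triv: "\<And>f g. f \<in> schur_cocycles G \<Longrightarrow> g \<in> S \<Longrightarrow> pairing G z f g = 1"
    and fin: "finite (schur_multiplier (G Mod generate G {z}))"
    and bound: "card (schur_multiplier (G Mod generate G {z})) \<le> m"
  shows "finite (schur_multiplier G)" and "card (schur_multiplier G) \<le> m * p ^ k"
    and "z \<in> derived G (carrier G) \<Longrightarrow> p * card (schur_multiplier G) \<le> m * p ^ k"
proof -
  interpret C: central_prime G z p
    by unfold_locales (use z prime_p in auto)
  have sub: "C.pairings \<subseteq> char_ann G p S"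
    using pairing_in_char_ann[OF _ z(1,3) subgroup.subset[OF S(1)] triv] by blast
  note ann = card_char_ann[OF S]
  have finP: "finite C.pairings" using sub ann by (auto intro: finite_subset)
  have "card C.pairings \<le> p ^ k" using ann card_mono[OF _ sub] by auto
  then have le: "card (schur_multiplier (G Mod C.Z)) * card C.pairings \<le> m * p ^ k"
    using bound by (rule mult_le_mono[rotated])
  note step = C.schur_multiplier_step[OF fin finP]
  show "finite (schur_multiplier G)" by (rule step(1))
  show "card (schur_multiplier G) \<le> m * p ^ k" using step(2) le by linarith
  show "p * card (schur_multiplier G) \<le> m * p ^ k" if "z \<in> derived G (carrier G)"
    using step(3)[OF that] le by linarith
qed

end

section \<open>Upper bounds\<close>

definition frattini :: "('a, 'b) monoid_scheme \<Rightarrow> nat \<Rightarrow> 'a set" where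
  "frattini G p = generate G (derived G (carrier G) \<union> (\<lambda>x. x [^]\<^bsub>G\<^esub> p) ` carrier G)"

context p_group
begin

lemma frattini_gens: "derived G (carrier G) \<union> (\<lambda>x. x [^] p) ` carrier G \<subseteq> carrier G"
  using derived_closed by auto

lemma subgroup_frattini: "subgroup (frattini G p) G"
  unfolding frattini_def by (rule generate_is_subgroup[OF frattini_gens])

lemma derived_subset_frattini: "derived G (carrier G) \<subseteq> frattini G p"
  unfolding frattini_def by (auto intro: generate.incl)

lemma pow_in_frattini: "x \<in> carrier G \<Longrightarrow> x [^] p \<in> frattini G p"
  unfolding frattini_def by (auto intro: generate.incl)

lemma subgroup_pairing_kernel:
  assumes f: "f \<in> schur_cocycles G" and z: "z \<in> center G" "z [^] p = \<one>"
  shows "subgroup {g \<in> carrier G. pairing G z f g = 1} G"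
proof (rule char_kernel_subgroup)
  have "pairing G z f \<in> char_ann G p {}" by (rule pairing_in_char_ann[OF f z]) auto
  then show "pairing G z f g ^ p = 1" if "g \<in> carrier G" for g
    using that by (simp add: char_ann_def)
qed (rule pairing_mult_left[OF f z(1)])

lemma pairing_generate:
  assumes f: "f \<in> schur_cocycles G" and z: "z \<in> center G" "z [^] p = \<one>"
    and T: "T \<subseteq> carrier G" "\<And>g. g \<in> T \<Longrightarrow> pairing G z f g = 1"
    and g: "g \<in> generate G T"
  shows "pairing G z f g = 1"
proof -
  have "generate G T \<subseteq> {g \<in> carrier G. pairing G z f g = 1}"
    by (rule generate_subgroup_incl[OF _ subgroup_pairing_kernel[OF f z]]) (use T in auto)
  then show ?thesis using g by blast
qed

lemma pairing_frattini:
  assumes "f \<in> schur_cocycles G" "z \<in> center G" "z [^] p = \<one>" "g \<in> frattini G p"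
  shows "pairing G z f g = 1"
  using pairing_generate[OF assms(1-3) frattini_gens _ assms(4)[unfolded frattini_def]]
    pairing_derived[OF assms(1,2)] pairing_p_power[OF assms(1-3)] by auto

text \<open>Unlike \<open>card_coset_image\<close> this also covers sets without \<open>z\<close>,
  since the Frattini subgroup may avoid the chosen \<open>z\<close>.\<close>

lemma card_le_coset_image:
  assumes z: "z \<in> center G" "z \<noteq> \<one>" "z [^] p = \<one>" and S: "S \<subseteq> carrier G"
  shows "card S \<le> p * card ((\<lambda>x. generate G {z} #> x) ` S)"
proof -
  interpret C: central_prime G z p
    by unfold_locales (use z prime_p in auto)
  let ?C = "(\<lambda>x. C.Z #> x) ` S"
  have finS: "finite S" using S finite_carrier finite_subset by blast
  have sub: "?C \<subseteq> rcosets C.Z" using S by (auto simp: RCOSETS_def)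
  have card: "card c = p" if "c \<in> ?C" for c
    using that sub card_rcosets_equal[of c C.Z] C.card_Z C.Z.subset by auto
  have "S \<subseteq> (\<Union>c\<in>?C. c)" using rcos_self[OF _ C.Z.subgroup_axioms] S by auto
  moreover have "finite (\<Union>c\<in>?C. c)"
    using finS card p_gt_1 by (intro finite_UN_I finite_imageI) (auto intro: card_ge_0_finite)
  ultimately have "card S \<le> card (\<Union>c\<in>?C. c)" by (rule card_mono[rotated])
  also have "\<dots> \<le> (\<Sum>c\<in>?C. card c)" using finS by (intro card_UN_le) simp
  also have "\<dots> = p * card ?C" using card by simp
  finally show ?thesis .
qed

text \<open>The Frattini subgroup maps onto that of the quotient, so its index does not grow: a
  bound on the number of generators is inherited by quotients.\<close>

lemma frattini_quotient:
  assumes z: "z \<in> center G" "z \<noteq> \<one>" "z [^] p = \<one>"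
    and "p ^ n \<le> card (frattini G p) * p ^ k"
  shows "p ^ (n - 1) \<le> card (frattini (G Mod generate G {z}) p) * p ^ k"
proof -
  interpret C: central_prime G z p
    by unfold_locales (use z prime_p in auto)
  interpret h: group_hom G "G Mod C.Z" "\<lambda>x. C.Z #> x"
    unfolding group_hom_def group_hom_axioms_def
    using C.Z.factorgroup_is_group C.Z.r_coset_hom_Mod is_group by blast
  have pow: "(\<lambda>x. x [^]\<^bsub>G Mod C.Z\<^esub> p) ` carrier (G Mod C.Z) =
      (\<lambda>x. C.Z #> x) ` (\<lambda>x. x [^] p) ` carrier G"
    by (simp add: carrier_FactGroup image_image C.Z.FactGroup_pow)
  have "frattini (G Mod C.Z) p = (\<lambda>x. C.Z #> x) ` frattini G p"
    unfolding frattini_def derived_quotient[OF z(1)] pow image_Un[symmetric]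
    by (rule h.generate_img[OF frattini_gens])
  then have "card (frattini G p) \<le> p * card (frattini (G Mod C.Z) p)"
    using card_le_coset_image[OF z subgroup.subset[OF subgroup_frattini]] by simp
  then have "card (frattini G p) * p ^ k \<le> p * card (frattini (G Mod C.Z) p) * p ^ k"
    by (rule mult_le_mono1)
  then have "p ^ n \<le> p * (card (frattini (G Mod C.Z) p) * p ^ k)"
    using assms(4) by (metis mult.assoc order_trans)
  moreover have "p ^ n = p * p ^ (n - 1)"
    using p_group_quotient(2)[OF z] by (metis power_eq_if not_gr_zero)
  ultimately show ?thesis using p_gt_1 by simp
qed

section \<open>Groups of small order and groups with two generators\<close>

lemma schur_multiplier_trivial_group:
  assumes "n = 0"
  shows "finite (schur_multiplier G)" "card (schur_multiplier G) \<le> 1"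
proof -
  have "card (carrier G) = 1" using card_carrier assms by simp
  then have c: "carrier G = {\<one>}" by (metis card_1_singletonE one_closed singletonD)
  \<comment> \<open>For a constant \<open>g\<close> the expression \<open>g * g / g\<close> is
    \<open>g\<close> itself, so the constant \<open>f \<one> \<one>\<close> cobounds
    \<open>f\<close>.\<close>
  have "(f, \<lambda>x y. 1) \<in> cohomologous G" if f: "f \<in> schur_cocycles G" for f
    unfolding cohomologous_iff
    by (intro conjI f cocycle_trivial exI[of _ "\<lambda>x. f \<one> \<one>"]) (use f c in auto)
  then have sub: "schur_multiplier G \<subseteq> {cohomologous G `` {\<lambda>x y. 1}}"
    using cohomologous_class_eq_iff[OF _ cocycle_trivial] quotient_rep
    by (metis insertI1 subsetI)
  then show "finite (schur_multiplier G)" by (rule finite_subset) simp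
  show "card (schur_multiplier G) \<le> 1" using card_mono[OF _ sub] by simp
qed

lemma carrier_nontrivial:
  assumes "n > 0"
  shows "carrier G \<noteq> {\<one>}"
proof
  assume "carrier G = {\<one>}"
  then have "p ^ n = 1" using card_carrier by simp
  then show False using p_gt_1 assms by simp
qed

lemma schur_multiplier_order_p:
  assumes "n = 1"
  shows "finite (schur_multiplier G)" "p * card (schur_multiplier G) \<le> p ^ n"
proof -
  obtain z where z: "z \<in> center G" "z \<noteq> \<one>" "z [^] p = \<one>"
    using normal_central_order_p[OF normal_self carrier_nontrivial] assms by auto
  have zc: "z \<in> carrier G" using z center_closed by blast
  interpret Q: p_group "G Mod generate G {z}" p "n - 1" by (rule p_group_quotient[OF z])
  have card: "p ^ n \<le> card (generate G {z}) * p ^ 0"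
    using generate_pow_card[OF zc] ord_eq_p[OF zc z(2,3)] assms by simp
  have sub: "subgroup (generate G {z}) G" using zc by (intro generate_is_subgroup) auto
  have triv: "pairing G z f g = 1" if "f \<in> schur_cocycles G" "g \<in> generate G {z}" for f g
    by (rule pairing_generate[OF that(1) z(1,3) _ _ that(2)])
      (use zc pairing_of_root[OF that(1) zc, of 1] in auto)
  have Q: "finite (schur_multiplier (G Mod generate G {z}))"
    "card (schur_multiplier (G Mod generate G {z})) \<le> 1"
    using Q.schur_multiplier_trivial_group assms by simp_all
  note b = schur_multiplier_bound[OF z sub card triv Q]
  show "finite (schur_multiplier G)" by (rule b(1))
  show "p * card (schur_multiplier G) \<le> p ^ n" using b(2) assms by simp
qed

text \<open>The multiplier is to stay below \<open>p ^ (n - 1)\<close>, so each step may cost one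
  factor \<open>p\<close>. If \<open>G\<close> is not abelian, the index \<open>p ^ 2\<close> of the
  Frattini subgroup is offset by the kernel of inflation. If \<open>G\<close> is abelian there is no
  such gain and \<open>S\<close> must have index \<open>p\<close>: \<open>z\<close> is chosen as a
  power of some \<open>x\<close> outside the Frattini subgroup, so the pairing vanishes on
  \<open>x\<close> too.\<close>

lemma schur_multiplier_rank_2_step:
  assumes n: "n > 1" and F: "p ^ n \<le> card (frattini G p) * p ^ 2"
    and IH: "\<And>z. z \<in> center G \<Longrightarrow> z \<noteq> \<one> \<Longrightarrow> z [^] p = \<one> \<Longrightarrow>
      finite (schur_multiplier (G Mod generate G {z})) \<and>
      p * card (schur_multiplier (G Mod generate G {z})) \<le> p ^ (n - 1)"
  shows "finite (schur_multiplier G)" "p * card (schur_multiplier G) \<le> p ^ n"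
proof -
  have pn: "p ^ n = p * p ^ (n - 1)" using n by (metis power_eq_if not_less_zero)
  have "finite (schur_multiplier G) \<and> p * card (schur_multiplier G) \<le> p ^ n"
  proof (cases "derived G (carrier G) = {\<one>}")
    case True
    have "\<exists>z S. z \<in> center G \<and> z \<noteq> \<one> \<and> z [^] p = \<one> \<and> subgroup S G \<and> p ^ n \<le> card S * p ^ 1 \<and>
      (\<forall>f\<in>schur_cocycles G. \<forall>g\<in>S. pairing G z f g = 1)"
    proof (cases "frattini G p = carrier G")
      case True
      obtain z where z: "z \<in> center G" "z \<noteq> \<one>" "z [^] p = \<one>"
        using normal_central_order_p[OF normal_self carrier_nontrivial] n by auto
      then show ?thesis
        using pairing_frattini[OF _ z(1,3)] subgroup_frattini card_carrier p_gt_1 True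
        by (intro exI[of _ z] exI[of _ "frattini G p"]) auto
    next
      case False
      then obtain x where x: "x \<in> carrier G" "x \<notin> frattini G p"
        using subgroup.subset[OF subgroup_frattini] by blast
      have "x \<noteq> \<one>" using x subgroup.one_closed[OF subgroup_frattini] by blast
      then obtain k :: nat where k: "x [^] k \<noteq> \<one>" "(x [^] k) [^] p = \<one>"
        by (rule pow_of_order_p[OF x(1)])
      define S where "S = generate G (insert x (frattini G p))"
      have ins: "insert x (frattini G p) \<subseteq> carrier G"
        using x subgroup.subset[OF subgroup_frattini] by blast
      have S: "subgroup S G" unfolding S_def by (rule generate_is_subgroup[OF ins])
      have "insert x (frattini G p) \<subseteq> S" unfolding S_def by (auto intro: generate.incl)
      then have "p * card (frattini G p) \<le> card S"
        using psubset_card[OF subgroup_frattini S] x(2) by blast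
      then have "p * card (frattini G p) * p \<le> card S * p" by (rule mult_le_mono1)
      moreover have "p * card (frattini G p) * p = card (frattini G p) * p ^ 2"
        by (simp add: power2_eq_square)
      ultimately have card: "p ^ n \<le> card S * p ^ 1" using F by simp
      have z: "x [^] k \<in> center G"
        using x comm_if_derived_trivial[OF True] by (simp add: center_def)
      have "pairing G (x [^] k) f g = 1" if "f \<in> schur_cocycles G" "g \<in> S" for f g
        by (rule pairing_generate[OF that(1) z k(2) ins _ that(2)[unfolded S_def]])
          (use pairing_of_root[OF that(1) x(1)] pairing_frattini[OF that(1) z k(2)] in auto)
      then show ?thesis using z k S card by blast
    qed
    then obtain z S where z: "z \<in> center G" "z \<noteq> \<one>" "z [^] p = \<one>"
      and S: "subgroup S G" "p ^ n \<le> card S * p ^ 1"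
      and triv: "\<And>f g. f \<in> schur_cocycles G \<Longrightarrow> g \<in> S \<Longrightarrow> pairing G z f g = 1"
      by blast
    note b = schur_multiplier_bound[OF z S triv conjunct1[OF IH[OF z]] order_refl]
    have "p * card (schur_multiplier G) \<le> p * (card (schur_multiplier (G Mod generate G {z})) * p ^ 1)"
      using b(2) by (rule mult_le_mono2)
    also have "\<dots> = p * (p * card (schur_multiplier (G Mod generate G {z})))" by simp
    also have "\<dots> \<le> p * p ^ (n - 1)" using conjunct2[OF IH[OF z]] by (rule mult_le_mono2)
    finally show ?thesis using b(1) pn by simp
  next
    case False
    obtain z where z: "z \<in> derived G (carrier G)" "z \<in> center G" "z \<noteq> \<one>" "z [^] p = \<one>"
      by (rule normal_central_order_p[OF derived_self_is_normal False])
    note b = schur_multiplier_bound[OF z(2-4) subgroup_frattini F pairing_frattini[OF _ z(2,4)]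
        conjunct1[OF IH[OF z(2-4)]] order_refl]
    have "p * card (schur_multiplier G) \<le> card (schur_multiplier (G Mod generate G {z})) * p ^ 2"
      using b(3) z(1) by blast
    also have "\<dots> = p * (p * card (schur_multiplier (G Mod generate G {z})))"
      by (simp add: power2_eq_square)
    also have "\<dots> \<le> p * p ^ (n - 1)" using conjunct2[OF IH[OF z(2-4)]] by (rule mult_le_mono2)
    finally show ?thesis using b(1) pn z(1) by simp
  qed
  then show "finite (schur_multiplier G)" "p * card (schur_multiplier G) \<le> p ^ n" by blast+
qed

text \<open>The bound is iterated one order at a time because an induction on \<^term>\<open>n\<close> would have to
  pass from the type of \<^term>\<open>G\<close> to that of its quotient.\<close>

lemma schur_multiplier_order_p2:
  assumes "n = 2"
  shows "finite (schur_multiplier G)" "p * card (schur_multiplier G) \<le> p ^ n"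
proof -
  have IH: "finite (schur_multiplier (G Mod generate G {z})) \<and>
      p * card (schur_multiplier (G Mod generate G {z})) \<le> p ^ (n - 1)"
    if z: "z \<in> center G" "z \<noteq> \<one>" "z [^] p = \<one>" for z
  proof -
    interpret Q: p_group "G Mod generate G {z}" p "n - 1" by (rule p_group_quotient[OF z])
    show ?thesis using Q.schur_multiplier_order_p assms by simp
  qed
  have "card (frattini G p) > 0"
    using finite_subgroup[OF subgroup_frattini] subgroup.one_closed[OF subgroup_frattini]
    by (auto simp: card_gt_0_iff)
  then have F: "p ^ n \<le> card (frattini G p) * p ^ 2" using assms by simp
  have n: "n > 1" using assms by simp
  show "finite (schur_multiplier G)" by (rule schur_multiplier_rank_2_step(1)[OF n F IH])
  show "p * card (schur_multiplier G) \<le> p ^ n"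
    by (rule schur_multiplier_rank_2_step(2)[OF n F IH])
qed

lemma schur_multiplier_rank_2_order_p3:
  assumes "n = 3" and F: "p ^ n \<le> card (frattini G p) * p ^ 2"
  shows "finite (schur_multiplier G)" "p * card (schur_multiplier G) \<le> p ^ n"
proof -
  have IH: "finite (schur_multiplier (G Mod generate G {z})) \<and>
      p * card (schur_multiplier (G Mod generate G {z})) \<le> p ^ (n - 1)"
    if z: "z \<in> center G" "z \<noteq> \<one>" "z [^] p = \<one>" for z
  proof -
    interpret Q: p_group "G Mod generate G {z}" p "n - 1" by (rule p_group_quotient[OF z])
    show ?thesis using Q.schur_multiplier_order_p2 assms by simp
  qed
  have n: "n > 1" using assms(1) by simp
  show "finite (schur_multiplier G)" by (rule schur_multiplier_rank_2_step(1)[OF n F IH])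
  show "p * card (schur_multiplier G) \<le> p ^ n"
    by (rule schur_multiplier_rank_2_step(2)[OF n F IH])
qed

lemma schur_multiplier_rank_2_order_p4:
  assumes "n = 4" and F: "p ^ n \<le> card (frattini G p) * p ^ 2"
  shows "finite (schur_multiplier G)" "p * card (schur_multiplier G) \<le> p ^ n"
proof -
  have IH: "finite (schur_multiplier (G Mod generate G {z})) \<and>
      p * card (schur_multiplier (G Mod generate G {z})) \<le> p ^ (n - 1)"
    if z: "z \<in> center G" "z \<noteq> \<one>" "z [^] p = \<one>" for z
  proof -
    interpret Q: p_group "G Mod generate G {z}" p "n - 1" by (rule p_group_quotient[OF z])
    show ?thesis
      using Q.schur_multiplier_rank_2_order_p3[OF _ frattini_quotient[OF z F]] assms(1) by simp
  qed
  have n: "n > 1" using assms(1) by simp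
  show "finite (schur_multiplier G)" by (rule schur_multiplier_rank_2_step(1)[OF n F IH])
  show "p * card (schur_multiplier G) \<le> p ^ n"
    by (rule schur_multiplier_rank_2_step(2)[OF n F IH])
qed

lemma schur_multiplier_rank_2_order_p5:
  assumes "n = 5" and F: "p ^ n \<le> card (frattini G p) * p ^ 2"
  shows "finite (schur_multiplier G)" "p * card (schur_multiplier G) \<le> p ^ n"
proof -
  have IH: "finite (schur_multiplier (G Mod generate G {z})) \<and>
      p * card (schur_multiplier (G Mod generate G {z})) \<le> p ^ (n - 1)"
    if z: "z \<in> center G" "z \<noteq> \<one>" "z [^] p = \<one>" for z
  proof -
    interpret Q: p_group "G Mod generate G {z}" p "n - 1" by (rule p_group_quotient[OF z])
    show ?thesis
      using Q.schur_multiplier_rank_2_order_p4[OF _ frattini_quotient[OF z F]] assms(1) by simp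
  qed
  have n: "n > 1" using assms(1) by simp
  show "finite (schur_multiplier G)" by (rule schur_multiplier_rank_2_step(1)[OF n F IH])
  show "p * card (schur_multiplier G) \<le> p ^ n"
    by (rule schur_multiplier_rank_2_step(2)[OF n F IH])
qed

text \<open>The rank is not restricted here, so the bound is \<open>p ^ 3\<close>, the value for the
  elementary abelian group. The subgroup generated by \<open>z\<close> has index
  \<open>p ^ 2\<close> and the quotient contributes \<open>p\<close>.\<close>

lemma schur_multiplier_order_p3:
  assumes "n = 3"
  shows "finite (schur_multiplier G)" "card (schur_multiplier G) \<le> p ^ 3"
proof -
  obtain z where z: "z \<in> center G" "z \<noteq> \<one>" "z [^] p = \<one>"
    using normal_central_order_p[OF normal_self carrier_nontrivial] assms by auto
  have zc: "z \<in> carrier G" using z center_closed by blast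
  interpret Q: p_group "G Mod generate G {z}" p "n - 1" by (rule p_group_quotient[OF z])
  have card: "p ^ n \<le> card (generate G {z}) * p ^ 2"
    using generate_pow_card[OF zc] ord_eq_p[OF zc z(2,3)] assms by (simp add: power3_eq_cube power2_eq_square)
  have sub: "subgroup (generate G {z}) G" using zc by (intro generate_is_subgroup) auto
  have triv: "pairing G z f g = 1" if "f \<in> schur_cocycles G" "g \<in> generate G {z}" for f g
    by (rule pairing_generate[OF that(1) z(1,3) _ _ that(2)])
      (use zc pairing_of_root[OF that(1) zc, of 1] in auto)
  have Q: "finite (schur_multiplier (G Mod generate G {z}))"
    "p * card (schur_multiplier (G Mod generate G {z})) \<le> p * p"
    using Q.schur_multiplier_order_p2 assms by (simp_all add: power2_eq_square)
  then have "card (schur_multiplier (G Mod generate G {z})) \<le> p" using p_gt_1 by simp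
  note b = schur_multiplier_bound[OF z sub card triv Q(1) this]
  show "finite (schur_multiplier G)" by (rule b(1))
  show "card (schur_multiplier G) \<le> p ^ 3" using b(2) by (simp add: power3_eq_cube power2_eq_square)
qed

end

text \<open>Conjugation by \<open>g\<close> replaces \<open>x\<close> by
  \<open>u \<otimes> x\<close> and \<open>y\<close> by \<open>l \<otimes> y\<close>. As
  \<open>l\<close> is central and \<open>u\<close> commutes with \<open>y\<close> and
  \<open>z\<close>, the new pair satisfies the relation \<open>xy\<close> with the same
  \<open>z\<close>, so conjugation by \<open>g\<close> fixes \<open>z\<close>.\<close>

lemma (in group) commutator_commutes:
  assumes c: "g \<in> carrier G" "x \<in> carrier G" "y \<in> carrier G" "u \<in> carrier G"
      "l \<in> carrier G" "z \<in> carrier G"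
    and gx: "g \<otimes> x = u \<otimes> x \<otimes> g" and gy: "g \<otimes> y = l \<otimes> y \<otimes> g"
    and xy: "x \<otimes> y = z \<otimes> (y \<otimes> x)"
    and uy: "u \<otimes> y = y \<otimes> u" and uz: "u \<otimes> z = z \<otimes> u"
    and l: "\<And>v. v \<in> carrier G \<Longrightarrow> v \<otimes> l = l \<otimes> v"
  shows "g \<otimes> z = z \<otimes> g"
proof -
  have "g \<otimes> (x \<otimes> y) = u \<otimes> x \<otimes> (g \<otimes> y)" using c gx by (metis m_assoc m_closed)
  also have "\<dots> = u \<otimes> (x \<otimes> l) \<otimes> (y \<otimes> g)" using c by (simp add: gy m_assoc)
  also have "\<dots> = u \<otimes> l \<otimes> (x \<otimes> y) \<otimes> g" using c by (simp add: l[of x] m_assoc)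
  finally have 1: "g \<otimes> (x \<otimes> y) = l \<otimes> u \<otimes> (x \<otimes> y) \<otimes> g" using c l[of u] by simp
  have "g \<otimes> (y \<otimes> x) = l \<otimes> y \<otimes> (g \<otimes> x)" using c gy by (metis m_assoc m_closed)
  also have "\<dots> = l \<otimes> (y \<otimes> u) \<otimes> (x \<otimes> g)" using c by (simp add: gx m_assoc)
  finally have 2: "g \<otimes> (y \<otimes> x) = l \<otimes> u \<otimes> (y \<otimes> x) \<otimes> g"
    using c by (simp add: uy[symmetric] m_assoc)
  have lu: "l \<otimes> u \<otimes> z = z \<otimes> (l \<otimes> u)" using c uz l[of z] by (metis m_assoc)
  have "g \<otimes> z \<otimes> (y \<otimes> x) = g \<otimes> (x \<otimes> y)" using c by (simp add: xy m_assoc)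
  also have "\<dots> = l \<otimes> u \<otimes> z \<otimes> (y \<otimes> x) \<otimes> g" unfolding 1 using c by (simp add: xy m_assoc)
  also have "\<dots> = z \<otimes> (l \<otimes> u \<otimes> (y \<otimes> x) \<otimes> g)" unfolding lu using c by (simp add: m_assoc)
  also have "\<dots> = z \<otimes> g \<otimes> (y \<otimes> x)" unfolding 2[symmetric] using c by (simp add: m_assoc)
  finally show ?thesis using c by (metis m_closed right_cancel)
qed

lemma (in group) central_extension_lift_product:
  assumes f: "f \<in> schur_cocycles G" and c: "x \<in> carrier G" "y \<in> carrier G" "u \<in> carrier G"
    and e: "x \<otimes> y = u \<otimes> (y \<otimes> x)"
  obtains a where "a \<noteq> 0" "(1, x) \<otimes>\<^bsub>central_extension G f\<^esub> (1, y) =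
    (a, u) \<otimes>\<^bsub>central_extension G f\<^esub> ((1, y) \<otimes>\<^bsub>central_extension G f\<^esub> (1, x))"
  using that[of "f x y / (f y x * f u (y \<otimes> x))"] f e by simp

lemma (in group) central_extension_scalar_central:
  assumes f: "f \<in> schur_cocycles G" and v: "v \<in> carrier (central_extension G f)"
  shows "v \<otimes>\<^bsub>central_extension G f\<^esub> (a, \<one>) = (a, \<one>) \<otimes>\<^bsub>central_extension G f\<^esub> v"
proof -
  obtain b y where v: "v = (b, y)" "y \<in> carrier G" using v by auto
  show ?thesis
    using v cocycle_one_left[OF f v(2)] cocycle_one_right[OF f v(2)] by simp
qed

text \<open>A form of the Hall--Witt identity in the central extension attached to \<^term>\<open>f\<close>: a lift of
  \<^term>\<open>g\<close> changes lifts of \<^term>\<open>x\<close> and \<^term>\<open>y\<close> only by factors that do not affect their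
  commutator.\<close>

lemma (in group) pairing_commutator:
  assumes f: "f \<in> schur_cocycles G"
    and c: "g \<in> carrier G" "x \<in> carrier G" "y \<in> carrier G"
    and z: "commutator G x y \<in> center G"
    and gy: "g \<otimes> y = y \<otimes> g"
    and uy: "commutator G g x \<otimes> y = y \<otimes> commutator G g x"
      "f (commutator G g x) y = f y (commutator G g x)"
  shows "pairing G (commutator G x y) f g = 1"
proof -
  let ?E = "central_extension G f"
  interpret E: group ?E by (rule group_central_extension[OF f])
  let ?u = "commutator G g x" and ?z = "commutator G x y"
  have uc: "?u \<in> carrier G" and zc: "?z \<in> carrier G" using c by simp_all
  obtain a where a: "a \<noteq> 0" "(1, g) \<otimes>\<^bsub>?E\<^esub> (1, x) = (a, ?u) \<otimes>\<^bsub>?E\<^esub> ((1, x) \<otimes>\<^bsub>?E\<^esub> (1, g))"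
    by (rule central_extension_lift_product[OF f c(1,2) uc mult_eq_commutator[OF c(1,2)]])
  obtain b where b: "b \<noteq> 0" "(1, x) \<otimes>\<^bsub>?E\<^esub> (1, y) = (b, ?z) \<otimes>\<^bsub>?E\<^esub> ((1, y) \<otimes>\<^bsub>?E\<^esub> (1, x))"
    by (rule central_extension_lift_product[OF f c(2,3) zc mult_eq_commutator[OF c(2,3)]])
  have "g \<otimes> y = \<one> \<otimes> (y \<otimes> g)" using c gy by simp
  then obtain d where d: "d \<noteq> 0" "(1, g) \<otimes>\<^bsub>?E\<^esub> (1, y) = (d, \<one>) \<otimes>\<^bsub>?E\<^esub> ((1, y) \<otimes>\<^bsub>?E\<^esub> (1, g))"
    by (rule central_extension_lift_product[OF f c(1,3) one_closed])
  have "(1, g) \<otimes>\<^bsub>?E\<^esub> (b, ?z) = (b, ?z) \<otimes>\<^bsub>?E\<^esub> (1, g)"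
  proof (rule E.commutator_commutes)
    show "(1, g) \<in> carrier ?E" "(1, x) \<in> carrier ?E" "(1, y) \<in> carrier ?E"
      "(a, ?u) \<in> carrier ?E" "(d, \<one>) \<in> carrier ?E" "(b, ?z) \<in> carrier ?E"
      using c uc zc a(1) b(1) d(1) by simp_all
    then show "(1, g) \<otimes>\<^bsub>?E\<^esub> (1, x) = (a, ?u) \<otimes>\<^bsub>?E\<^esub> (1, x) \<otimes>\<^bsub>?E\<^esub> (1, g)"
      "(1, g) \<otimes>\<^bsub>?E\<^esub> (1, y) = (d, \<one>) \<otimes>\<^bsub>?E\<^esub> (1, y) \<otimes>\<^bsub>?E\<^esub> (1, g)"
      using a(2) d(2) by (simp_all only: E.m_assoc)
    show "(1, x) \<otimes>\<^bsub>?E\<^esub> (1, y) = (b, ?z) \<otimes>\<^bsub>?E\<^esub> ((1, y) \<otimes>\<^bsub>?E\<^esub> (1, x))" by (rule b(2))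
    show "(a, ?u) \<otimes>\<^bsub>?E\<^esub> (1, y) = (1, y) \<otimes>\<^bsub>?E\<^esub> (a, ?u)" using uy by simp
    have "pairing G ?z f ?u = 1"
      by (rule hom_trivial_on_derived[OF _ pairing_mult_left[OF f z]])
        (use f commutator_in_derived[OF c(1,2)] in \<open>auto simp: pairing_def\<close>)
    then show "(a, ?u) \<otimes>\<^bsub>?E\<^esub> (b, ?z) = (b, ?z) \<otimes>\<^bsub>?E\<^esub> (a, ?u)"
      using pairing_eq_1_iff[OF f uc center_comm[OF z uc] a(1) b(1)] by simp
    show "v \<otimes>\<^bsub>?E\<^esub> (d, \<one>) = (d, \<one>) \<otimes>\<^bsub>?E\<^esub> v" if "v \<in> carrier ?E" for v
      by (rule central_extension_scalar_central[OF f that])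
  qed
  then show ?thesis
    using pairing_eq_1_iff[OF f c(1) center_comm[OF z c(1)] _ b(1), of 1] by simp
qed

text \<open>The set is the projection of the centralizer of a lift of \<open>w\<close>. It takes the
  place of the kernel of the pairing when \<open>w\<close> is not central.\<close>

lemma (in group) subgroup_lift_centralizer:
  assumes f: "f \<in> schur_cocycles G" and w: "w \<in> carrier G"
  shows "subgroup {u \<in> carrier G. u \<otimes> w = w \<otimes> u \<and> f u w = f w u} G"
proof -
  let ?E = "central_extension G f"
  interpret E: group ?E by (rule group_central_extension[OF f])
  interpret h: group_hom ?E G snd
    unfolding group_hom_def group_hom_axioms_def hom_def
    using E.group_axioms group_axioms by (auto simp: central_extension_def)
  have wE: "(1, w) \<in> carrier ?E" using w by simp
  have "{u \<in> carrier G. u \<otimes> w = w \<otimes> u \<and> f u w = f w u} = snd ` centralizer ?E (1, w)"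
  proof (intro subset_antisym subsetI)
    fix u assume u: "u \<in> {u \<in> carrier G. u \<otimes> w = w \<otimes> u \<and> f u w = f w u}"
    then have "(1, u) \<in> centralizer ?E (1, w)" by (simp add: centralizer_def)
    then show "u \<in> snd ` centralizer ?E (1, w)" by (rule rev_image_eqI) simp
  next
    fix u assume "u \<in> snd ` centralizer ?E (1, w)"
    then obtain a where "(a, u) \<in> centralizer ?E (1, w)" by auto
    then show "u \<in> {u \<in> carrier G. u \<otimes> w = w \<otimes> u \<and> f u w = f w u}"
      by (auto simp: centralizer_def)
  qed
  then show ?thesis
    using h.subgroup_img_is_subgroup[OF E.subgroup_centralizer[OF wE]] by simp
qed

lemma (in group) inv_mult_cancel:
  "x \<in> carrier G \<Longrightarrow> y \<in> carrier G \<Longrightarrow> inv x \<otimes> (x \<otimes> y) = y"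
  by (simp add: m_assoc[symmetric])

lemma (in group) commutator_eq_imp_commute:
  assumes c: "h \<in> carrier G" "k \<in> carrier G" "x \<in> carrier G"
    and e: "commutator G h x = commutator G k x"
  shows "inv h \<otimes> k \<otimes> x = x \<otimes> (inv h \<otimes> k)"
proof -
  let ?c = "commutator G h x"
  have "?c \<otimes> x = h \<otimes> x \<otimes> inv h" using c by (simp add: commutator_def m_assoc)
  then have "inv h \<otimes> (?c \<otimes> x \<otimes> k) = x \<otimes> (inv h \<otimes> k)"
    using c by (simp add: m_assoc inv_mult_cancel)
  moreover have "k \<otimes> x = ?c \<otimes> x \<otimes> k"
    unfolding e using mult_eq_commutator[OF c(2,3)] c by (simp add: m_assoc)
  ultimately show ?thesis using c by (simp add: m_assoc)
qed

section \<open>Three-generator groups: order p^4, and order p^5 in class three\<close>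

context p_group
begin

lemma card_p_subgroup_eq_generate:
  assumes "subgroup N G" "card N = p" "z \<in> N" "z \<noteq> \<one>"
  shows "N = generate G {z}"
proof -
  have zc: "z \<in> carrier G" using assms subgroup.subset by blast
  have g: "subgroup (generate G {z}) G" "generate G {z} \<subseteq> N"
    using zc assms(3) generate_is_subgroup[of "{z}"] generate_subgroup_incl[OF _ assms(1), of "{z}"]
    by simp_all
  have "{\<one>} \<subset> generate G {z}"
    using assms(4) generate.one[of G "{z}"] generate.incl[of z "{z}" G] by auto
  then have "p * card {\<one>} \<le> card (generate G {z})"
    by (rule psubset_card[OF triv_subgroup g(1)])
  then have "card N \<le> card (generate G {z})" using assms(2) by simp
  then show ?thesis using g(2) finite_subgroup[OF assms(1)] card_seteq by blast
qed

text \<open>The subgroup contains a central element of order \<open>p\<close>, and that element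
  generates it.\<close>

lemma normal_card_p_central:
  assumes "N \<lhd> G" "card N = p"
  shows "N \<subseteq> center G" and "z \<in> N \<Longrightarrow> z [^] p = \<one>"
proof -
  have N: "subgroup N G" using assms(1) by (rule normal_imp_subgroup)
  have "N \<noteq> {\<one>}" using assms(2) p_gt_1 by auto
  then obtain x where x: "x \<in> N" "x \<in> center G" "x \<noteq> \<one>" "x [^] p = \<one>"
    by (rule normal_central_order_p[OF assms(1)])
  have Nx: "N = generate G {x}" by (rule card_p_subgroup_eq_generate[OF N assms(2) x(1,3)])
  show "N \<subseteq> center G" unfolding Nx
    by (rule generate_subgroup_incl[OF _ subgroup_center]) (use x in simp)
  interpret C: central_prime G x p by unfold_locales (use x prime_p in auto)
  assume "z \<in> N"
  then obtain i :: nat where i: "z = x [^] i" unfolding Nx C.Z_eq by blast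
  have "z [^] p = (x [^] p) [^] i" 
    unfolding i by (simp only: nat_pow_pow[OF center_closed[OF x(2)]] mult.commute)
  then show "z [^] p = \<one>" using x by simp
qed

lemma card_centralizer_ge:
  assumes x: "x \<in> carrier G" and B: "finite B"
    "\<And>h. h \<in> carrier G \<Longrightarrow> commutator G h x \<in> B"
  shows "p ^ n \<le> card B * card (centralizer G x)"
  unfolding card_carrier[symmetric]
proof (rule card_le_fibres[OF subgroup_centralizer[OF x] finite_carrier B(1)])
  show "(\<lambda>h. commutator G h x) ` carrier G \<subseteq> B" using B(2) by auto
  fix h k assume c: "h \<in> carrier G" "k \<in> carrier G"
    and e: "commutator G h x = commutator G k x"
  show "inv h \<otimes> k \<in> centralizer G x"
    using commutator_eq_imp_commute[OF c x e] c by (simp add: centralizer_def)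
qed

text \<open>For \<open>z = [x, y]\<close> every \<open>g\<close> that commutes with both
  \<open>x\<close> and \<open>y\<close> pairs trivially with \<open>z\<close>, by
  \<open>pairing_commutator\<close>. All commutators lie in a group of order \<open>p\<close>, so
  these \<open>g\<close> form a subgroup of index at most \<open>p ^ 2\<close>, and the estimate is
  \<open>p ^ 3 * p ^ 2\<close> divided by \<open>p\<close>.\<close>

lemma schur_multiplier_order_p4:
  assumes n: "n = 4" and D: "card (derived G (carrier G)) = p"
  shows "finite (schur_multiplier G)" "card (schur_multiplier G) \<le> p ^ 4"
proof -
  let ?D = "derived G (carrier G)"
  have "\<not> (\<forall>x\<in>carrier G. \<forall>y\<in>carrier G. commutator G x y \<in> {\<one>})"
    using derived_subset_iff[OF triv_subgroup] D p_gt_1 card_mono[of "{\<one>}" ?D] by auto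
  then obtain x y where xy: "x \<in> carrier G" "y \<in> carrier G" "commutator G x y \<noteq> \<one>" by blast
  define z where "z = commutator G x y"
  have zD: "z \<in> ?D" unfolding z_def by (rule commutator_in_derived[OF xy(1,2)])
  have z: "z \<in> center G" "z \<noteq> \<one>" "z [^] p = \<one>"
    using normal_card_p_central[OF derived_self_is_normal D] zD xy(3) by (auto simp: z_def)
  interpret Q: p_group "G Mod generate G {z}" p "n - 1" by (rule p_group_quotient[OF z])
  have Q: "finite (schur_multiplier (G Mod generate G {z}))"
    "card (schur_multiplier (G Mod generate G {z})) \<le> p ^ 3"
    using Q.schur_multiplier_order_p3 n by simp_all
  have finD: "finite ?D" by (rule finite_subgroup[OF subgroup_derived])
  define S where "S = centralizer G x \<inter> centralizer G y"
  have S: "subgroup S G"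
    unfolding S_def by (intro subgroups_Inter_pair subgroup_centralizer xy)
  have "card (carrier G) \<le> card (?D \<times> ?D) * card S"
  proof (rule card_le_fibres[OF S finite_carrier])
    show "finite (?D \<times> ?D)" using finD by simp
    show "(\<lambda>h. (commutator G h x, commutator G h y)) ` carrier G \<subseteq> ?D \<times> ?D"
      using commutator_in_derived xy by auto
    show "inv h \<otimes> k \<in> S" if "h \<in> carrier G" "k \<in> carrier G"
      "(commutator G h x, commutator G h y) = (commutator G k x, commutator G k y)" for h k
      using that commutator_eq_imp_commute[OF that(1,2)] xy
      by (simp add: S_def centralizer_def)
  qed
  then have card: "p ^ n \<le> card S * p ^ 2"
    using D card_carrier by (simp add: card_cartesian_product power2_eq_square mult.commute)
  have triv: "pairing G z f g = 1" if f: "f \<in> schur_cocycles G" and g: "g \<in> S" for f g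
  proof -
    have gc: "g \<in> carrier G" "g \<otimes> x = x \<otimes> g" "g \<otimes> y = y \<otimes> g"
      using g by (auto simp: S_def centralizer_def)
    have u: "commutator G g x = \<one>" using gc xy by (simp add: commutator_eq_one_iff)
    show ?thesis unfolding z_def
      by (rule pairing_commutator[OF f gc(1) xy(1,2) z(1)[unfolded z_def] gc(3)])
        (use u xy cocycle_one_left[OF f xy(2)] cocycle_one_right[OF f xy(2)] in auto)
  qed
  note b = schur_multiplier_bound[OF z S card triv Q]
  show "finite (schur_multiplier G)" by (rule b(1))
  have "p * card (schur_multiplier G) \<le> p ^ 3 * p ^ 2" by (rule b(3)[OF _ _ zD])
  then have "p * card (schur_multiplier G) \<le> p * p ^ 4" by (simp add: power_numeral_reduce)
  then show "card (schur_multiplier G) \<le> p ^ 4" using p_gt_1 by simp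
qed

lemma schur_multiplier_quotient_order_p5:
  assumes n: "n = 5" and D: "card (derived G (carrier G)) = p ^ 2"
    and z: "z \<in> center G" "z \<noteq> \<one>" "z [^] p = \<one>" "z \<in> derived G (carrier G)"
  shows "finite (schur_multiplier (G Mod generate G {z}))"
    and "card (schur_multiplier (G Mod generate G {z})) \<le> p ^ 4"
    and "card (derived (G Mod generate G {z}) (carrier (G Mod generate G {z}))) = p"
proof -
  interpret Q: p_group "G Mod generate G {z}" p "n - 1" by (rule p_group_quotient[OF z(1-3)])
  have "p * card (derived (G Mod generate G {z}) (carrier (G Mod generate G {z}))) = p * p"
    unfolding derived_quotient[OF z(1)] card_coset_image[OF z(1-3) subgroup_derived z(4)] D
    by (rule power2_eq_square)
  then show dQ: "card (derived (G Mod generate G {z}) (carrier (G Mod generate G {z}))) = p"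
    using p_gt_1 by simp
  show "finite (schur_multiplier (G Mod generate G {z}))"
    and "card (schur_multiplier (G Mod generate G {z})) \<le> p ^ 4"
    using Q.schur_multiplier_order_p4[OF _ dQ] n by simp_all
qed

text \<open>The quotient contributes \<open>p ^ 4\<close> and the pairings contribute
  \<open>p\<close>, which the kernel of inflation cancels.\<close>

lemma schur_multiplier_order_p5_index_p:
  assumes n: "n = 5" and D: "card (derived G (carrier G)) = p ^ 2"
    and z: "z \<in> center G" "z \<noteq> \<one>" "z [^] p = \<one>" "z \<in> derived G (carrier G)"
    and S: "subgroup S G" "p ^ n \<le> card S * p"
    and triv: "\<And>f g. f \<in> schur_cocycles G \<Longrightarrow> g \<in> S \<Longrightarrow> pairing G z f g = 1"
  shows "finite (schur_multiplier G)" "card (schur_multiplier G) \<le> p ^ 4"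
proof -
  have S': "p ^ n \<le> card S * p ^ 1" using S(2) by simp
  note b = schur_multiplier_bound[OF z(1-3) S(1) S' triv
      schur_multiplier_quotient_order_p5(1,2)[OF n D z]]
  show "finite (schur_multiplier G)" by (rule b(1))
  have "p * card (schur_multiplier G) \<le> p ^ 4 * p ^ 1" by (rule b(3)[OF _ _ z(4)])
  then have "p * card (schur_multiplier G) \<le> p * p ^ 4" by (simp add: mult.commute)
  then show "card (schur_multiplier G) \<le> p ^ 4" using p_gt_1 by simp
qed

text \<open>Modulo a central subgroup of order \<open>p\<close> in \<open>G'\<close>, generated by
  \<open>t\<close>, the derived subgroup has order \<open>p\<close> and is central. So all
  commutators with a noncentral \<open>w \<in> G'\<close> are powers of \<open>t\<close>, the
  centralizer of \<open>w\<close> has index at most \<open>p\<close>, and \<open>z = [a, w]\<close>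
  has the form to which \<open>pairing_commutator\<close> applies.\<close>

lemma schur_multiplier_class_3:
  assumes n: "n = 5" and D: "card (derived G (carrier G)) = p ^ 2"
    and cl: "\<not> derived G (carrier G) \<subseteq> center G"
  shows "finite (schur_multiplier G)" "card (schur_multiplier G) \<le> p ^ 4"
proof -
  let ?D = "derived G (carrier G)"
  have "?D \<noteq> {\<one>}" using cl subgroup.one_closed[OF subgroup_center] by auto
  then obtain t where t: "t \<in> ?D" "t \<in> center G" "t \<noteq> \<one>" "t [^] p = \<one>"
    by (rule normal_central_order_p[OF derived_self_is_normal])
  interpret C: central_prime G t p by unfold_locales (use t prime_p in auto)
  interpret Q: p_group "G Mod C.Z" p "n - 1" by (rule p_group_quotient[OF t(2-4)])
  have dQ: "card (derived (G Mod C.Z) (carrier (G Mod C.Z))) = p"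
    by (rule schur_multiplier_quotient_order_p5(3)[OF n D t(2-4,1)])
  obtain w where w: "w \<in> ?D" "w \<notin> center G" using cl by blast
  have wc: "w \<in> carrier G" using w derived_closed by blast
  have comm: "commutator G g w \<in> C.Z" if g: "g \<in> carrier G" for g
  proof -
    have "C.Z #> w \<in> derived (G Mod C.Z) (carrier (G Mod C.Z))"
      unfolding derived_quotient[OF t(2)] using w by blast
    then have "C.Z #> w \<in> center (G Mod C.Z)"
      using Q.normal_card_p_central(1)[OF Q.derived_self_is_normal dQ] by blast
    then have e: "C.Z #> (g \<otimes> w) = C.Z #> (w \<otimes> g)"
      unfolding C.coset_mult[OF g wc, symmetric] C.coset_mult[OF wc g, symmetric]
      by (rule Q.center_comm[OF _ C.coset_in_quot[OF g]])
    obtain i where "i < p" "g \<otimes> w = t [^] i \<otimes> (w \<otimes> g)"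
      by (rule C.coset_eq_imp[OF m_closed[OF g wc] m_closed[OF wc g] e])
    then have "commutator G g w = t [^] i" using commutator_unique[OF g wc] by simp
    then show ?thesis using subgroup_nat_pow_closed[OF C.Z.subgroup_axioms C.z_in_Z] by simp
  qed
  obtain a where a: "a \<in> carrier G" "a \<otimes> w \<noteq> w \<otimes> a"
    using w(2) wc by (auto simp: center_def)
  define z where "z = commutator G a w"
  have zZ: "z \<in> C.Z" unfolding z_def by (rule comm[OF a(1)])
  have z: "z \<in> center G" "z \<noteq> \<one>" "z [^] p = \<one>" "z \<in> ?D"
    using normal_card_p_central[OF C.normal_Z C.card_Z] zZ a wc commutator_in_derived[OF a(1) wc]
    by (auto simp: z_def commutator_eq_one_iff)
  have zc: "z \<in> carrier G" using z center_closed by blast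
  have finZ: "finite C.Z" by (rule finite_subgroup[OF C.Z.subgroup_axioms])
  have card: "p ^ n \<le> card (centralizer G w) * p"
    using card_centralizer_ge[OF wc finZ comm] C.card_Z by (simp add: mult.commute)
  have triv: "pairing G z f g = 1" if f: "f \<in> schur_cocycles G" and g: "g \<in> centralizer G w" for f g
  proof -
    \<comment> \<open>These are the elements whose lifts commute with a lift of \<open>w\<close>.
      Among them are \<open>z\<close>, since \<open>w\<close> lies in the derived subgroup and pairs
      trivially with \<open>z\<close>, and \<open>w\<close> itself. As \<open>w\<close> is not a
      power of \<open>z\<close>, they exhaust the derived subgroup of order \<open>p ^ 2\<close>, in
      particular they include \<open>[g, a]\<close>.\<close>
    let ?L = "{u \<in> carrier G. u \<otimes> w = w \<otimes> u \<and> f u w = f w u}"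
    have L: "subgroup (?L \<inter> ?D) G"
      by (intro subgroups_Inter_pair subgroup_lift_centralizer f wc subgroup_derived)
    have "z \<in> ?L \<inter> ?D"
      using pairing_derived[OF f z(1) w(1)] wc zc z center_comm[OF z(1) wc] f
      by (simp add: pairing_def)
    then have sub: "generate G {z} \<subseteq> ?L \<inter> ?D" by (intro generate_subgroup_incl[OF _ L]) simp
    have "generate G {z} \<subseteq> center G"
      by (rule generate_subgroup_incl[OF _ subgroup_center]) (use z in simp)
    then have "w \<notin> generate G {z}" using w by blast
    moreover have "w \<in> ?L \<inter> ?D" using w wc by simp
    ultimately have "generate G {z} \<subset> ?L \<inter> ?D" using sub by blast
    moreover have "subgroup (generate G {z}) G" using zc by (intro generate_is_subgroup) simp
    ultimately have "p * card (generate G {z}) \<le> card (?L \<inter> ?D)" using psubset_card L by blast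
    moreover have "card (generate G {z}) = p"
      using generate_pow_card[OF zc] ord_eq_p[OF zc z(2,3)] by simp
    ultimately have "card ?D \<le> card (?L \<inter> ?D)" using D by (simp add: power2_eq_square)
    then have LD: "?L \<inter> ?D = ?D"
      by (intro card_seteq finite_subgroup[OF subgroup_derived]) auto
    have gc: "g \<in> carrier G" "g \<otimes> w = w \<otimes> g" using g by (auto simp: centralizer_def)
    have u: "commutator G g a \<in> ?L" using commutator_in_derived[OF gc(1) a(1)] LD by blast
    show ?thesis unfolding z_def
      by (rule pairing_commutator[OF f gc(1) a(1) wc z(1)[unfolded z_def] gc(2)]) (use u in auto)
  qed
  show "finite (schur_multiplier G)" "card (schur_multiplier G) \<le> p ^ 4"
    by (rule schur_multiplier_order_p5_index_p[OF n D z subgroup_centralizer[OF wc] card triv];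
        assumption)+
qed

end

section \<open>Groups of nilpotency class two\<close>

locale class_two_group = group G for G (structure) +
  assumes derived_central: "derived G (carrier G) \<subseteq> center G"
begin

lemma commutator_central:
  "x \<in> carrier G \<Longrightarrow> y \<in> carrier G \<Longrightarrow> commutator G x y \<in> center G"
  using commutator_in_derived derived_central by blast

lemma commutator_mult_left:
  assumes "x \<in> carrier G" "y \<in> carrier G" "w \<in> carrier G"
  shows "commutator G (x \<otimes> y) w = commutator G x w \<otimes> commutator G y w"
proof (rule commutator_unique)
  let ?a = "commutator G x w" and ?b = "commutator G y w"
  have b: "x \<otimes> ?b = ?b \<otimes> x" "?a \<otimes> ?b = ?b \<otimes> ?a"
    using center_comm[OF commutator_central[OF assms(2,3)]] assms by (blast, simp)
  have "x \<otimes> y \<otimes> w = x \<otimes> ?b \<otimes> (w \<otimes> y)"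
    using assms mult_eq_commutator[of y w] by (simp add: m_assoc)
  also have "\<dots> = ?b \<otimes> (x \<otimes> w) \<otimes> y" unfolding b(1) using assms by (simp add: m_assoc)
  also have "\<dots> = ?a \<otimes> ?b \<otimes> (w \<otimes> (x \<otimes> y))"
    unfolding mult_eq_commutator[OF assms(1,3)] b(2) using assms by (simp add: m_assoc)
  finally show "x \<otimes> y \<otimes> w = ?a \<otimes> ?b \<otimes> (w \<otimes> (x \<otimes> y))" .
qed (use assms in auto)

lemma commutator_swap:
  assumes "x \<in> carrier G" "y \<in> carrier G"
  shows "commutator G y x = inv (commutator G x y)"
proof (rule commutator_unique)
  show "y \<otimes> x = inv (commutator G x y) \<otimes> (x \<otimes> y)"
    using assms mult_eq_commutator[OF assms] by (simp add: inv_solve_left)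
qed (use assms in auto)

lemma commutator_mult_right:
  assumes "x \<in> carrier G" "y \<in> carrier G" "w \<in> carrier G"
  shows "commutator G w (x \<otimes> y) = commutator G w x \<otimes> commutator G w y"
proof -
  have "commutator G w (x \<otimes> y) = inv (commutator G x w \<otimes> commutator G y w)"
    using assms commutator_swap[of "x \<otimes> y" w] commutator_mult_left by simp
  also have "\<dots> = inv (commutator G y w) \<otimes> inv (commutator G x w)"
    using assms by (simp add: inv_mult_group)
  also have "\<dots> = commutator G w y \<otimes> commutator G w x"
    using assms commutator_swap[of x w] commutator_swap[of y w] by simp
  finally show ?thesis
    using center_comm[OF commutator_central[OF assms(3,1)], of "commutator G w y"] assms by simp
qed

lemma commutator_pow_left:
  assumes "x \<in> carrier G" "w \<in> carrier G"
  shows "commutator G (x [^] (k::nat)) w = commutator G x w [^] k"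
proof (induction k)
  case 0
  then show ?case using assms by (simp add: commutator_eq_one_iff)
next
  case (Suc k)
  then show ?case using commutator_mult_left[of "x [^] k" x w] assms by simp
qed

lemma commutator_pow_right:
  assumes "x \<in> carrier G" "w \<in> carrier G"
  shows "commutator G w (x [^] (k::nat)) = commutator G w x [^] k"
proof (induction k)
  case 0
  then show ?case using assms by (simp add: commutator_eq_one_iff)
next
  case (Suc k)
  then show ?case using commutator_mult_right[of "x [^] k" x w] assms by simp
qed

lemma subgroup_commutator_left:
  assumes "subgroup W G" "h \<in> carrier G"
  shows "subgroup {g \<in> carrier G. commutator G g h \<in> W} G"
proof (rule subgroupI)
  have "commutator G \<one> h = \<one>" using assms by (simp add: commutator_eq_one_iff)
  then show "{g \<in> carrier G. commutator G g h \<in> W} \<noteq> {}"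
    using subgroup.one_closed[OF assms(1)] by force
  fix g assume g: "g \<in> {g \<in> carrier G. commutator G g h \<in> W}"
  then have "commutator G g h \<otimes> commutator G (inv g) h = \<one>"
    using commutator_mult_left[of g "inv g" h] assms(2) \<open>commutator G \<one> h = \<one>\<close> by simp
  then have "commutator G (inv g) h = inv (commutator G g h)"
    using g assms(2) by (simp add: inv_solve_left' inv_unique' inv_comm)
  then show "inv g \<in> {g \<in> carrier G. commutator G g h \<in> W}"
    using g assms subgroup.m_inv_closed by fastforce
next
  fix g k assume "g \<in> {g \<in> carrier G. commutator G g h \<in> W}" "k \<in> {g \<in> carrier G. commutator G g h \<in> W}"
  then show "g \<otimes> k \<in> {g \<in> carrier G. commutator G g h \<in> W}"
    using commutator_mult_left[of g k h] assms subgroup.m_closed by fastforce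
qed auto

lemma subgroup_commutator_right:
  assumes "subgroup W G" "h \<in> carrier G"
  shows "subgroup {g \<in> carrier G. commutator G h g \<in> W} G"
proof -
  have "commutator G h g \<in> W \<longleftrightarrow> commutator G g h \<in> W" if "g \<in> carrier G" for g
    using commutator_swap[OF that assms(2)] commutator_swap[OF assms(2) that]
      subgroup.m_inv_closed[OF assms(1)] by metis
  then have "{g \<in> carrier G. commutator G h g \<in> W} = {g \<in> carrier G. commutator G g h \<in> W}" by blast
  then show ?thesis using subgroup_commutator_left[OF assms] by simp
qed

text \<open>Moving one more \<open>x\<close> to the left past \<open>y [^] k\<close> produces
  \<open>k\<close> central commutators, and these add up to the binomial coefficient.\<close>

lemma pow_mult_commutator:
  assumes "x \<in> carrier G" "y \<in> carrier G"
  shows "(x \<otimes> y) [^] (k::nat) = x [^] k \<otimes> y [^] k \<otimes> commutator G y x [^] (k choose 2)"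
proof (induction k)
  case (Suc k)
  let ?c = "commutator G y x"
  have c: "?c [^] m \<in> center G" for m :: nat
    using subgroup_nat_pow_closed[OF subgroup_center commutator_central] assms by blast
  have cc: "?c \<in> carrier G" using assms by simp
  have yx: "y [^] k \<otimes> x = ?c [^] k \<otimes> (x \<otimes> y [^] k)"
    using mult_eq_commutator[of "y [^] k" x] commutator_pow_left assms by simp
  have "(x \<otimes> y) [^] Suc k = x [^] k \<otimes> y [^] k \<otimes> (?c [^] (k choose 2) \<otimes> (x \<otimes> y))"
    using Suc assms by (simp add: m_assoc)
  also have "\<dots> = x [^] k \<otimes> (y [^] k \<otimes> x) \<otimes> y \<otimes> ?c [^] (k choose 2)"
    unfolding center_comm[OF c m_closed[OF assms], symmetric] using assms by (simp add: m_assoc)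
  also have "\<dots> = x [^] k \<otimes> ?c [^] k \<otimes> (x \<otimes> y [^] Suc k) \<otimes> ?c [^] (k choose 2)"
    unfolding yx using assms by (simp add: m_assoc)
  also have "\<dots> = x [^] k \<otimes> (?c [^] k \<otimes> (x \<otimes> y [^] Suc k)) \<otimes> ?c [^] (k choose 2)"
    using assms by (simp add: m_assoc)
  also have "\<dots> = x [^] k \<otimes> (x \<otimes> y [^] Suc k \<otimes> ?c [^] k) \<otimes> ?c [^] (k choose 2)"
    using center_comm[OF c, of "x \<otimes> y [^] Suc k" k] assms by simp
  also have "\<dots> = x [^] Suc k \<otimes> y [^] Suc k \<otimes> (?c [^] k \<otimes> ?c [^] (k choose 2))"
    using assms by (simp add: m_assoc)
  also have "?c [^] k \<otimes> ?c [^] (k choose 2) = ?c [^] (Suc k choose 2)"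
    using nat_pow_mult[OF cc] by (simp add: numeral_2_eq_2)
  finally show ?case .
qed (simp add: binomial_eq_0)

end

section \<open>Class two with abelianisation of exponent p\<close>

locale class_two_p_group = p_group G p n + class_two_group G for G (structure) and p n +
  assumes odd_p: "odd p"
    and pow_p_derived: "x \<in> carrier G \<Longrightarrow> x [^] p \<in> derived G (carrier G)"
begin

lemma commutator_pow_p:
  assumes "x \<in> carrier G" "y \<in> carrier G"
  shows "commutator G x y [^] p = \<one>"
proof -
  have "x [^] p \<in> center G" using pow_p_derived[OF assms(1)] derived_central by blast
  then have "commutator G (x [^] p) y = \<one>"
    using assms center_comm[of "x [^] p" y] by (simp add: commutator_eq_one_iff)
  then show ?thesis using commutator_pow_left[OF assms] by simp
qed

lemma derived_pow_p:
  assumes "d \<in> derived G (carrier G)"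
  shows "d [^] p = \<one>"
proof -
  have "subgroup {d \<in> center G. d [^] p = \<one>} G"
  proof (rule subgroupI)
    fix x y assume x: "x \<in> {d \<in> center G. d [^] p = \<one>}" and y: "y \<in> {d \<in> center G. d [^] p = \<one>}"
    have "(x \<otimes> y) [^] p = x [^] p \<otimes> y [^] p"
      using x y center_closed center_comm[of y x] by (intro pow_mult_distrib) auto
    then show "x \<otimes> y \<in> {d \<in> center G. d [^] p = \<one>}"
      using x y subgroup.m_closed[OF subgroup_center] by simp
  next
    fix x assume x: "x \<in> {d \<in> center G. d [^] p = \<one>}"
    then show "inv x \<in> {d \<in> center G. d [^] p = \<one>}"
      using subgroup.m_inv_closed[OF subgroup_center] center_closed[of x] nat_pow_inv[of x p] by simp
  qed (use center_closed subgroup.one_closed[OF subgroup_center] in auto)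
  then have "derived G (carrier G) \<subseteq> {d \<in> center G. d [^] p = \<one>}"
    using derived_subset_iff commutator_central commutator_pow_p by auto
  then show ?thesis using assms by blast
qed

text \<open>For odd \<open>p\<close> the number \<open>p choose 2\<close> is a multiple of
  \<open>p\<close>, so the commutator term disappears.\<close>

lemma pow_p_mult:
  assumes "x \<in> carrier G" "y \<in> carrier G"
  shows "(x \<otimes> y) [^] p = x [^] p \<otimes> y [^] p"
proof -
  obtain m where m: "p = Suc (2 * m)" using odd_p by (metis Suc_eq_plus1 oddE)
  have ch: "p choose 2 = p * m" by (simp add: choose_two m)
  have "commutator G y x [^] (p choose 2) = (commutator G y x [^] p) [^] m"
    unfolding ch using assms by (simp add: nat_pow_pow)
  then have "commutator G y x [^] (p choose 2) = \<one>" using commutator_pow_p[OF assms(2,1)] by simp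
  then show ?thesis using pow_mult_commutator[OF assms, of p] assms by simp
qed

text \<open>The \<open>p\<close>-th power map is a homomorphism into \<open>G'\<close>, so the
  preimage \<open>S\<close> of the subgroup generated by \<open>z = u [^] p\<close> has index at
  most \<open>p\<close>. Every element of \<open>S\<close> is a product of roots of \<open>z\<close>
  and their powers, on which the pairing with \<open>z\<close> vanishes.\<close>

lemma schur_multiplier_power_nontrivial:
  assumes n: "n = 5" and D: "card (derived G (carrier G)) = p ^ 2"
    and u: "u \<in> carrier G" "u [^] p \<noteq> \<one>"
  shows "finite (schur_multiplier G)" "card (schur_multiplier G) \<le> p ^ 4"
proof -
  let ?D = "derived G (carrier G)"
  define z where "z = u [^] p"
  have zD: "z \<in> ?D" unfolding z_def by (rule pow_p_derived[OF u(1)])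
  have z: "z \<in> center G" "z \<noteq> \<one>" "z [^] p = \<one>"
    using zD derived_central derived_pow_p u by (auto simp: z_def)
  have zc: "z \<in> carrier G" using z center_closed by blast
  interpret C: central_prime G z p by unfold_locales (use z prime_p in auto)
  define S where "S = {h \<in> carrier G. h [^] p \<in> C.Z}"
  have S: "subgroup S G"
  proof (rule subgroupI)
    fix h assume "h \<in> S"
    then show "inv h \<in> S" unfolding S_def using nat_pow_inv[of h p] C.Z.m_inv_closed by auto
  qed (use pow_p_mult C.Z.one_closed C.Z.m_closed in \<open>auto simp: S_def\<close>)
  have "card (carrier G) \<le> card ((\<lambda>x. C.Z #> x) ` ?D) * card S"
  proof (rule card_le_fibres[OF S finite_carrier])
    show "finite ((\<lambda>x. C.Z #> x) ` ?D)" using finite_subgroup[OF subgroup_derived] by simp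
    show "(\<lambda>h. C.Z #> h [^] p) ` carrier G \<subseteq> (\<lambda>x. C.Z #> x) ` ?D" using pow_p_derived by blast
    fix h k assume c: "h \<in> carrier G" "k \<in> carrier G" and e: "C.Z #> h [^] p = C.Z #> k [^] p"
    obtain i where "i < p" and i: "k [^] p = z [^] i \<otimes> h [^] p"
      by (rule C.coset_eq_imp[OF nat_pow_closed[OF c(2)] nat_pow_closed[OF c(1)] e[symmetric]])
    have "(inv h \<otimes> k) [^] p = inv (h [^] p) \<otimes> (z [^] i \<otimes> h [^] p)"
      using c pow_p_mult[of "inv h" k] nat_pow_inv[of h p] i by simp
    also have "z [^] i \<otimes> h [^] p = h [^] p \<otimes> z [^] i"
      using center_comm[OF subgroup_nat_pow_closed[OF subgroup_center z(1)], of "h [^] p" i] c by simp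
    finally have "(inv h \<otimes> k) [^] p = z [^] i" using c zc by (simp add: inv_mult_cancel)
    then show "inv h \<otimes> k \<in> S"
      using c subgroup_nat_pow_closed[OF C.Z.subgroup_axioms C.z_in_Z] by (simp add: S_def)
  qed
  moreover have "card ((\<lambda>x. C.Z #> x) ` ?D) = p"
    using card_coset_image[OF z subgroup_derived zD] D p_gt_1 by (simp add: power2_eq_square)
  ultimately have card: "p ^ n \<le> card S * p" using card_carrier by (simp add: mult.commute)
  have triv: "pairing G z f h = 1" if f: "f \<in> schur_cocycles G" and h: "h \<in> S" for f h
  proof -
    have hc: "h \<in> carrier G" using h by (simp add: S_def)
    obtain i :: nat where i: "i < p" "h [^] p = z [^] i"
      using h unfolding S_def C.Z_eq by blast
    \<comment> \<open>This is \<open>1 - i\<close> modulo \<open>p\<close>, kept a natural number: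
      with it \<open>h \<otimes> u [^] k\<close> becomes a \<open>p\<close>-th root of
      \<open>z\<close> like \<open>u\<close>, and \<open>h\<close> pairs trivially because both
      roots do.\<close>
    define k where "k = Suc (p - i)"
    have kc: "u [^] k \<in> carrier G" using u by simp
    have pu: "pairing G z f u = 1"
      using pairing_of_root[OF f u(1), of p] by (simp add: z_def)
    have "(u [^] k) [^] p = z [^] k"
      using u by (simp add: z_def nat_pow_pow mult.commute)
    then have "(h \<otimes> u [^] k) [^] p = z [^] (i + k)"
      using pow_p_mult[OF hc kc] i zc by (simp add: nat_pow_mult)
    also have "i + k = Suc p" using i by (simp add: k_def)
    finally have "(h \<otimes> u [^] k) [^] p = z" using z(3) zc by simp
    then have "pairing G z f (h \<otimes> u [^] k) = 1"
      using pairing_of_root[OF f m_closed[OF hc kc], of p] by simp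
    then show ?thesis
      using pairing_mult_left[OF f z(1) hc kc] pairing_pow_left[OF f z(1) u(1), of k] pu by simp
  qed
  show "finite (schur_multiplier G)" "card (schur_multiplier G) \<le> p ^ 4"
    by (rule schur_multiplier_order_p5_index_p[OF n D z zD S card triv]; assumption)+
qed

end

section \<open>A lower bound from explicit cocycles\<close>

text \<open>Coordinates \<^term>\<open>u 0\<close>, \<dots>, \<^term>\<open>u 4\<close> stand for the normal form
  \<open>a\<^sub>1\<^bsup>u 0\<^esup> a\<^sub>2\<^bsup>u 1\<^esup> w\<^sub>1\<^bsup>u 2\<^esup> w\<^sub>2\<^bsup>u 3\<^esup> c\<^bsup>u 4\<^esup>\<close>, where \<open>w\<^sub>i = [c, a\<^sub>i]\<close> is central and
  \<open>a\<^sub>1\<close>, \<open>a\<^sub>2\<close> commute. Writing the group as \<open>N \<rtimes> \<langle>c\<rangle>\<close> with \<open>N\<close> abelian, the first four terms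
  of the form below are bilinear forms on \<open>N\<close> invariant under \<open>c\<close>; the last two come from
  \<open>H\<^sup>1(\<langle>c\<rangle>, Hom(N, \<complex>\<^sup>*))\<close>, doubled to avoid binomial coefficients.\<close>

definition heis_mult :: "(nat \<Rightarrow> int) \<Rightarrow> (nat \<Rightarrow> int) \<Rightarrow> nat \<Rightarrow> int" where
  "heis_mult u v t = u t + v t + (if t = 2 then u 4 * v 0 else if t = 3 then u 4 * v 1 else 0)"

definition heis_form :: "(nat \<Rightarrow> int) \<Rightarrow> (nat \<Rightarrow> int) \<Rightarrow> (nat \<Rightarrow> int) \<Rightarrow> int" where
  "heis_form a u v =
     a 0 * (u 0 * v 1) +
     a 1 * (u 0 * (v 2 + u 4 * v 0) - u 2 * v 0) +
     a 2 * (u 1 * (v 3 + u 4 * v 1) - u 3 * v 1) +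
     a 3 * (u 0 * (v 3 + u 4 * v 1) - u 2 * v 1) +
     a 4 * (2 * u 4 * v 2 + u 4 * (u 4 - 1) * v 0) +
     a 5 * (2 * u 4 * v 3 + u 4 * (u 4 - 1) * v 1)"

text \<open>The identity holds over the integers; reduction modulo \<open>p\<close> enters only
  through \<open>heis_form_cong\<close>.\<close>

lemma heis_form_cocycle:
  "heis_form a u v + heis_form a (heis_mult u v) w = heis_form a v w + heis_form a u (heis_mult v w)"
  by (simp add: heis_form_def heis_mult_def) (simp add: algebra_simps)

lemma heis_form_cong:
  assumes "\<And>t. t < 5 \<Longrightarrow> u t mod m = u' t mod m" "\<And>t. t < 5 \<Longrightarrow> v t mod m = v' t mod m"
  shows "heis_form a u v mod m = heis_form a u' v' mod m"
  unfolding heis_form_def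
  by (intro mod_add_cong mod_mult_cong mod_diff_cong refl assms) simp_all

lemma heis_form_diff:
  "heis_form (\<lambda>t. a t - b t) u v = heis_form a u v - heis_form b u v"
  by (simp add: heis_form_def algebra_simps)

text \<open>Coboundaries are symmetric on commuting pairs, so the commutator of lifts of two
  commuting elements is an invariant of the class. It is used to tell the explicit cocycles
  apart.\<close>

lemma (in group) cohomologous_commute:
  assumes coh: "(f, f') \<in> cohomologous G" and c: "x \<in> carrier G" "y \<in> carrier G" "x \<otimes> y = y \<otimes> x"
  shows "f x y / f y x = f' x y / f' y x"
proof -
  obtain h where h: "\<forall>x\<in>carrier G. h x \<noteq> 0"
    "\<forall>x\<in>carrier G. \<forall>y\<in>carrier G. f x y = f' x y * (h x * h y / h (x \<otimes> y))"
    using cohomologousD(3)[OF coh] by blast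
  have nz: "f' x y \<noteq> 0" "f' y x \<noteq> 0" "h x \<noteq> 0" "h y \<noteq> 0" "h (y \<otimes> x) \<noteq> 0"
    using cohomologousD(2)[OF coh] h(1) c by simp_all
  have "f x y = f' x y * (h x * h y / h (y \<otimes> x))" "f y x = f' y x * (h x * h y / h (y \<otimes> x))"
    using h(2) c by (simp_all add: mult.commute)
  then show ?thesis using nz by simp
qed

text \<open>The coordinates are integers that multiply correctly only modulo \<open>p\<close>, which
  is all that a \<open>p\<close>-th root of unity sees. Six coefficients modulo \<open>p\<close>
  give \<open>p ^ 6\<close> cocycles, and six commuting pairs of basis elements separate their
  classes.\<close>

lemma (in group) schur_multiplier_lower_bound:
  fixes v :: "'a \<Rightarrow> nat \<Rightarrow> int" and p :: nat
  assumes p: "Factorial_Ring.prime p" "odd p"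
    and mult: "\<And>x y t. x \<in> carrier G \<Longrightarrow> y \<in> carrier G \<Longrightarrow> t < 5 \<Longrightarrow>
      v (x \<otimes> y) t mod int p = heis_mult (v x) (v y) t mod int p"
    and e: "\<And>t. t < 5 \<Longrightarrow> e t \<in> carrier G"
      "\<And>t t'. t < 5 \<Longrightarrow> t' < 5 \<Longrightarrow> v (e t) t' = (if t = t' then 1 else 0)"
    and comm: "e 0 \<otimes> e 1 = e 1 \<otimes> e 0" "e 2 \<in> center G" "e 3 \<in> center G"
    and fin: "finite (schur_multiplier G)"
  shows "p ^ 6 \<le> card (schur_multiplier G)"
proof -
  have p0: "p > 0" using p(1) by (rule prime_gt_0_nat)
  define f where "f a x y = (if x \<in> carrier G \<and> y \<in> carrier G
    then root_of_unity p (heis_form a (v x) (v y)) else 1)" for a x y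
  have f: "f a \<in> schur_cocycles G" for a
    unfolding schur_cocycles_def
  proof (intro CollectI conjI ballI allI impI)
    fix x y z assume c: "x \<in> carrier G" "y \<in> carrier G" "z \<in> carrier G"
    have "heis_form a (v (x \<otimes> y)) (v z) mod int p = heis_form a (heis_mult (v x) (v y)) (v z) mod int p"
      "heis_form a (v x) (v (y \<otimes> z)) mod int p = heis_form a (v x) (heis_mult (v y) (v z)) mod int p"
      using c by (auto intro!: heis_form_cong mult)
    then have "(heis_form a (v x) (v y) + heis_form a (v (x \<otimes> y)) (v z)) mod int p =
        (heis_form a (v y) (v z) + heis_form a (v x) (v (y \<otimes> z))) mod int p"
      using heis_form_cocycle[of a "v x" "v y" "v z"] by (metis mod_add_cong)
    then have "root_of_unity p (heis_form a (v x) (v y) + heis_form a (v (x \<otimes> y)) (v z)) =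
        root_of_unity p (heis_form a (v y) (v z) + heis_form a (v x) (v (y \<otimes> z)))"
      by (intro root_of_unity_cong[OF p0]) (simp add: mod_eq_dvd_iff)
    then show "f a x y * f a (x \<otimes> y) z = f a y z * f a x (y \<otimes> z)"
      using c by (simp add: f_def root_of_unity_add)
  qed (auto simp: f_def)
  define A where "A = {..<6::nat} \<rightarrow>\<^sub>E {0..<int p}"
  have dvd: "int p dvd heis_form (\<lambda>t. a t - b t) (v x) (v y) - heis_form (\<lambda>t. a t - b t) (v y) (v x)"
    if coh: "(f a, f b) \<in> cohomologous G"
      and c: "x \<in> carrier G" "y \<in> carrier G" "x \<otimes> y = y \<otimes> x" for a b x y
  proof -
    have "root_of_unity p (heis_form a (v x) (v y) - heis_form a (v y) (v x)) =
        root_of_unity p (heis_form b (v x) (v y) - heis_form b (v y) (v x))"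
      using cohomologous_commute[OF coh c] c by (simp add: f_def root_of_unity_diff)
    then have "root_of_unity p (heis_form a (v x) (v y) - heis_form a (v y) (v x) -
        (heis_form b (v x) (v y) - heis_form b (v y) (v x))) = 1"
      by (subst root_of_unity_diff) simp
    then show ?thesis
      unfolding root_of_unity_eq_1_iff[OF p0] heis_form_diff by (simp add: algebra_simps)
  qed
  have inj: "inj_on (\<lambda>a. cohomologous G `` {f a}) A"
  proof (rule inj_onI)
    fix a b assume ab: "a \<in> A" "b \<in> A" "cohomologous G `` {f a} = cohomologous G `` {f b}"
    then have coh: "(f a, f b) \<in> cohomologous G"
      using cohomologous_class_eq_iff[OF f f] by blast
    \<comment> \<open>With the pair \<open>e 0\<close>, \<open>e 1\<close> these are six commuting
      pairs, and each isolates one coefficient: the exponent of the commutator is \<open>a 0\<close>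
      for \<open>(e 0, e 1)\<close>, \<open>2 * a 1\<close> for \<open>(e 0, e 2)\<close>,
      \<open>2 * a 2\<close> for \<open>(e 1, e 3)\<close>, \<open>a 3\<close> for
      \<open>(e 0, e 3)\<close>, \<open>2 * a 4\<close> for \<open>(e 4, e 2)\<close> and
      \<open>2 * a 5\<close> for \<open>(e 4, e 3)\<close>.\<close>
    have 2: "e 4 \<otimes> e 2 = e 2 \<otimes> e 4" "e 4 \<otimes> e 3 = e 3 \<otimes> e 4" "e 0 \<otimes> e 2 = e 2 \<otimes> e 0"
      "e 0 \<otimes> e 3 = e 3 \<otimes> e 0" "e 1 \<otimes> e 3 = e 3 \<otimes> e 1"
      by (intro center_comm comm(2,3) e(1); simp)+
    have odd: "int p dvd d" if "int p dvd 2 * d" for d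
    proof -
      have "coprime (int p) 2" using p by (simp add: coprime_commute)
      then show ?thesis using that by (simp add: coprime_dvd_mult_right_iff)
    qed
    have "int p dvd a 0 - b 0"
      using dvd[OF coh e(1) e(1) comm(1)] by (simp add: heis_form_def e(2))
    moreover have "int p dvd a 1 - b 1"
      using dvd[OF coh e(1) e(1) 2(3)] by - (rule odd, simp add: heis_form_def e(2))
    moreover have "int p dvd a 2 - b 2"
      using dvd[OF coh e(1) e(1) 2(5)] by - (rule odd, simp add: heis_form_def e(2))
    moreover have "int p dvd a 3 - b 3"
      using dvd[OF coh e(1) e(1) 2(4)] by (simp add: heis_form_def e(2))
    moreover have "int p dvd a 4 - b 4"
      using dvd[OF coh e(1) e(1) 2(1)] by - (rule odd, simp add: heis_form_def e(2) algebra_simps)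
    moreover have "int p dvd a 5 - b 5"
      using dvd[OF coh e(1) e(1) 2(2)] by - (rule odd, simp add: heis_form_def e(2) algebra_simps)
    moreover have "a t = b t" if t: "t < 6" "int p dvd a t - b t" for t
    proof -
      have "a t \<in> {0..<int p}" "b t \<in> {0..<int p}" using ab t(1) by (auto simp: A_def PiE_iff)
      then show ?thesis using t(2) by (simp add: mod_eq_dvd_iff[symmetric])
    qed
    ultimately have "a t = b t" if "t < 6" for t
      using that by (auto simp: numeral_eq_Suc less_Suc_eq)
    then show "a = b" using ab unfolding A_def by (intro PiE_ext) auto
  qed
  have "card A = p ^ 6" by (simp add: A_def card_PiE)
  moreover have "(\<lambda>a. cohomologous G `` {f a}) ` A \<subseteq> schur_multiplier G"
    using cohomologous_class_in[OF f] by blast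
  ultimately show ?thesis using card_inj_on_le[OF inj _ fin] by simp
qed

section \<open>Class two and exponent p\<close>

locale exponent_p_group = class_two_p_group G p n for G (structure) and p n +
  assumes n5: "n = 5" and card_derived: "card (derived G (carrier G)) = p ^ 2"
    and exponent: "x \<in> carrier G \<Longrightarrow> x [^] p = \<one>"
begin

abbreviation D :: "'a set" where "D \<equiv> derived G (carrier G)"

lemma subgroup_of_closed:
  assumes "H \<subseteq> carrier G" "\<one> \<in> H" "\<And>x y. x \<in> H \<Longrightarrow> y \<in> H \<Longrightarrow> x \<otimes> y \<in> H"
  shows "subgroup H G"
proof (rule subgroupI)
  fix x assume x: "x \<in> H"
  then have xc: "x \<in> carrier G" using assms(1) by blast
  have pw: "x [^] k \<in> H" for k :: nat using assms x by (induction k) auto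
  obtain m where m: "p = Suc m" using p_gt_1 by (metis gr0_implies_Suc less_trans zero_less_one)
  have "x [^] m \<otimes> x = \<one>" using exponent[OF xc] unfolding m by simp
  then have "inv x = x [^] m" using xc inv_equality by simp
  then show "inv x \<in> H" using pw by simp
qed (use assms in auto)

lemma pow_mod_p: "x \<in> carrier G \<Longrightarrow> x [^] (k mod p) = x [^] k"
proof -
  assume x: "x \<in> carrier G"
  have "x [^] k = x [^] (p * (k div p) + k mod p)" by simp
  also have "\<dots> = (x [^] p) [^] (k div p) \<otimes> x [^] (k mod p)"
    using x by (simp only: nat_pow_mult[symmetric] nat_pow_pow)
  finally show ?thesis using exponent[OF x] x by simp
qed

text \<open>Modulo a central \<open>z\<close> of order \<open>p\<close> in \<open>G'\<close>, the
  commutator is an alternating form on the three-dimensional space \<open>G / G'\<close> with values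
  in a group of order \<open>p\<close>. In odd dimension such a form has a nonzero radical; an
  element \<open>g\<close> of it has all its commutators in \<open>Z\<close>, hence a centralizer of
  index at most \<open>p\<close>. The sets \<open>K t\<close> are the orthogonal
  complements.\<close>

lemma ex_large_centralizer:
  obtains g where "g \<in> carrier G" "g \<notin> D" "p ^ 4 \<le> card (centralizer G g)"
proof -
  have "1 < p ^ 2" using p_gt_1 by (intro one_less_power) auto
  then have "D \<noteq> {\<one>}" using card_derived by auto
  then obtain z where z: "z \<in> D" "z \<in> center G" "z \<noteq> \<one>" "z [^] p = \<one>"
    by (rule normal_central_order_p[OF derived_self_is_normal])
  interpret C: central_prime G z p by unfold_locales (use z prime_p in auto)
  have "\<not> D \<subseteq> C.Z"
  proof
    assume "D \<subseteq> C.Z"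
    then have "p ^ 2 \<le> p"
      using card_mono[OF finite_subgroup[OF C.Z.subgroup_axioms]] C.card_Z card_derived by metis
    then show False using p_gt_1 by (simp add: power2_eq_square)
  qed
  then obtain x y where xy: "x \<in> carrier G" "y \<in> carrier G" "commutator G x y \<notin> C.Z"
    using derived_subset_iff[OF C.Z.subgroup_axioms] by blast
  define K where "K t = {h \<in> carrier G. commutator G t h \<in> C.Z}" for t
  have K: "subgroup (K t) G" if "t \<in> carrier G" for t
    unfolding K_def by (rule subgroup_commutator_right[OF C.Z.subgroup_axioms that])
  have K_sym: "h \<in> K t \<longleftrightarrow> t \<in> K h" if "t \<in> carrier G" "h \<in> carrier G" for t h
    using that commutator_swap[of t h] commutator_swap[of h t] C.Z.m_inv_closed
    unfolding K_def by fastforce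
  have K_self: "t \<in> K t" if "t \<in> carrier G" for t
    using that commutator_eq_one_iff[of t t] C.Z.one_closed by (simp add: K_def)
  have DK: "D \<subseteq> K t" if t: "t \<in> carrier G" for t
  proof
    fix d assume d: "d \<in> D"
    then have "commutator G t d = \<one>"
      using t derived_closed derived_central center_comm[of d t] by (auto simp: commutator_eq_one_iff)
    then show "d \<in> K t" using derived_closed[OF d] C.Z.one_closed by (simp add: K_def)
  qed
  have S: "subgroup (K x \<inter> K y) G" using K xy by (intro subgroups_Inter_pair) auto
  let ?I = "(\<lambda>x. C.Z #> x) ` D"
  have "card (carrier G) \<le> card (?I \<times> ?I) * card (K x \<inter> K y)"
  proof (rule card_le_fibres[OF S finite_carrier])
    show "finite (?I \<times> ?I)" using finite_subgroup[OF subgroup_derived] by simp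
    show "(\<lambda>h. (C.Z #> commutator G x h, C.Z #> commutator G y h)) ` carrier G \<subseteq> ?I \<times> ?I"
      using commutator_in_derived xy by auto
    fix h k assume c: "h \<in> carrier G" "k \<in> carrier G"
      and eq: "(C.Z #> commutator G x h, C.Z #> commutator G y h) =
        (C.Z #> commutator G x k, C.Z #> commutator G y k)"
    have "inv h \<otimes> k \<in> K t" if t: "t \<in> carrier G"
      and e: "C.Z #> commutator G t k = C.Z #> commutator G t h" for t
    proof -
      obtain i where "i < p" and i: "commutator G t k = z [^] i \<otimes> commutator G t h"
        by (rule C.coset_eq_imp[OF commutator_closed[OF t c(2)] commutator_closed[OF t c(1)] e])
      have "commutator G t h \<otimes> commutator G t (inv h \<otimes> k) = commutator G t k"
        using commutator_mult_right[of h "inv h \<otimes> k" t] c t by (simp add: m_assoc[symmetric])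
      also have "\<dots> = commutator G t h \<otimes> z [^] i"
        unfolding i using center_comm[OF commutator_central[OF t c(1)], of "z [^] i"] by simp
      finally have "commutator G t (inv h \<otimes> k) = z [^] i" using t c by simp
      then show ?thesis
        using c subgroup_nat_pow_closed[OF C.Z.subgroup_axioms C.z_in_Z] by (simp add: K_def)
    qed
    then show "inv h \<otimes> k \<in> K x \<inter> K y" using eq xy by simp
  qed
  moreover have "card ?I = p"
    using card_coset_image[OF z(2-4) subgroup_derived z(1)] card_derived p_gt_1
    by (simp add: power2_eq_square)
  ultimately have "p ^ 5 \<le> p ^ 2 * card (K x \<inter> K y)"
    using card_carrier n5 by (simp add: card_cartesian_product power2_eq_square)
  moreover have p5: "p ^ 5 = p ^ 2 * p ^ 3" by (simp flip: power_add)
  ultimately have "p ^ 2 * p ^ 3 \<le> p ^ 2 * card (K x \<inter> K y)" unfolding p5 by blast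
  then have "p ^ 3 \<le> card (K x \<inter> K y)" using p_gt_1 by (simp only: mult_le_cancel1) simp
  moreover have "p ^ 2 < p ^ 3" using p_gt_1 by simp
  ultimately have "\<not> K x \<inter> K y \<subseteq> D"
    using card_mono[OF finite_subgroup[OF subgroup_derived], of "K x \<inter> K y"] card_derived by auto
  then obtain g where g: "g \<in> K x" "g \<in> K y" "g \<notin> D" by blast
  have gc: "g \<in> carrier G" using g(1) by (simp add: K_def)
  have x: "x \<in> K g" "x \<in> K x" "x \<notin> K y" and y: "y \<in> K g" "y \<notin> K x"
    using g K_sym K_self xy gc by (auto simp: K_def)
  have T: "subgroup (K g) G" "subgroup (K g \<inter> K x) G" "subgroup (K g \<inter> K x \<inter> K y) G"
    using K gc xy by (auto intro!: subgroups_Inter_pair)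
  \<comment> \<open>The elements \<open>g\<close>, \<open>x\<close> and \<open>y\<close> witness
    three strict inclusions from \<open>D\<close> up to \<open>K g\<close>, so \<open>K g\<close>
    has at least \<open>p ^ 5\<close> elements.\<close>
  have "p * card D \<le> card (K g \<inter> K x \<inter> K y)"
    by (rule psubset_card[OF subgroup_derived T(3)]) (use DK gc xy g K_self in blast)
  moreover have "p * card (K g \<inter> K x \<inter> K y) \<le> card (K g \<inter> K x)"
    by (rule psubset_card[OF T(3,2)]) (use x in blast)
  moreover have "p * card (K g \<inter> K x) \<le> card (K g)"
    by (rule psubset_card[OF T(2,1)]) (use y in blast)
  ultimately have "p * (p * (p * card D)) \<le> card (K g)"
    by (meson le_trans mult_le_mono2)
  then have "card (carrier G) \<le> card (K g)"
    using card_derived card_carrier n5 by (simp add: power_numeral_reduce)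
  then have Kg: "K g = carrier G"
    using card_seteq[OF finite_carrier, of "K g"] by (auto simp: K_def)
  have "p ^ n \<le> card C.Z * card (centralizer G g)"
  proof (rule card_centralizer_ge[OF gc finite_subgroup[OF C.Z.subgroup_axioms]])
    show "commutator G h g \<in> C.Z" if "h \<in> carrier G" for h
      using Kg K_sym[OF that gc] that by (auto simp: K_def)
  qed
  then have "p * p ^ 4 \<le> p * card (centralizer G g)"
    using C.card_Z n5 by (simp add: power_numeral_reduce)
  then have "p ^ 4 \<le> card (centralizer G g)" using p_gt_1 by simp
  then show ?thesis using that gc g(3) by blast
qed

text \<open>For a subgroup \<open>S\<close> that contains \<open>D\<close> this is the subgroup
  generated by \<open>S\<close> and \<open>x\<close>; the explicit form bounds its order from
  above.\<close>

definition adjoin :: "'a set \<Rightarrow> 'a \<Rightarrow> 'a set" where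
  "adjoin S x = (\<lambda>(s, i). s \<otimes> x [^] i) ` (S \<times> {..<p})"

lemma adjoin_pow_mem:
  assumes "x \<in> carrier G" "s \<in> S"
  shows "s \<otimes> x [^] (k::nat) \<in> adjoin S x"
  unfolding adjoin_def using assms p_gt_1 pow_mod_p[of x k]
  by (intro rev_image_eqI[of "(s, k mod p)"]) auto

lemma adjoin:
  assumes S: "subgroup S G" "D \<subseteq> S" and x: "x \<in> carrier G"
  shows "subgroup (adjoin S x) G" "insert x S \<subseteq> adjoin S x" "card (adjoin S x) \<le> p * card S"
proof -
  interpret S: subgroup S G by (rule S(1))
  show ins: "insert x S \<subseteq> adjoin S x"
    using adjoin_pow_mem[OF x, of \<one> S 1] adjoin_pow_mem[OF x, of _ S 0] x S.mem_carrier by auto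
  show "subgroup (adjoin S x) G"
  proof (rule subgroup_of_closed)
    show "adjoin S x \<subseteq> carrier G" unfolding adjoin_def using x S.mem_carrier by auto
    show "\<one> \<in> adjoin S x" using ins S.one_closed by blast
    fix u w assume "u \<in> adjoin S x" "w \<in> adjoin S x"
    then obtain s t and i j :: nat where u: "u = s \<otimes> x [^] i" "s \<in> S" and w: "w = t \<otimes> x [^] j" "t \<in> S"
      unfolding adjoin_def by auto
    note c = S.mem_carrier[OF u(2)] S.mem_carrier[OF w(2)]
    let ?c = "commutator G (x [^] i) t"
    have "u \<otimes> w = s \<otimes> (x [^] i \<otimes> t) \<otimes> x [^] j" unfolding u w using c x by (simp add: m_assoc)
    also have "\<dots> = (s \<otimes> ?c \<otimes> t) \<otimes> (x [^] i \<otimes> x [^] j)"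
      unfolding mult_eq_commutator[OF nat_pow_closed[OF x] c(2)] using c x by (simp add: m_assoc)
    finally have "u \<otimes> w = (s \<otimes> ?c \<otimes> t) \<otimes> x [^] (i + j)" using x by (simp add: nat_pow_mult)
    moreover have "?c \<in> S" using S(2) commutator_in_derived[OF nat_pow_closed[OF x] c(2)] by blast
    ultimately show "u \<otimes> w \<in> adjoin S x" using adjoin_pow_mem[OF x] u w S.m_closed by simp
  qed
  have "card (adjoin S x) \<le> card (S \<times> {..<p})"
    unfolding adjoin_def using finite_subgroup[OF S(1)] by (intro card_image_le) simp
  then show "card (adjoin S x) \<le> p * card S" by (simp add: card_cartesian_product mult.commute)
qed

text \<open>The centralizer of \<open>a\<close> has order at least \<open>p ^ 4\<close>, which
  leaves room for \<open>b\<close> outside the subgroup generated by \<open>D\<close> and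
  \<open>a\<close>, of order at most \<open>p ^ 3\<close>. The last property acts as an induction
  principle: a property that defines a subgroup is checked on \<open>D\<close>, \<open>a\<close>,
  \<open>b\<close> and \<open>c\<close> only.\<close>

lemma generators:
  obtains a b c where "a \<in> carrier G" "b \<in> carrier G" "c \<in> carrier G" "a \<otimes> b = b \<otimes> a"
    "\<And>H. subgroup H G \<Longrightarrow> D \<subseteq> H \<Longrightarrow> a \<in> H \<Longrightarrow> b \<in> H \<Longrightarrow> c \<in> H \<Longrightarrow> H = carrier G"
proof -
  obtain a where a: "a \<in> carrier G" "a \<notin> D" "p ^ 4 \<le> card (centralizer G a)"
    by (rule ex_large_centralizer)
  note E1 = adjoin[OF subgroup_derived order_refl a(1)]
  have lt: "p ^ 3 < p ^ 4" "p ^ 4 < p ^ 5" using p_gt_1 by simp_all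
  have "card (adjoin D a) \<le> p ^ 3" using E1(3) card_derived by (simp add: power_numeral_reduce)
  then have "\<not> centralizer G a \<subseteq> adjoin D a"
    using card_mono[OF finite_subgroup[OF E1(1)], of "centralizer G a"] a(3) lt by linarith
  then obtain b where b: "b \<in> centralizer G a" "b \<notin> adjoin D a" by blast
  have bc: "b \<in> carrier G" "b \<otimes> a = a \<otimes> b" using b(1) by (auto simp: centralizer_def)
  have D1: "D \<subseteq> adjoin D a" using E1(2) by blast
  note E2 = adjoin[OF E1(1) D1 bc(1)]
  have "p * card (adjoin D a) \<le> p * p ^ 3" using \<open>card (adjoin D a) \<le> p ^ 3\<close> by (rule mult_le_mono2)
  with E2(3) have "card (adjoin (adjoin D a) b) \<le> p * p ^ 3" by (rule order_trans)
  then have "card (adjoin (adjoin D a) b) \<le> p ^ 4" by (simp add: power_numeral_reduce)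
  then have "\<not> carrier G \<subseteq> adjoin (adjoin D a) b"
    using card_mono[OF finite_subgroup[OF E2(1)], of "carrier G"] card_carrier n5 lt by auto
  then obtain c where c: "c \<in> carrier G" "c \<notin> adjoin (adjoin D a) b" by blast
  show ?thesis
  proof (rule that[OF a(1) bc(1) c(1) bc(2)[symmetric]])
    fix H assume H: "subgroup H G" "D \<subseteq> H" "a \<in> H" "b \<in> H" "c \<in> H"
    interpret H: subgroup H G by (rule H(1))
    have sub: "adjoin S x \<subseteq> H" if "S \<subseteq> H" "x \<in> H" for S x
      unfolding adjoin_def using that subgroup_nat_pow_closed[OF H(1)] H.m_closed by auto
    have 1: "adjoin D a \<subseteq> H" by (rule sub[OF H(2,3)])
    have 2: "adjoin (adjoin D a) b \<subseteq> H" by (rule sub[OF 1 H(4)])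
    have "p * card D \<le> card (adjoin D a)"
      by (rule psubset_card[OF subgroup_derived E1(1)]) (use E1(2) a(2) in blast)
    moreover have "p * card (adjoin D a) \<le> card (adjoin (adjoin D a) b)"
      by (rule psubset_card[OF E1(1) E2(1)]) (use E2(2) b(2) in blast)
    moreover have "p * card (adjoin (adjoin D a) b) \<le> card H"
      by (rule psubset_card[OF E2(1) H(1)]) (use 2 c(2) H(5) in blast)
    ultimately have "p * (p * (p * card D)) \<le> card H"
      by (meson le_trans mult_le_mono2)
    then have "card (carrier G) \<le> card H"
      using card_derived card_carrier n5 by (simp add: power_numeral_reduce)
    then show "H = carrier G" using card_seteq[OF finite_carrier H.subset] by simp
  qed
qed

text \<open>What \<open>schur_multiplier_lower_bound\<close> asks for is a coordinate system. The
  exponents of a normal form in the generators and their two commutators provide it.\<close>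

lemma schur_multiplier_exponent_p:
  assumes fin: "finite (schur_multiplier G)"
  shows "p ^ 6 \<le> card (schur_multiplier G)"
proof -
  obtain a b c where abc: "a \<in> carrier G" "b \<in> carrier G" "c \<in> carrier G" and ab: "a \<otimes> b = b \<otimes> a"
    and gen: "\<And>H. subgroup H G \<Longrightarrow> D \<subseteq> H \<Longrightarrow> a \<in> H \<Longrightarrow> b \<in> H \<Longrightarrow> c \<in> H \<Longrightarrow> H = carrier G"
    by (rule generators) (rule that)
  define w1 where "w1 = commutator G c a"
  define w2 where "w2 = commutator G c b"
  have wcen: "w1 \<in> center G" "w2 \<in> center G"
    unfolding w1_def w2_def using commutator_central abc by blast+
  have wc: "w1 \<in> carrier G" "w2 \<in> carrier G" using wcen center_closed by blast+
  define cen where "cen k l = w1 [^] k \<otimes> w2 [^] l" for k l :: nat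
  have cenc: "cen k l \<in> carrier G" for k l using wc by (simp add: cen_def)
  have cen: "cen k l \<in> center G" for k l
    unfolding cen_def using wcen subgroup_nat_pow_closed[OF subgroup_center]
      subgroup.m_closed[OF subgroup_center] by blast
  have cen_mult: "cen k l \<otimes> cen k' l' = cen (k + k') (l + l')" for k l k' l'
  proof -
    have "w2 [^] l \<otimes> w1 [^] k' = w1 [^] k' \<otimes> w2 [^] l"
      using center_comm[OF subgroup_nat_pow_closed[OF subgroup_center wcen(1)]] wc by simp
    then have "cen k l \<otimes> cen k' l' = w1 [^] k \<otimes> w1 [^] k' \<otimes> (w2 [^] l \<otimes> w2 [^] l')"
      unfolding cen_def using wc by (metis (no_types, lifting) m_assoc m_closed nat_pow_closed)
    then show ?thesis using wc by (simp add: cen_def nat_pow_mult)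
  qed
  define W where "W = range (\<lambda>(k, l). cen k l)"
  have W_mem: "cen k l \<in> W" for k l unfolding W_def by (rule range_eqI[of _ _ "(k, l)"]) simp
  have W: "subgroup W G"
  proof (rule subgroup_of_closed)
    show "\<one> \<in> W" using W_mem[of 0 0] by (simp add: cen_def)
  qed (use cenc cen_mult W_mem in \<open>auto simp: W_def\<close>)
  have inW: "w1 \<in> W" "w2 \<in> W" "\<one> \<in> W"
    using W_mem[of 1 0] W_mem[of 0 1] W_mem[of 0 0] wc by (simp_all add: cen_def)
  have inW': "inv w1 \<in> W" "inv w2 \<in> W" using inW subgroup.m_inv_closed[OF W] by blast+
  \<comment> \<open>The commutator is multiplicative in each argument, so it suffices to treat
    generators: \<open>gen\<close> is applied in the second argument with a generator in the first,
    and then in the first argument.\<close>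
  have DW: "D \<subseteq> W"
  proof -
    have d: "commutator G d h = \<one>" "commutator G h d = \<one>" if "d \<in> D" "h \<in> carrier G" for d h
      using that derived_central derived_closed center_comm[of d h]
      by (auto simp: commutator_eq_one_iff)
    have self: "commutator G h h = \<one>" if "h \<in> carrier G" for h
      using that by (simp add: commutator_eq_one_iff)
    have ab1: "commutator G a b = \<one>" "commutator G b a = \<one>"
      using abc ab by (simp_all add: commutator_eq_one_iff)
    have sw: "commutator G a c = inv w1" "commutator G b c = inv w2"
      unfolding w1_def w2_def using commutator_swap abc by blast+
    have R: "{g \<in> carrier G. commutator G h g \<in> W} = carrier G"
      if h: "h \<in> carrier G" "commutator G h a \<in> W" "commutator G h b \<in> W" "commutator G h c \<in> W" for h
      by (rule gen[OF subgroup_commutator_right[OF W h(1)]])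
        (use h abc d inW(3) derived_closed in auto)
    have 1: "commutator G a g \<in> W" "commutator G b g \<in> W" "commutator G c g \<in> W" if "g \<in> carrier G" for g
      using R[of a] R[of b] R[of c] abc self ab1 sw inW inW' that w1_def w2_def by auto
    have L: "{h \<in> carrier G. commutator G h g \<in> W} = carrier G" if g: "g \<in> carrier G" for g
      by (rule gen[OF subgroup_commutator_left[OF W g]])
        (use abc d g 1 inW(3) derived_closed in auto)
    show ?thesis unfolding derived_subset_iff[OF W] using L by blast
  qed
  define nf where "nf u = a [^] u 0 \<otimes> b [^] u 1 \<otimes> cen (u 2) (u 3) \<otimes> c [^] u 4" for u :: "nat \<Rightarrow> nat"
  have nfc: "nf u \<in> carrier G" for u using abc cenc by (simp add: nf_def)
  \<comment> \<open>This is \<open>heis_mult\<close> for natural exponents. Without reduction modulo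
    \<open>p\<close> the product of normal forms is an exact formula.\<close>
  define mu where "mu u v t = u t + v t + (if t = 2 then u 4 * v 0 else if t = 3 then u 4 * v 1 else 0)"
    for u v :: "nat \<Rightarrow> nat" and t :: nat
  have nf_mult: "nf u \<otimes> nf v = nf (mu u v)" for u v
  proof -
    let ?A = "a [^] u 0 \<otimes> b [^] u 1" and ?B = "a [^] v 0 \<otimes> b [^] v 1"
    let ?W = "cen (u 2) (u 3)" and ?V = "cen (v 2) (v 3)"
    let ?C = "c [^] u 4" and ?E = "c [^] v 4"
    let ?K = "cen (u 4 * v 0) (u 4 * v 1)"
    have cl: "?A \<in> carrier G" "?B \<in> carrier G" "?C \<in> carrier G" "?E \<in> carrier G" using abc by simp_all
    have "commutator G ?C ?B = commutator G ?C (a [^] v 0) \<otimes> commutator G ?C (b [^] v 1)"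
      using abc by (intro commutator_mult_right) auto
    also have "\<dots> = ?K"
      using abc wc by (simp add: commutator_pow_left commutator_pow_right nat_pow_pow cen_def
          w1_def[symmetric] w2_def[symmetric] mult.commute)
    finally have CB: "?C \<otimes> ?B = ?K \<otimes> (?B \<otimes> ?C)" using mult_eq_commutator[OF cl(3,2)] by simp
    have ba: "b [^] u 1 \<otimes> a [^] v 0 = a [^] v 0 \<otimes> b [^] u 1"
      using nat_pow_commute[OF abc(2) nat_pow_closed[OF abc(1)]
          nat_pow_commute[OF abc(1,2) ab, symmetric]] .
    have "?A \<otimes> ?B = a [^] u 0 \<otimes> (b [^] u 1 \<otimes> a [^] v 0) \<otimes> b [^] v 1"
      using abc by (simp only: m_assoc m_closed nat_pow_closed)
    also have "\<dots> = (a [^] u 0 \<otimes> a [^] v 0) \<otimes> (b [^] u 1 \<otimes> b [^] v 1)"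
      unfolding ba using abc by (simp only: m_assoc m_closed nat_pow_closed)
    finally have AB: "?A \<otimes> ?B = a [^] (u 0 + v 0) \<otimes> b [^] (u 1 + v 1)"
      unfolding nat_pow_mult[OF abc(1)] nat_pow_mult[OF abc(2)] .
    \<comment> \<open>The only noncentral exchange is that of \<open>?C\<close> with
      \<open>?B\<close>; it produces the central factor \<open>?K\<close>, which is the twist in
      \<open>heis_mult\<close>.\<close>
    have "nf u \<otimes> nf v = ?A \<otimes> ?W \<otimes> (?C \<otimes> ?B) \<otimes> ?V \<otimes> ?E"
      unfolding nf_def using cl cenc by (simp only: m_assoc m_closed)
    also have "\<dots> = ?A \<otimes> (?W \<otimes> ?K) \<otimes> ?B \<otimes> (?C \<otimes> ?V) \<otimes> ?E"
      unfolding CB using cl cenc by (simp only: m_assoc m_closed)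
    also have "\<dots> = ?A \<otimes> ((?W \<otimes> ?K) \<otimes> ?B) \<otimes> (?V \<otimes> ?C) \<otimes> ?E"
      unfolding center_comm[OF cen cl(3)] using cl cenc by (simp only: m_assoc m_closed)
    also have "\<dots> = ?A \<otimes> (?B \<otimes> (?W \<otimes> ?K)) \<otimes> (?V \<otimes> ?C) \<otimes> ?E"
      unfolding cen_mult center_comm[OF cen cl(2)] ..
    also have "\<dots> = (?A \<otimes> ?B) \<otimes> (?W \<otimes> ?K \<otimes> ?V) \<otimes> (?C \<otimes> ?E)"
      using cl cenc by (simp only: m_assoc m_closed)
    also have "\<dots> = nf (mu u v)"
      unfolding AB cen_mult nf_def mu_def using abc by (simp add: nat_pow_mult ac_simps)
    finally show ?thesis .
  qed
  have nf_unit: "nf (\<lambda>s. 0) = \<one>" by (simp add: nf_def cen_def)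
  have nf_gen: "nf (\<lambda>s. if s = 0 then 1 else 0) = a" "nf (\<lambda>s. if s = 1 then 1 else 0) = b"
    "nf (\<lambda>s. if s = 2 then 1 else 0) = w1" "nf (\<lambda>s. if s = 3 then 1 else 0) = w2"
    "nf (\<lambda>s. if s = 4 then 1 else 0) = c"
    using abc wc by (simp_all add: nf_def cen_def)
  have nf_cen: "nf (\<lambda>s. if s = 2 then k else if s = 3 then l else 0) = cen k l" for k l
    using cenc by (simp add: nf_def)
  have range: "range nf = carrier G"
  proof (rule gen[OF subgroup_of_closed])
    show "range nf \<subseteq> carrier G" using nfc by blast
    show "\<one> \<in> range nf" using nf_unit by (metis rangeI)
    show "x \<otimes> y \<in> range nf" if "x \<in> range nf" "y \<in> range nf" for x y
      using that nf_mult by auto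
    show "D \<subseteq> range nf"
    proof
      fix d assume "d \<in> D"
      then obtain k l where "d = cen k l" using DW unfolding W_def by auto
      then have "d = nf (\<lambda>s. if s = 2 then k else if s = 3 then l else 0)" unfolding nf_cen .
      then show "d \<in> range nf" by simp
    qed
    show "a \<in> range nf" "b \<in> range nf" "c \<in> range nf" using nf_gen by (metis rangeI)+
  qed
  define U where "U = {..<5::nat} \<rightarrow>\<^sub>E {..<p}"
  define rd where "rd u = (\<lambda>t\<in>{..<5::nat}. u t mod p)" for u :: "nat \<Rightarrow> nat"
  have rd: "rd u \<in> U" for u unfolding rd_def U_def using p_gt_1 by (auto simp: PiE_iff)
  have nf_rd: "nf (rd u) = nf u" for u
    unfolding nf_def rd_def cen_def using abc wc by (simp add: pow_mod_p)
  have im: "nf ` U = carrier G"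
  proof
    show "carrier G \<subseteq> nf ` U" unfolding range[symmetric] using nf_rd rd by (metis image_eqI image_subsetI)
  qed (use nfc in blast)
  have finU: "finite U" unfolding U_def by (intro finite_PiE) auto
  \<comment> \<open>There are as many reduced exponent vectors as group elements, so surjectivity of
    \<open>nf\<close> already makes the coordinates unique.\<close>
  have "card U = p ^ 5" by (simp add: U_def card_PiE)
  then have inj: "inj_on nf U"
    using im card_carrier n5 by (intro eq_card_imp_inj_on finU) simp
  define co where "co x = inv_into U nf x" for x
  have co: "co x \<in> U" "nf (co x) = x" if "x \<in> carrier G" for x
    using that im inv_into_into[of x nf U] f_inv_into_f[of x nf U] by (simp_all add: co_def)
  have co_nf: "co (nf u) = rd u" for u
    using inv_into_f_f[OF inj rd[of u]] nf_rd by (simp add: co_def)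
  define v where "v x t = int (co x t)" for x t
  define e where "e t = nf (\<lambda>s. if s = t then 1 else 0)" for t
  show ?thesis
  proof (rule schur_multiplier_lower_bound[OF prime_p odd_p, where v = v and e = e])
    fix x y and t :: nat assume c: "x \<in> carrier G" "y \<in> carrier G" "t < 5"
    have "x \<otimes> y = nf (mu (co x) (co y))" using nf_mult[of "co x" "co y"] co c by simp
    then have "co (x \<otimes> y) t = mu (co x) (co y) t mod p"
      using co_nf c by (simp add: rd_def)
    then have "v (x \<otimes> y) t mod int p = int (mu (co x) (co y) t) mod int p"
      by (simp add: v_def zmod_int)
    also have "int (mu (co x) (co y) t) = heis_mult (v x) (v y) t"
      by (simp add: mu_def heis_mult_def v_def)
    finally show "v (x \<otimes> y) t mod int p = heis_mult (v x) (v y) t mod int p" .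
  next
    show "e t \<in> carrier G" for t using nfc by (simp add: e_def)
    show "v (e t) t' = (if t = t' then 1 else 0)" if "t < 5" "t' < 5" for t t'
      using that p_gt_1 by (simp add: v_def e_def co_nf rd_def)
    show "e 0 \<otimes> e 1 = e 1 \<otimes> e 0" "e 2 \<in> center G" "e 3 \<in> center G"
      using ab wcen by (simp_all only: e_def nf_gen)
  qed (rule fin)
qed

end

section \<open>Case distinction by Frattini index, nilpotency class and exponent\<close>

theorem theorem3p4:
  fixes G :: "('a, 'b) monoid_scheme" and p :: nat
  assumes "Factorial_Ring.prime p" and "odd p"
    and "group G"
    and "card (carrier G) = p ^ 5"
    and "card (derived G (carrier G)) \<ge> p ^ 2"
  shows "schur_multiplier_order G \<noteq> p ^ 5"
proof -
  interpret p_group G p 5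
    unfolding p_group_def p_group_axioms_def using assms by blast
  let ?D = "derived G (carrier G)" and ?F = "frattini G p"
  have lt: "p ^ 4 < p ^ 5" "p ^ 5 < p ^ 6" using p_gt_1 by simp_all
  have "card (schur_multiplier G) \<noteq> p ^ 5"
  proof (cases "p ^ 5 \<le> card ?F * p ^ 2")
    case True
    then have "p * card (schur_multiplier G) \<le> p * p ^ 4"
      using schur_multiplier_rank_2_order_p5(2) by (simp add: power_numeral_reduce)
    then have "card (schur_multiplier G) \<le> p ^ 4" using p_gt_1 by simp
    then show ?thesis using lt by linarith
  next
    case False
    \<comment> \<open>The order of the Frattini subgroup is now at most \<open>p ^ 2\<close>, while
      the derived subgroup inside it has order at least \<open>p ^ 2\<close>. So the two coincide,
      and all \<open>p\<close>-th powers lie in the derived subgroup.\<close>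
    obtain i where i: "card ?F = p ^ i" by (rule subgroup_card[OF subgroup_frattini])
    then have "p ^ (i + 2) < p ^ 5" using False by (simp only: power_add not_le)
    then have "i < 3" using power_less_imp_less_exp[OF p_gt_1, of "i + 2" 5] by simp
    then have "card ?F \<le> p ^ 2" using i p_gt_1 by (simp add: power_increasing)
    then have DF: "?D = ?F" and D: "card ?D = p ^ 2"
      using card_seteq[OF finite_subgroup[OF subgroup_frattini] derived_subset_frattini]
        card_mono[OF finite_subgroup[OF subgroup_frattini] derived_subset_frattini] assms(5)
      by auto
    show ?thesis
    proof (cases "?D \<subseteq> center G")
      case False
      then show ?thesis using schur_multiplier_class_3(2)[OF refl D] lt by linarith
    next
      case True
      then interpret C: class_two_p_group G p 5
        using assms(2) pow_in_frattini DF by unfold_locales auto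
      show ?thesis
      proof (cases "\<exists>u\<in>carrier G. u [^]\<^bsub>G\<^esub> p \<noteq> \<one>\<^bsub>G\<^esub>")
        case True
        then show ?thesis using C.schur_multiplier_power_nontrivial(2)[OF refl D] lt
          by (metis not_le)
      next
        case False
        then interpret E: exponent_p_group G p 5 using D by unfold_locales auto
        show ?thesis
        proof
          assume eq: "card (schur_multiplier G) = p ^ 5"
          \<comment> \<open>An infinite set would have cardinality 0, so the assumed value itself
            gives the finiteness that the lower bound requires.\<close>
          then have "finite (schur_multiplier G)"
            using p_gt_1 by (intro card_ge_0_finite) simp
          then show False using E.schur_multiplier_exponent_p eq lt by simp
        qed
      qed
    qed
  qed
  then show ?thesis by (simp add: schur_multiplier_order_def)
qed

end
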